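(* Let $m\ge2$, $c>-1$, and let $M_\ell\in\mathcal{M}_\ell$ be a spherical monogenic of degree $\ell$. Let $f(x)=f(r)$, $r=|x|$, be a radial (scalar-valued) function such that the functions transformed below lie in $\mathcal{L}^2_{0,c}(\mathbb{R}^m)$ and the integrals below converge absolutely. Then the deformed Fourier transforms of $f(r)M_\ell$ and $f(r)\underline{x}M_\ell$ are $$\mathcal{F}_{0,c}(f(r)M_\ell)(y)=e^{-\frac{i\pi\ell}{2(1+c)}}M_\ell(\underline{y}')\int_0^{+\infty}r^{\ell}f(r)\,z^{-\frac{\delta-2}{2}}J_{\frac{\gamma_\ell}{2}-1}(z)\,h(r)\,r^{m-1}\,dr,$$ $$\mathcal{F}_{0,c}(f(r)\underline{x}M_\ell)(y)=-i\,e^{-\frac{i\pi\ell}{2(1+c)}}\,\underline{y}'M_\ell(\underline{y}')\int_0^{+\infty}r^{\ell+1}f(r)\,z^{-\frac{\delta-2}{2}}J_{\frac{\gamma_\ell}{2}}(z)\,h(r)\,r^{m-1}\,dr,$$ where $\underline{y}=s\underline{y}'$ with $s=|y|$, $\underline{y}'\in\mathbb{S}^{m-1}$, and $z=rs$.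
   Context: $\mathcal{C}l_m$ is the real associative Clifford algebra generated by $e_1,\dots,e_m$ with $e_ie_j+e_je_i=0$ ($i\ne j$), $e_i^2=-1$. Functions take values in $\mathbb{C}\otimes\mathcal{C}l_m$. A point $x\in\mathbb{R}^m$ is identified with $\underline{x}=\sum_i e_ix_i$, $r=|x|$. $\partial_{\underline{x}}=\sum_i e_i\partial_{x_i}$. Constants: $\delta=1+\frac{m-1}{1+c}$, $\lambda=\frac{m-2}{2}$, $\gamma_\ell=\frac{2}{1+c}\left(\ell+\frac{m-2}{2}\right)+\frac{c+2}{1+c}$, $\sigma_m=2\pi^{m/2}/\Gamma(m/2)$; $h(r)=r^{1-\frac{1+mc}{1+c}}$; $\mathcal{L}^2_{0,c}(\mathbb{R}^m)=L^2(\mathbb{R}^m,h(r)dx)\otimes\mathcal{C}l_m$. $\mathcal{M}_\ell$ is the space of $\mathcal{C}l_m$-valued homogeneous polynomials $M$ of degree $\ell$ on $\mathbb{R}^m$ with $\partial_{\underline{x}}M=0$ (spherical monogenics). The deformed Fourier transform is $\mathcal{F}_{0,c}(f)(y)=\sigma_m^{-1}\int_{\mathbb{R}^m}K(x,y)f(x)h(|x|)\,dx$ (in the distributional sense on $\mathcal{L}^2_{0,c}(\mathbb{R}^m)$), where $K(x,y)=A(z,w)+(\underline{x}\wedge\underline{y})B(z,w)$, $z=|x||y|$, $w=\langle x,y\rangle/z$, $\underline{x}\wedge\underline{y}=\sum_{j<k}e_je_k(x_jy_k-x_ky_j)$, $$A=\sum_{k\ge0}z^{-\frac{\delta-2}{2}}\left(\alpha_k\tfrac{k+2\lambda}{2\lambda}J_{\frac{\gamma_k}{2}-1}(z)-i\alpha_{k-1}\tfrac{k}{2\lambda}J_{\frac{\gamma_{k-1}}{2}}(z)\right)C_k^{\lambda}(w),$$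 $$B=\sum_{k\ge1}z^{-\frac{\delta}{2}}\left(-\alpha_kJ_{\frac{\gamma_k}{2}-1}(z)-i\alpha_{k-1}J_{\frac{\gamma_{k-1}}{2}}(z)\right)C_{k-1}^{\lambda+1}(w),$$ with $\alpha_{-1}=0$, $\alpha_k=e^{-\frac{i\pi k}{2(1+c)}}$, $C_k^\lambda$ Gegenbauer polynomials, $J_\nu$ Bessel functions (for $m=2$ the expressions with $\lambda$ in the denominator are limits $\lambda\to0$). *)

theory Defs
  imports "HOL-Analysis.Analysis"
begin

section \<open>The complexified Clifford algebra\<close>

text \<open>
  With \<open>m = CARD('n)\<close>, the algebra \<open>\<complex> \<otimes> Cl\<^sub>m\<close> is modelled on the \<open>2\<^sup>m\<close>-dimensional space
  of coefficient vectors with respect to the basis \<open>e\<^sub>A = e\<^sub>i\<^sub>1 \<cdots> e\<^sub>i\<^sub>k\<close>, where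
  \<open>A = {i\<^sub>1 < \<cdots> < i\<^sub>k}\<close>. The linear order on the index type only serves to fix this basis.
  The product already carried by \<^typ>\<open>complex ^ ('n set)\<close> is the componentwise one, which is not
  the Clifford product; the latter is \<open>\<odot>\<close> below.
\<close>

type_synonym 'n cl = "complex ^ ('n set)"

text \<open>
  \<open>e\<^sub>A e\<^sub>B = cl_sign A B e\<^sub>C\<close> with \<open>C\<close> the symmetric difference: every pair \<open>b < a\<close> costs a
  transposition, and every common index a factor \<open>e\<^sub>a\<^sup>2 = -1\<close>.
\<close>

definition cl_sign :: "'n::{finite,linorder} set \<Rightarrow> 'n set \<Rightarrow> complex" where
  "cl_sign A B = (\<Prod>a\<in>A. \<Prod>b\<in>B. if b \<le> a then -1 else 1)"

definition cl_mult :: "'n::{finite,linorder} cl \<Rightarrow> 'n cl \<Rightarrow> 'n cl" (infixl "\<odot>" 70) where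
  "u \<odot> v = (\<chi> C. \<Sum>A\<in>UNIV. cl_sign A (sym_diff A C) * u $ A * v $ (sym_diff A C))"

definition cl_one :: "'n::{finite,linorder} cl" where
  "cl_one = axis {} 1"

definition cl_e :: "'n::{finite,linorder} \<Rightarrow> 'n::{finite,linorder} cl" where
  "cl_e i = axis {i} 1"

text \<open>The real subalgebra \<open>Cl\<^sub>m\<close>.\<close>

definition cl_real :: "'n::{finite,linorder} cl set" where
  "cl_real = {u. \<forall>A. u $ A \<in> \<real>}"

definition cl_vec :: "real ^ 'n::{finite,linorder} \<Rightarrow> 'n cl" where
  "cl_vec x = (\<Sum>i\<in>UNIV. (x $ i) *\<^sub>R cl_e i)"

definition cl_wedge :: "real ^ 'n::{finite,linorder} \<Rightarrow> real ^ 'n::{finite,linorder} \<Rightarrow> 'n cl" where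
  "cl_wedge x y =
     (\<Sum>(j, k) \<in> {(j, k). j < k}. (x $ j * y $ k - x $ k * y $ j) *\<^sub>R (cl_e j \<odot> cl_e k))"

text \<open>
  The following facts confirm that \<open>\<odot>\<close> is the Clifford product: it is bilinear, associative and
  unital, satisfies the defining relations, and the \<open>2\<^sup>m\<close> ordered products of generators are the
  standard basis.
\<close>

lemma sym_diff_cancel: "sym_diff A (sym_diff A C) = C"
  by auto

lemma prod_sym_diff:
  fixes g :: "'a::finite \<Rightarrow> complex"
  assumes "\<And>a. g a * g a = 1"
  shows "(\<Prod>a\<in>sym_diff A B. g a) = (\<Prod>a\<in>A. g a) * (\<Prod>a\<in>B. g a)"
proof -
  have A: "(\<Prod>a\<in>A. g a) = (\<Prod>a\<in>A - B. g a) * (\<Prod>a\<in>A \<inter> B. g a)"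
    by (subst prod.union_disjoint [symmetric]) (auto intro: prod.cong)
  have B: "(\<Prod>a\<in>B. g a) = (\<Prod>a\<in>B - A. g a) * (\<Prod>a\<in>A \<inter> B. g a)"
    by (subst prod.union_disjoint [symmetric]) (auto intro: prod.cong)
  have S: "(\<Prod>a\<in>sym_diff A B. g a) = (\<Prod>a\<in>A - B. g a) * (\<Prod>a\<in>B - A. g a)"
    by (subst prod.union_disjoint [symmetric]) auto
  have "(\<Prod>a\<in>A \<inter> B. g a) * (\<Prod>a\<in>A \<inter> B. g a) = 1"
    by (simp add: prod.distrib [symmetric] assms)
  then show ?thesis
    unfolding A B S by (simp add: mult.assoc mult.left_commute)
qed

lemma cl_sign_left: "cl_sign (sym_diff A A') B = cl_sign A B * cl_sign A' B"
  unfolding cl_sign_def by (rule prod_sym_diff) (auto simp: prod.distrib [symmetric] intro!: prod.neutral)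

lemma cl_sign_right: "cl_sign A (sym_diff B B') = cl_sign A B * cl_sign A B'"
proof -
  have "cl_sign A (sym_diff B B') =
      (\<Prod>a\<in>A. (\<Prod>b\<in>B. if b \<le> a then -1 else 1) * (\<Prod>b\<in>B'. if b \<le> a then -1 else 1))"
    unfolding cl_sign_def by (intro prod.cong refl prod_sym_diff) auto
  then show ?thesis
    by (simp add: cl_sign_def prod.distrib)
qed

lemma cl_mult_assoc: "(u \<odot> v) \<odot> w = u \<odot> (v \<odot> w)"
proof -
  have "((u \<odot> v) \<odot> w) $ D = (u \<odot> (v \<odot> w)) $ D" for D
  proof -
    have "((u \<odot> v) \<odot> w) $ D = (\<Sum>C\<in>UNIV. \<Sum>A\<in>UNIV. cl_sign C (sym_diff C D) *
        (cl_sign A (sym_diff A C) * u $ A * v $ (sym_diff A C)) * w $ (sym_diff C D))"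
      by (simp add: cl_mult_def sum_distrib_left sum_distrib_right)
    also have "\<dots> = (\<Sum>A\<in>UNIV. \<Sum>C\<in>UNIV. cl_sign C (sym_diff C D) *
        (cl_sign A (sym_diff A C) * u $ A * v $ (sym_diff A C)) * w $ (sym_diff C D))"
      by (rule sum.swap)
    also have "\<dots> = (\<Sum>A\<in>UNIV. \<Sum>B\<in>UNIV. cl_sign A (sym_diff A D) * u $ A *
        (cl_sign B (sym_diff B (sym_diff A D)) * v $ B * w $ (sym_diff B (sym_diff A D))))"
    proof (rule sum.cong [OF refl])
      fix A :: "'a set"
      have bij: "bij_betw (\<lambda>B. sym_diff A B) UNIV UNIV"
        by (rule bij_betw_byWitness [where f' = "\<lambda>B. sym_diff A B"]) auto
      have "(\<Sum>C\<in>UNIV. cl_sign C (sym_diff C D) *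
          (cl_sign A (sym_diff A C) * u $ A * v $ (sym_diff A C)) * w $ (sym_diff C D)) =
        (\<Sum>B\<in>UNIV. cl_sign (sym_diff A B) (sym_diff (sym_diff A B) D) *
          (cl_sign A B * u $ A * v $ B) * w $ (sym_diff (sym_diff A B) D))"
        by (subst sum.reindex_bij_betw [OF bij, symmetric]) (simp only: sym_diff_cancel)
      also have "\<dots> = (\<Sum>B\<in>UNIV. cl_sign A (sym_diff A D) * u $ A *
        (cl_sign B (sym_diff B (sym_diff A D)) * v $ B * w $ (sym_diff B (sym_diff A D))))"
      proof (rule sum.cong [OF refl])
        fix B :: "'a set"
        define E where "E = sym_diff B (sym_diff A D)"
        have 1: "sym_diff (sym_diff A B) D = E" and 2: "sym_diff A D = sym_diff B E"
          unfolding E_def by auto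
        show "cl_sign (sym_diff A B) (sym_diff (sym_diff A B) D) *
            (cl_sign A B * u $ A * v $ B) * w $ (sym_diff (sym_diff A B) D) =
          cl_sign A (sym_diff A D) * u $ A *
            (cl_sign B (sym_diff B (sym_diff A D)) * v $ B * w $ (sym_diff B (sym_diff A D)))"
          unfolding 1 E_def [symmetric] unfolding 2
          by (simp only: cl_sign_left cl_sign_right) (simp add: mult_ac)
      qed
      finally show "(\<Sum>C\<in>UNIV. cl_sign C (sym_diff C D) *
          (cl_sign A (sym_diff A C) * u $ A * v $ (sym_diff A C)) * w $ (sym_diff C D)) =
        (\<Sum>B\<in>UNIV. cl_sign A (sym_diff A D) * u $ A *
        (cl_sign B (sym_diff B (sym_diff A D)) * v $ B * w $ (sym_diff B (sym_diff A D))))" .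
    qed
    also have "\<dots> = (u \<odot> (v \<odot> w)) $ D"
      by (simp add: cl_mult_def sum_distrib_left)
    finally show ?thesis .
  qed
  then show ?thesis
    by (simp add: vec_eq_iff)
qed

lemma cl_mult_add_left: "(u + v) \<odot> w = u \<odot> w + v \<odot> w"
  and cl_mult_add_right: "u \<odot> (v + w) = u \<odot> v + u \<odot> w"
  and cl_mult_scale_left: "(a *s u) \<odot> v = a *s (u \<odot> v)"
  and cl_mult_scale_right: "u \<odot> (a *s v) = a *s (u \<odot> v)"
  by (simp_all add: cl_mult_def vec_eq_iff algebra_simps sum.distrib sum_distrib_left)

lemma cl_mult_axis:
  "axis A a \<odot> axis B b = axis (sym_diff A B) (cl_sign A B * a * b)"
proof -
  have "(axis A a \<odot> axis B b) $ C = axis (sym_diff A B) (cl_sign A B * a * b) $ C" for C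
  proof -
    have "(axis A a \<odot> axis B b) $ C =
        (\<Sum>A'\<in>UNIV. if A' = A then cl_sign A (sym_diff A C) * a * axis B b $ (sym_diff A C) else 0)"
      unfolding cl_mult_def vec_lambda_beta by (rule sum.cong [OF refl]) (simp add: axis_def)
    also have "\<dots> = cl_sign A (sym_diff A C) * a * axis B b $ (sym_diff A C)"
      by simp
    also have "sym_diff A C = B \<longleftrightarrow> C = sym_diff A B"
      by auto
    then have "cl_sign A (sym_diff A C) * a * axis B b $ (sym_diff A C) =
        axis (sym_diff A B) (cl_sign A B * a * b) $ C"
      unfolding axis_def vec_lambda_beta by (cases "C = sym_diff A B") simp_all
    finally show ?thesis .
  qed
  then show ?thesis
    by (simp add: vec_eq_iff)
qed

lemma vec_cl_basis: "u = (\<Sum>A\<in>UNIV. (u $ A) *s axis A (1::complex))"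
  by (simp add: vec_eq_iff axis_def if_distrib cong: if_cong)

lemma cl_mult_one_left: "cl_one \<odot> u = u"
  for u :: "'n::{finite,linorder} cl"
proof -
  have "(cl_one \<odot> u) $ C = (\<Sum>A\<in>(UNIV :: 'n set set). if A = {} then u $ C else 0)" for C
    unfolding cl_mult_def cl_one_def vec_lambda_beta
    by (rule sum.cong [OF refl]) (simp add: axis_def cl_sign_def)
  then show ?thesis by (simp add: vec_eq_iff)
qed

lemma cl_mult_one_right: "u \<odot> cl_one = u"
proof -
  have *: "sym_diff A C = {} \<longleftrightarrow> A = C" for A C :: "'a set" by auto
  have "(u \<odot> cl_one) $ C = (\<Sum>A\<in>UNIV. if A = C then u $ C else 0)" for C
    unfolding cl_mult_def cl_one_def vec_lambda_beta
  proof (rule sum.cong [OF refl])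
    fix A
    show "cl_sign A (sym_diff A C) * u $ A * axis {} 1 $ (sym_diff A C) = (if A = C then u $ C else 0)"
      unfolding axis_def vec_lambda_beta * by (simp add: cl_sign_def)
  qed
  then show ?thesis by (simp add: vec_eq_iff)
qed

lemma cl_e_square: "cl_e i \<odot> cl_e i = - cl_one"
  unfolding cl_e_def cl_one_def cl_mult_axis by (simp add: cl_sign_def vec_eq_iff axis_def)

lemma cl_e_anticommute:
  assumes "i \<noteq> j"
  shows "cl_e i \<odot> cl_e j + cl_e j \<odot> cl_e i = 0"
proof -
  have "sym_diff {i} {j} = {i, j}" "sym_diff {j} {i} = {i, j}"
    using assms by auto
  then show ?thesis
    using assms unfolding cl_e_def cl_mult_axis by (auto simp: cl_sign_def vec_eq_iff axis_def)
qed

lemma axis_eq_ordered_product: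
  "axis A 1 = foldr (\<lambda>i u. cl_e i \<odot> u) (sorted_list_of_set A) cl_one"
proof -
  have "axis (set is) 1 = foldr (\<lambda>i u. cl_e i \<odot> u) is cl_one"
    if "sorted_wrt (<) is" for "is" :: "'a list"
    using that
  proof (induction "is")
    case Nil
    then show ?case by (simp add: cl_one_def)
  next
    case (Cons i "is")
    then have "cl_e i \<odot> axis (set is) 1 = axis (set (i # is)) 1"
    proof -
      have less: "\<forall>j\<in>set is. i < j"
        using Cons.prems by simp
      then have "cl_sign {i} (set is) = 1"
        unfolding cl_sign_def by (auto intro!: prod.neutral)
      moreover have "sym_diff {i} (set is) = set (i # is)"
        using less by auto
      ultimately show ?thesis
        unfolding cl_e_def cl_mult_axis by simp
    qed
    with Cons show ?case by simp
  qed
  from this [of "sorted_list_of_set A"] show ?thesis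
    by simp
qed


section \<open>Spherical monogenics\<close>

definition cl_dirac :: "(real ^ 'n::{finite,linorder} \<Rightarrow> 'n cl) \<Rightarrow> real ^ 'n::{finite,linorder} \<Rightarrow> 'n cl" where
  "cl_dirac M x =
     (\<Sum>i\<in>UNIV. cl_e i \<odot> vector_derivative (\<lambda>t. M (x + t *\<^sub>R axis i 1)) (at 0))"

text \<open>The functions \<open>a\<close> are multi-indices, and \<open>p a \<in> Cl\<^sub>m\<close> is the coefficient of \<open>x\<^sup>a\<close>.\<close>

definition homogeneous_cl_poly :: "nat \<Rightarrow> (real ^ 'n::{finite,linorder} \<Rightarrow> 'n cl) set" where
  "homogeneous_cl_poly l =
     {M. \<exists>p :: ('n \<Rightarrow> nat) \<Rightarrow> 'n cl. (\<forall>a. p a \<in> cl_real) \<and>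
        (\<forall>x. M x = (\<Sum>a | (\<Sum>i\<in>UNIV. a i) = l. (\<Prod>i\<in>UNIV. (x $ i) ^ a i) *\<^sub>R p a))}"

definition spherical_monogenics :: "nat \<Rightarrow> (real ^ 'n::{finite,linorder} \<Rightarrow> 'n cl) set" where
  "spherical_monogenics l = {M \<in> homogeneous_cl_poly l. \<forall>x. cl_dirac M x = 0}"


section \<open>Special functions\<close>

text \<open>
  The Bessel function of the first kind, for real order and argument \<open>z > 0\<close>. The reciprocal
  Gamma function vanishes at the poles of Gamma.
\<close>

definition bessel_J :: "real \<Rightarrow> real \<Rightarrow> real" where
  "bessel_J \<nu> z =
     (\<Sum>j. (-1) ^ j * rGamma (real j + \<nu> + 1) / fact j * (z / 2) powr (2 * real j + \<nu>))"

definition gegenbauer :: "nat \<Rightarrow> real \<Rightarrow> real \<Rightarrow> real" where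
  "gegenbauer k \<mu> w =
     (\<Sum>j\<le>k div 2. (-1) ^ j * pochhammer \<mu> (k - j) / (fact j * fact (k - 2 * j)) *
        (2 * w) ^ (k - 2 * j))"


section \<open>The kernel\<close>

definition def_delta :: "nat \<Rightarrow> real \<Rightarrow> real" where
  "def_delta m c = 1 + (real m - 1) / (1 + c)"

definition def_lambda :: "nat \<Rightarrow> real" where
  "def_lambda m = (real m - 2) / 2"

text \<open>
  The index is an integer because the kernel refers to \<open>\<alpha>\<^bsub>k-1\<^esub>\<close> and \<open>\<gamma>\<^bsub>k-1\<^esub>\<close> also for \<open>k = 0\<close>.
\<close>

definition def_gamma :: "nat \<Rightarrow> real \<Rightarrow> int \<Rightarrow> real" where
  "def_gamma m c k = 2 / (1 + c) * (of_int k + (real m - 2) / 2) + (c + 2) / (1 + c)"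

definition def_alpha :: "real \<Rightarrow> int \<Rightarrow> complex" where
  "def_alpha c k =
     (if k < 0 then 0 else exp (- (\<i> * of_real pi * of_int k / (2 * (1 + of_real c)))))"

definition def_sigma :: "nat \<Rightarrow> real" where
  "def_sigma m = 2 * pi powr (real m / 2) / Gamma (real m / 2)"

definition def_h :: "nat \<Rightarrow> real \<Rightarrow> real \<Rightarrow> real" where
  "def_h m c r = r powr (1 - (1 + real m * c) / (1 + c))"

text \<open>
  \<open>(k + 2\<lambda>)/(2\<lambda>) C\<^sub>k\<^sup>\<lambda>(w)\<close> and \<open>k/(2\<lambda>) C\<^sub>k\<^sup>\<lambda>(w)\<close>, understood as limits for \<open>\<lambda> = 0\<close>.
\<close>

definition gegenbauer_plus :: "nat \<Rightarrow> real \<Rightarrow> real \<Rightarrow> real" where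
  "gegenbauer_plus k \<mu> w =
     (if \<mu> = 0 then Lim (at 0) (\<lambda>\<nu>. (real k + 2 * \<nu>) / (2 * \<nu>) * gegenbauer k \<nu> w)
      else (real k + 2 * \<mu>) / (2 * \<mu>) * gegenbauer k \<mu> w)"

definition gegenbauer_minus :: "nat \<Rightarrow> real \<Rightarrow> real \<Rightarrow> real" where
  "gegenbauer_minus k \<mu> w =
     (if \<mu> = 0 then Lim (at 0) (\<lambda>\<nu>. real k / (2 * \<nu>) * gegenbauer k \<nu> w)
      else real k / (2 * \<mu>) * gegenbauer k \<mu> w)"

definition kernel_A :: "nat \<Rightarrow> real \<Rightarrow> real \<Rightarrow> real \<Rightarrow> complex" where
  "kernel_A m c z w =
     (\<Sum>k. of_real (z powr (- (def_delta m c - 2) / 2)) *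
        (def_alpha c (int k) * of_real (gegenbauer_plus k (def_lambda m) w) *
           of_real (bessel_J (def_gamma m c (int k) / 2 - 1) z)
         - \<i> * def_alpha c (int k - 1) * of_real (gegenbauer_minus k (def_lambda m) w) *
           of_real (bessel_J (def_gamma m c (int k - 1) / 2) z)))"

text \<open>The sum over \<open>k \<ge> 1\<close> is written with \<open>k = n + 1\<close>.\<close>

definition kernel_B :: "nat \<Rightarrow> real \<Rightarrow> real \<Rightarrow> real \<Rightarrow> complex" where
  "kernel_B m c z w =
     (\<Sum>n. of_real (z powr (- def_delta m c / 2)) *
        (- def_alpha c (int n + 1) * of_real (bessel_J (def_gamma m c (int n + 1) / 2 - 1) z)
         - \<i> * def_alpha c (int n) * of_real (bessel_J (def_gamma m c (int n) / 2) z)) *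
        of_real (gegenbauer n (def_lambda m + 1) w))"

definition kernel_K :: "real \<Rightarrow> real ^ 'n::{finite,linorder} \<Rightarrow> real ^ 'n::{finite,linorder} \<Rightarrow> 'n cl" where
  "kernel_K c x y =
     (let z = norm x * norm y; w = (x \<bullet> y) / z in
        kernel_A CARD('n) c z w *s cl_one + kernel_B CARD('n) c z w *s cl_wedge x y)"


section \<open>The deformed Fourier transform\<close>

text \<open>Complex-valued, i.e. with values in \<open>\<complex> \<otimes> Cl\<^sub>m\<close>.\<close>

definition L2_0c :: "real \<Rightarrow> (real ^ 'n::{finite,linorder} \<Rightarrow> 'n cl) set" where
  "L2_0c c = {u. u \<in> borel_measurable lborel \<and>
     integrable lborel (\<lambda>x. def_h CARD('n) c (norm x) * (norm (u x))\<^sup>2)}"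

text \<open>
  For \<open>u \<in> L2_0c c\<close> the integral of \<open>K(x,y) u(x) h(|x|)\<close> over the whole space need not converge
  absolutely. It is therefore read as the limit of the integrals over balls (which do converge
  absolutely); it coincides with the Lebesgue integral whenever the latter exists, see
  \<open>deformed_fourier_eq_integral\<close>.
\<close>

definition deformed_fourier ::
    "real \<Rightarrow> (real ^ 'n::{finite,linorder} \<Rightarrow> 'n cl) \<Rightarrow> real ^ 'n::{finite,linorder} \<Rightarrow> 'n cl" where
  "deformed_fourier c u y =
     Lim at_top (\<lambda>R. inverse (def_sigma CARD('n)) *\<^sub>R
       (LINT x:cball 0 R|lborel. def_h CARD('n) c (norm x) *\<^sub>R (kernel_K c x y \<odot> u x)))"

lemma deformed_fourier_eq_integral:
  fixes u :: "real ^ 'n::{finite,linorder} \<Rightarrow> 'n cl"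
  assumes "integrable lborel (\<lambda>x. def_h CARD('n) c (norm x) *\<^sub>R (kernel_K c x y \<odot> u x))"
  shows "deformed_fourier c u y = inverse (def_sigma CARD('n)) *\<^sub>R
    (LINT x|lborel. def_h CARD('n) c (norm x) *\<^sub>R (kernel_K c x y \<odot> u x))"
proof -
  let ?g = "\<lambda>x. def_h CARD('n) c (norm x) *\<^sub>R (kernel_K c x y \<odot> u x)"
  have "((\<lambda>R. LINT x|lborel. indicat_real (cball 0 R) x *\<^sub>R ?g x) \<longlongrightarrow> (LINT x|lborel. ?g x)) at_top"
  proof (rule integral_dominated_convergence_at_top)
    show "?g \<in> borel_measurable lborel" and "integrable lborel (\<lambda>x. norm (?g x))"
      using assms by (auto simp del: norm_scaleR)
    show "\<forall>\<^sub>F R in at_top. AE x in lborel. norm (indicat_real (cball 0 R) x *\<^sub>R ?g x) \<le> norm (?g x)"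
      by (intro always_eventually allI AE_I2) (simp add: indicator_def)
    show "AE x in lborel. ((\<lambda>R. indicat_real (cball 0 R) x *\<^sub>R ?g x) \<longlongrightarrow> ?g x) at_top"
    proof (rule AE_I2)
      fix x :: "real ^ 'n::{finite,linorder}"
      have "\<forall>\<^sub>F R in at_top. indicat_real (cball 0 R) x *\<^sub>R ?g x = ?g x"
        using eventually_ge_at_top [of "norm x"] by eventually_elim simp
      then show "((\<lambda>R. indicat_real (cball 0 R) x *\<^sub>R ?g x) \<longlongrightarrow> ?g x) at_top"
        by (rule tendsto_eventually)
    qed
    show "\<And>R. (\<lambda>x. indicat_real (cball 0 R) x *\<^sub>R ?g x) \<in> borel_measurable lborel"
      by (rule borel_measurable_scaleR [OF _ borel_measurable_integrable [OF assms]])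
        (auto intro!: borel_measurable_indicator)
  qed
  then show ?thesis
    unfolding deformed_fourier_def set_lebesgue_integral_def
    by (intro tendsto_Lim tendsto_scaleR tendsto_const) auto
qed

end

theory Submission
  imports Defs
begin

text \<open>
  The kernel is a series in the zonal functions \<open>U\<^sub>k + \<eta> \<omega> U\<^bsub>k-1\<^esub>\<close> and \<open>- \<eta> \<omega> U\<^bsub>k-1\<^esub> - U\<^bsub>k-2\<^esub>\<close>, where
  \<open>U\<^sub>k = C\<^sub>k\<^bsup>m/2\<^esup>(\<langle>\<omega>, \<eta>\<rangle>)\<close>, with Bessel functions of \<open>|x||y|\<close> as coefficients. In polar coordinates the
  transform therefore reduces to averaging these functions against \<open>M\<close> and \<open>\<omega> M\<close> over the sphere, and only
  one term of the series survives. The averages are moments of \<open>\<langle>\<omega>, \<eta>\<rangle>\<close> against harmonic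
  polynomials, since both \<open>M\<close> and \<open>x M\<close> are harmonic. They are computed recursively from the identity
  \<open>avg (\<partial>\<^sub>v F) = (d + m - 1) avg (\<langle>\<omega>, v\<rangle> F)\<close> for \<open>F\<close> homogeneous of degree \<open>d\<close>, which expresses
  that a derivative with compact support has integral zero. The Gegenbauer coefficients turn the
  moments into an alternating binomial sum, so that \<open>U\<^sub>k\<close> averages a harmonic \<open>H\<close> of degree \<open>l\<close> to \<open>H(\<eta>)\<close>
  if \<open>l \<le> k\<close> and \<open>k - l\<close> is even, and to zero otherwise.
\<close>

section \<open>Clifford algebra\<close>


text \<open>Integrals over the sphere are reduced to Lebesgue integrals over space: the sphere
  carries the image of the uniform measure on the unit ball, and a bump that is only continuously
  differentiable suffices to prove the identity for averages. Using the parameter m/2 = \<lambda> +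
  1 instead of \<lambda> removes the division by \<lambda>, so that m = 2 needs no separate
  argument; in the same basis the scalar part of the wedge product cancels every explicit factor
  <\<omega>, \<eta>> of the kernel. Termwise integration rests on two crude facts: Gegenbauer
  polynomials grow at most geometrically in k on [-1, 1], while the Bessel factors contain
  1/\<Gamma> at arguments growing like k/(1+c), which decays faster than any geometric sequence. The
  remaining obstacle is that the transform is a limit of integrals over balls. On a ball the kernel
  is bounded, and square integrability with the local integrability of the weight gives absolute
  convergence; the passage to the limit takes place only afterwards, in the radial integral, whose
  absolute convergence is assumed.\<close>

lemma scaleR_eq_scale: "a *\<^sub>R u = complex_of_real a *s (u :: complex ^ 'k)"
  unfolding vec_eq_iff vector_scaleR_component vector_smult_component
  by (simp add: scaleR_conv_of_real)


text \<open>Bilinearity implies boundedness in finite dimension; the interpretation below then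
  supplies sums, continuity and the product rule for the Clifford product.\<close>

lemma bounded_bilinear_cl_mult: "bounded_bilinear (cl_mult :: 'n::{finite,linorder} cl \<Rightarrow> _)"
proof -
  have "bilinear (cl_mult :: 'n cl \<Rightarrow> _)"
    unfolding bilinear_def
    by (auto intro!: linearI simp: cl_mult_add_left cl_mult_add_right scaleR_eq_scale
        cl_mult_scale_left cl_mult_scale_right)
  then show ?thesis
    by (simp add: bilinear_conv_bounded_bilinear)
qed

interpretation cl: bounded_bilinear "cl_mult :: 'n::{finite,linorder} cl \<Rightarrow> _"
  by (rule bounded_bilinear_cl_mult)

text \<open>In the double sum over products of generators, the pairs k < j are folded onto j < k by
  anticommutation, and the diagonal contributes the inner product because generators square to -1.
  This trades the wedge product in the kernel for the product of two vectors.\<close>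

lemma cl_vec_mult_cl_vec:
  fixes x y :: "real ^ 'n::{finite,linorder}"
  shows "cl_vec y \<odot> cl_vec x = - cl_wedge x y - (x \<bullet> y) *\<^sub>R cl_one"
proof -
  let ?t = "\<lambda>(j, k). (y $ j * x $ k) *\<^sub>R (cl_e j \<odot> cl_e k)"
  have "cl_vec y \<odot> cl_vec x = (\<Sum>j\<in>UNIV. \<Sum>k\<in>UNIV. ?t (j, k))"
    unfolding cl_vec_def cl.sum_left cl.sum_right
    by (subst sum.swap) (simp add: cl.scaleR_left cl.scaleR_right mult.commute)
  also have "\<dots> = sum ?t UNIV"
    by (simp add: sum.cartesian_product)
  also have "\<dots> = sum ?t ({(j, k). j < k} \<union> {(j, k). k < j} \<union> {(j, k). j = k})"
    by (rule arg_cong [where f = "sum ?t"]) (auto simp: neq_iff)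
  also have "\<dots> = sum ?t {(j, k). j < k} + sum ?t {(j, k). k < j} + sum ?t {(j, k). j = k}"
    by (subst sum.union_disjoint; auto)+
  also have "sum ?t {(j, k). j = k} = (\<Sum>j\<in>UNIV. ?t (j, j))"
    by (rule sum.reindex_bij_witness [where i = "\<lambda>j. (j, j)" and j = fst]) auto
  also have "\<dots> = - (x \<bullet> y) *\<^sub>R cl_one"
    by (simp add: cl_e_square inner_vec_def scaleR_sum_left sum_negf mult.commute)
  also have "sum ?t {(j, k). k < j} = (\<Sum>(j, k)\<in>{(j, k). j < k}. (y $ k * x $ j) *\<^sub>R (cl_e k \<odot> cl_e j))"
    by (rule sum.reindex_bij_witness [where i = prod.swap and j = prod.swap]) auto
  also have "\<dots> = (\<Sum>(j, k)\<in>{(j, k). j < k}. - (y $ k * x $ j) *\<^sub>R (cl_e j \<odot> cl_e k))"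
  proof (rule sum.cong [OF refl], clarify)
    fix j k :: 'n assume "j < k"
    then have "cl_e k \<odot> cl_e j = - (cl_e j \<odot> cl_e k)"
      using cl_e_anticommute [of k j] by (simp add: eq_neg_iff_add_eq_0)
    then show "(y $ k * x $ j) *\<^sub>R (cl_e k \<odot> cl_e j) = - (y $ k * x $ j) *\<^sub>R (cl_e j \<odot> cl_e k)"
      by simp
  qed
  also have "sum ?t {(j, k). j < k} + \<dots> = - cl_wedge x y"
    unfolding cl_wedge_def sum_negf [symmetric] sum.distrib [symmetric]
    by (rule sum.cong) (auto simp: algebra_simps)
  finally show ?thesis by simp
qed

lemma cl_wedge_self: "cl_wedge x x = 0"
  unfolding cl_wedge_def by (rule sum.neutral) (auto simp: mult.commute)

lemma cl_vec_square: "cl_vec x \<odot> cl_vec x = - (x \<bullet> x) *\<^sub>R cl_one"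
  by (simp add: cl_vec_mult_cl_vec cl_wedge_self)

section \<open>Homogeneous polynomials and directional derivatives\<close>

text \<open>Generating the polynomials by multiplication with coordinates makes homogeneity,
  differentiability and the symmetry of second derivatives plain inductions. The values lie in any
  Euclidean space, and zero has every degree, so that derivatives of constants and empty sums are
  covered.\<close>

inductive hpoly :: "nat \<Rightarrow> (real ^ 'n::finite \<Rightarrow> 'b::euclidean_space) \<Rightarrow> bool" where
  hpoly_zero: "hpoly d (\<lambda>x. 0)"
| hpoly_const: "hpoly 0 (\<lambda>x. v)"
| hpoly_coord: "hpoly d F \<Longrightarrow> hpoly (Suc d) (\<lambda>x. x $ i *\<^sub>R F x)"
| hpoly_add: "hpoly d F \<Longrightarrow> hpoly d G \<Longrightarrow> hpoly d (\<lambda>x. F x + G x)"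

text \<open>The expression that \<open>cl_dirac\<close> uses for v a basis vector, so that the Dirac
  equation becomes a statement about \<open>dird\<close> by unfolding alone.\<close>

definition dird :: "real ^ 'n::finite \<Rightarrow> (real ^ 'n \<Rightarrow> 'b::euclidean_space) \<Rightarrow> real ^ 'n \<Rightarrow> 'b" where
  "dird v F x = vector_derivative (\<lambda>t. F (x + t *\<^sub>R v)) (at 0)"

definition lap :: "(real ^ 'n::finite \<Rightarrow> 'b::euclidean_space) \<Rightarrow> real ^ 'n \<Rightarrow> 'b" where
  "lap F x = (\<Sum>i\<in>UNIV. dird (axis i 1) (dird (axis i 1) F) x)"

lemma hpoly_sum: "(\<And>a. a \<in> A \<Longrightarrow> hpoly d (F a)) \<Longrightarrow> hpoly d (\<lambda>x. \<Sum>a\<in>A. F a x)"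
proof (induction A rule: infinite_finite_induct)
  case (insert a A)
  have "hpoly d (F a)" "hpoly d (\<lambda>x. \<Sum>a\<in>A. F a x)"
    using insert.prems insert.IH by auto
  then have "hpoly d (\<lambda>x. F a x + (\<Sum>a\<in>A. F a x))"
    by (rule hpoly_add)
  then show ?case using insert.hyps by simp
next
  case empty
  show ?case by (simp only: sum.empty) (rule hpoly_zero)
next
  case (infinite A)
  show ?case by (simp only: sum.infinite [OF infinite.hyps]) (rule hpoly_zero)
qed

lemma hpoly_linear: "hpoly d F \<Longrightarrow> linear L \<Longrightarrow> hpoly d (\<lambda>x. L (F x))"
proof (induction rule: hpoly.induct)
  case (hpoly_coord d F i)
  then show ?case
    using hpoly.hpoly_coord [of d "\<lambda>x. L (F x)" i] by (simp add: linear_cmul)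
next
  case (hpoly_add d F G)
  then show ?case
    using hpoly.hpoly_add [of d "\<lambda>x. L (F x)" "\<lambda>x. L (G x)"] by (simp add: linear_add)
qed (simp_all add: linear_0 hpoly_zero hpoly_const)

lemma hpoly_scaleR: "hpoly d F \<Longrightarrow> hpoly d (\<lambda>x. a *\<^sub>R F x)"
  by (rule hpoly_linear) (auto intro: linearI simp: algebra_simps)

lemma hpoly_inner:
  assumes "hpoly d F" shows "hpoly (Suc d) (\<lambda>x. (x \<bullet> v) *\<^sub>R F x)"
proof -
  have "hpoly (Suc d) (\<lambda>x. \<Sum>i\<in>UNIV. x $ i *\<^sub>R (v $ i *\<^sub>R F x))"
    by (intro hpoly_sum hpoly.hpoly_coord hpoly_scaleR assms)
  then show ?thesis
    by (simp add: inner_vec_def scaleR_sum_left)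
qed

lemma hpoly_inner_power:
  assumes "hpoly d F" shows "hpoly (n + d) (\<lambda>x. (x \<bullet> v) ^ n *\<^sub>R F x)"
proof (induction n)
  case (Suc n)
  then show ?case using hpoly_inner [OF Suc, of v] by simp
qed (simp add: assms)

lemma hpoly_scaleR_arg: "hpoly d F \<Longrightarrow> F (a *\<^sub>R x) = a ^ d *\<^sub>R F x"
  by (induction rule: hpoly.induct) (auto simp: algebra_simps)

lemma hpoly_differentiable: "hpoly d F \<Longrightarrow> F differentiable at x"
proof (induction rule: hpoly.induct)
  case (hpoly_coord d F i)
  have "(\<lambda>x. x $ i) differentiable at x"
    using bounded_linear_imp_differentiable bounded_linear_vec_nth by blast
  then show ?case using hpoly_coord.IH by (rule differentiable_scaleR)
qed auto

lemma dird_eqI: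
  assumes "(F has_derivative F') (at x)" shows "dird v F x = F' v"
proof -
  have F: "(F has_derivative F') (at (x + 0 *\<^sub>R v))" using assms by simp
  have "((\<lambda>t. x + t *\<^sub>R v) has_derivative (\<lambda>t. t *\<^sub>R v)) (at 0)"
    by (auto intro!: derivative_eq_intros)
  from has_derivative_compose [OF this F]
  have "((\<lambda>t. F (x + t *\<^sub>R v)) has_derivative (\<lambda>t. F' (t *\<^sub>R v))) (at 0)" .
  moreover have "(\<lambda>t. F' (t *\<^sub>R v)) = (\<lambda>t. t *\<^sub>R F' v)"
    using has_derivative_linear [OF assms] by (simp add: linear_cmul)
  ultimately show ?thesis
    unfolding dird_def by (intro vector_derivative_at) (simp add: has_vector_derivative_def)
qed

lemma has_derivative_dird:
  assumes "F differentiable at x" shows "(F has_derivative (\<lambda>v. dird v F x)) (at x)"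
proof -
  obtain F' where F': "(F has_derivative F') (at x)"
    using assms unfolding differentiable_def by blast
  then have "(\<lambda>v. dird v F x) = F'"
    by (intro ext dird_eqI)
  with F' show ?thesis by simp
qed

lemma dird_add:
  assumes "F differentiable at x" "G differentiable at x"
  shows "dird v (\<lambda>x. F x + G x) x = dird v F x + dird v G x"
  by (rule dird_eqI [OF has_derivative_add [OF has_derivative_dird has_derivative_dird]]) fact+

lemma dird_sum:
  assumes "\<And>a. a \<in> A \<Longrightarrow> F a differentiable at x"
  shows "dird v (\<lambda>x. \<Sum>a\<in>A. F a x) x = (\<Sum>a\<in>A. dird v (F a) x)"
  by (rule dird_eqI [OF has_derivative_sum [OF has_derivative_dird [OF assms]]])

lemma dird_linear:
  assumes "F differentiable at x" "linear L"
  shows "dird v (\<lambda>x. L (F x)) x = L (dird v F x)"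
proof (rule dird_eqI)
  show "((\<lambda>x. L (F x)) has_derivative (\<lambda>v. L (dird v F x))) (at x)"
    by (rule bounded_linear.has_derivative [OF _ has_derivative_dird [OF assms(1)]])
      (use assms(2) in \<open>simp add: linear_conv_bounded_linear\<close>)
qed

lemma dird_coord:
  assumes "F differentiable at x"
  shows "dird v (\<lambda>x. x $ i *\<^sub>R F x) x = v $ i *\<^sub>R F x + x $ i *\<^sub>R dird v F x"
proof -
  have "((\<lambda>x. x $ i) has_derivative (\<lambda>x. x $ i)) (at x)"
    by (rule bounded_linear_imp_has_derivative) (rule bounded_linear_vec_nth)
  from dird_eqI [OF has_derivative_scaleR [OF this has_derivative_dird [OF assms]]]
  show ?thesis by simp
qed

lemma dird_const: "dird v (\<lambda>x. a) = (\<lambda>x. 0)"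
  by (rule ext, rule dird_eqI [OF has_derivative_const])

text \<open>Both claims go through one induction: since d - 1 is truncated, a coordinate times the
  derivative of a degree 0 polynomial would get the wrong degree unless that derivative is known to
  vanish.\<close>

lemma hpoly_dird_aux:
  "hpoly d F \<Longrightarrow> (d = 0 \<longrightarrow> dird v F = (\<lambda>x. 0)) \<and> hpoly (d - 1) (dird v F)"
proof (induction rule: hpoly.induct)
  case (hpoly_coord d F i)
  have eq: "dird v (\<lambda>x. x $ i *\<^sub>R F x) = (\<lambda>x. v $ i *\<^sub>R F x + x $ i *\<^sub>R dird v F x)"
    by (rule ext, rule dird_coord) (rule hpoly_differentiable [OF hpoly_coord.hyps])
  have "hpoly d (\<lambda>x. x $ i *\<^sub>R dird v F x)"
  proof (cases d)
    case 0
    with hpoly_coord.IH show ?thesis by (simp add: hpoly_zero)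
  next
    case (Suc e)
    with hpoly_coord.IH hpoly.hpoly_coord [of e "dird v F" i] show ?thesis by simp
  qed
  then show ?case
    unfolding eq using hpoly_coord.hyps by (simp add: hpoly_add hpoly_scaleR)
next
  case (hpoly_add d F G)
  have "dird v (\<lambda>x. F x + G x) = (\<lambda>x. dird v F x + dird v G x)"
    by (rule ext, rule dird_add) (use hpoly_differentiable hpoly_add.hyps in blast)+
  with hpoly_add.IH show ?case by (simp add: hpoly.hpoly_add)
qed (simp_all add: dird_const hpoly_zero hpoly_const)

lemma hpoly_dird: "hpoly d F \<Longrightarrow> hpoly (d - 1) (dird v F)"
  and dird_hpoly_0: "hpoly 0 F \<Longrightarrow> dird v F = (\<lambda>x. 0)"
  using hpoly_dird_aux by auto

lemma hpoly_continuous_on: "hpoly d F \<Longrightarrow> continuous_on A F"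
  by (metis continuous_at_imp_continuous_on differentiable_imp_continuous_within hpoly_differentiable)

text \<open>For a coordinate times F, applying the product rule twice gives an expression symmetric
  in the two directions up to the second derivative of F, so the symmetry follows by induction on
  the polynomial.\<close>

lemma dird_commute: "hpoly d F \<Longrightarrow> dird v (dird w F) = dird w (dird v F)"
proof (induction rule: hpoly.induct)
  case (hpoly_coord d F i)
  have d: "F differentiable at x" "dird u F differentiable at x" for u x
    using hpoly_differentiable hpoly_dird hpoly_coord.hyps by blast+
  have eq: "dird u (\<lambda>x. x $ i *\<^sub>R F x) = (\<lambda>x. u $ i *\<^sub>R F x + x $ i *\<^sub>R dird u F x)" for u
    by (rule ext, rule dird_coord) (rule d)
  have sc: "linear (\<lambda>y. (a::real) *\<^sub>R (y :: 'b))" for a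
    by (auto intro: linearI simp: algebra_simps)
  have "dird u (\<lambda>x. u' $ i *\<^sub>R F x + x $ i *\<^sub>R dird u' F x) x =
      u' $ i *\<^sub>R dird u F x + (u $ i *\<^sub>R dird u' F x + x $ i *\<^sub>R dird u (dird u' F) x)" for u u' x
  proof (subst dird_add)
    show "(\<lambda>x. u' $ i *\<^sub>R F x) differentiable at x" "(\<lambda>x. x $ i *\<^sub>R dird u' F x) differentiable at x"
      using hpoly_differentiable hpoly_scaleR hpoly.hpoly_coord hpoly_dird hpoly_coord.hyps by blast+
    show "dird u (\<lambda>x. u' $ i *\<^sub>R F x) x + dird u (\<lambda>x. x $ i *\<^sub>R dird u' F x) x =
      u' $ i *\<^sub>R dird u F x + (u $ i *\<^sub>R dird u' F x + x $ i *\<^sub>R dird u (dird u' F) x)"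
      by (simp add: dird_coord d dird_linear [OF d(1) sc])
  qed
  then show ?case
    unfolding eq using hpoly_coord.IH by (auto simp: fun_eq_iff)
next
  case (hpoly_add d F G)
  have d: "dird u F differentiable at x" "dird u G differentiable at x"
     "F differentiable at x" "G differentiable at x" for u x
    using hpoly_differentiable hpoly_dird hpoly_add.hyps by blast+
  have eq: "dird u (\<lambda>x. F x + G x) = (\<lambda>x. dird u F x + dird u G x)" for u
    by (rule ext, rule dird_add) (rule d)+
  have "dird u (\<lambda>x. dird u' F x + dird u' G x) = (\<lambda>x. dird u (dird u' F) x + dird u (dird u' G) x)" for u u'
    by (rule ext, rule dird_add) (rule d)+
  with hpoly_add.IH show ?case unfolding eq by simp
qed (auto simp: dird_const)

lemma dird_euler: "hpoly d F \<Longrightarrow> dird x F x = real d *\<^sub>R F x"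
proof (induction rule: hpoly.induct)
  case (hpoly_coord d F i)
  then show ?case by (simp add: dird_coord hpoly_differentiable algebra_simps)
next
  case (hpoly_add d F G)
  then show ?case
    by (simp add: dird_add [OF hpoly_differentiable hpoly_differentiable] algebra_simps)
qed (auto simp: dird_const)

lemma dird_vec_sum:
  assumes "F differentiable at x"
  shows "dird v F x = (\<Sum>i\<in>UNIV. v $ i *\<^sub>R dird (axis i 1) F x)"
proof -
  note lin = has_derivative_linear [OF has_derivative_dird [OF assms]]
  have "dird v F x = dird (\<Sum>i\<in>UNIV. v $ i *\<^sub>R axis i 1) F x"
    by (simp add: basis_expansion scalar_mult_eq_scaleR [symmetric])
  then show ?thesis
    by (simp add: linear_sum [OF lin] linear_cmul [OF lin])
qed

text \<open>Operators with constant coefficients commute. This keeps directional derivatives of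
  harmonic polynomials harmonic, as the recursion for the moments demands.\<close>

lemma lap_dird:
  assumes F: "hpoly d F" shows "lap (dird v F) = dird v (lap F)"
proof
  fix x
  let ?e = "\<lambda>i::'a. axis i (1::real)"
  have "dird v (lap F) x = dird v (\<lambda>x. \<Sum>i\<in>UNIV. dird (?e i) (dird (?e i) F) x) x"
    by (simp add: lap_def [abs_def])
  also have "\<dots> = (\<Sum>i\<in>UNIV. dird v (dird (?e i) (dird (?e i) F)) x)"
    by (rule dird_sum) (metis F hpoly_dird hpoly_differentiable)
  also have "\<dots> = lap (dird v F) x"
    unfolding lap_def
    by (rule sum.cong [OF refl]) (metis F hpoly_dird dird_commute)
  finally show "lap (dird v F) x = dird v (lap F) x" by simp
qed

lemma hpoly_homogeneous_cl_poly:
  assumes "M \<in> homogeneous_cl_poly l" shows "hpoly l M"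
proof -
  obtain p where M: "M = (\<lambda>x. \<Sum>a | (\<Sum>i\<in>UNIV. a i) = l. (\<Prod>i\<in>UNIV. (x $ i) ^ a i) *\<^sub>R p a)"
    using assms unfolding homogeneous_cl_poly_def by auto
  have pow: "hpoly (n + d) (\<lambda>x. (x $ i) ^ n *\<^sub>R F x)"
    if "hpoly d F" for F :: "(real, 'a) vec \<Rightarrow> 'a cl" and n d i
  proof (induction n)
    case (Suc n)
    show ?case using hpoly_coord [OF Suc, of i] by simp
  qed (simp add: that)
  have "hpoly (\<Sum>i\<in>I. a i) (\<lambda>x. (\<Prod>i\<in>I. (x $ i) ^ a i) *\<^sub>R p a)" for a I
  proof (induction I rule: infinite_finite_induct)
    case (insert i I)
    then show ?case using pow [OF insert.IH, of "a i" i] by simp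
  qed (auto simp: hpoly_const)
  then show ?thesis
    unfolding M by (intro hpoly_sum) blast
qed

section \<open>Monogenic polynomials are harmonic\<close>

lemma linear_cl_mult: "linear (\<lambda>u. a \<odot> u)"
  by (auto intro!: linearI simp: cl.add_right cl.scaleR_right)

lemma hpoly_cl_vec_mult: "hpoly l M \<Longrightarrow> hpoly (Suc l) (\<lambda>x. cl_vec x \<odot> M x)"
  unfolding cl_vec_def cl.sum_left cl.scaleR_left
  by (intro hpoly_sum hpoly_coord hpoly_linear [OF _ linear_cl_mult])

lemma spherical_monogenics_hpoly: "M \<in> spherical_monogenics l \<Longrightarrow> hpoly l M"
  by (simp add: spherical_monogenics_def hpoly_homogeneous_cl_poly)

lemma spherical_monogenics_dirac:
  "M \<in> spherical_monogenics l \<Longrightarrow> (\<Sum>i\<in>UNIV. cl_e i \<odot> dird (axis i 1) M x) = 0"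
  by (simp add: spherical_monogenics_def cl_dirac_def dird_def)

text \<open>The Dirac operator squares to minus the Laplacian: when the double sum over j, i is
  added to its transpose, the symmetry of \<open>D\<close> and anticommutation leave only the
  diagonal terms, each with the factor -2.\<close>

lemma lap_monogenic:
  fixes M :: "real ^ 'n::{finite,linorder} \<Rightarrow> 'n cl"
  assumes M: "M \<in> spherical_monogenics l" shows "lap M x = 0"
proof -
  let ?e = "\<lambda>i::'n. axis i (1::real)"
  note hp = spherical_monogenics_hpoly [OF M]
  define D where "D i j = dird (?e i) (dird (?e j) M) x" for i j
  have sym: "D i j = D j i" for i j
    unfolding D_def using dird_commute [OF hp] by metis
  have "dird (?e j) (\<lambda>x. \<Sum>i\<in>UNIV. cl_e i \<odot> dird (?e i) M x) x = (\<Sum>i\<in>UNIV. cl_e i \<odot> D j i)" for j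
  proof -
    have df: "dird (?e i) M differentiable at x" for i
      by (rule hpoly_differentiable [OF hpoly_dird [OF hp]])
    show ?thesis
      unfolding D_def
      by (subst dird_sum)
        (auto simp: dird_linear [OF df linear_cl_mult]
          intro: hpoly_differentiable [OF hpoly_linear [OF hpoly_dird [OF hp] linear_cl_mult]])
  qed
  then have z: "(\<Sum>i\<in>UNIV. cl_e i \<odot> D j i) = 0" for j
    by (simp add: spherical_monogenics_dirac [OF M] dird_const)
  have "0 = (\<Sum>j\<in>UNIV. cl_e j \<odot> (\<Sum>i\<in>UNIV. cl_e i \<odot> D j i))"
    by (simp add: z cl.zero_right)
  also have "\<dots> = (\<Sum>j\<in>UNIV. \<Sum>i\<in>UNIV. (cl_e j \<odot> cl_e i) \<odot> D j i)"
    by (simp add: cl.sum_right cl_mult_assoc)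
  finally have 1: "(\<Sum>j\<in>UNIV. \<Sum>i\<in>UNIV. (cl_e j \<odot> cl_e i) \<odot> D j i) = 0" by simp
  then have 2: "(\<Sum>j\<in>UNIV. \<Sum>i\<in>UNIV. (cl_e i \<odot> cl_e j) \<odot> D j i) = 0"
    by (subst sum.swap) (simp add: sym)
  have ac: "(cl_e j \<odot> cl_e i) \<odot> D j i + (cl_e i \<odot> cl_e j) \<odot> D j i = (if i = j then - 2 *\<^sub>R D j j else 0)" for i j
    by (cases "i = j")
      (auto simp: cl_e_square cl.minus_left cl_mult_one_left cl_e_anticommute cl.zero_left
        scaleR_2 simp flip: cl_mult_add_left)
  have "0 = (\<Sum>j\<in>UNIV. \<Sum>i\<in>UNIV. (cl_e j \<odot> cl_e i) \<odot> D j i + (cl_e i \<odot> cl_e j) \<odot> D j i)"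
    unfolding sum.distrib 1 2 by simp
  also have "\<dots> = - 2 *\<^sub>R lap M x"
    unfolding ac by (simp add: lap_def D_def scaleR_sum_right sum_negf)
  finally have "2 *\<^sub>R lap M x = 0" by simp
  then show ?thesis by (simp del: scaleR_2)
qed

text \<open>The product rule gives the Laplacian of x M as twice the Dirac derivative of M plus x
  times the Laplacian of M, and both vanish.\<close>

lemma lap_cl_vec_mult_monogenic:
  fixes M :: "real ^ 'n::{finite,linorder} \<Rightarrow> 'n cl"
  assumes M: "M \<in> spherical_monogenics l" shows "lap (\<lambda>x. cl_vec x \<odot> M x) x = 0"
proof -
  let ?e = "\<lambda>i::'n. axis i (1::real)"
  note hp = spherical_monogenics_hpoly [OF M]
  have e: "cl_vec (?e i) = cl_e i" for i
    by (simp add: cl_vec_def axis_def if_distrib if_distribR cong: if_cong)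
  have lin: "linear (cl_vec :: (real, 'n) vec \<Rightarrow> _)"
    by (auto intro!: linearI simp: cl_vec_def scaleR_add_left sum.distrib scaleR_sum_right)
  have prod: "dird v (\<lambda>x. cl_vec x \<odot> F x) x = cl_vec v \<odot> F x + cl_vec x \<odot> dird v F x"
    if "F differentiable at x" for F :: "(real, 'n) vec \<Rightarrow> 'n cl" and v x
  proof -
    have "(cl_vec has_derivative cl_vec) (at x)"
      using lin by (intro bounded_linear_imp_has_derivative) (simp add: linear_conv_bounded_linear)
    from dird_eqI [OF cl.FDERIV [OF this has_derivative_dird [OF that]]]
    show ?thesis by (simp add: add.commute)
  qed
  have df: "M differentiable at x" "dird v M differentiable at x" for v x
    using hpoly_differentiable hpoly_dird hp by blast+
  have 1: "dird v (\<lambda>x. cl_vec x \<odot> M x) = (\<lambda>x. cl_vec v \<odot> M x + cl_vec x \<odot> dird v M x)" for v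
    by (rule ext) (rule prod [OF df(1)])
  have 2: "dird v (\<lambda>x. cl_vec v \<odot> M x + cl_vec x \<odot> dird v M x) x =
      2 *\<^sub>R (cl_vec v \<odot> dird v M x) + cl_vec x \<odot> dird v (dird v M) x" for v
    by (subst dird_add)
      (auto simp: prod df dird_linear [OF df(1) linear_cl_mult] scaleR_2
        intro: hpoly_differentiable [OF hpoly_linear [OF hp linear_cl_mult]]
          hpoly_differentiable [OF hpoly_cl_vec_mult [OF hpoly_dird [OF hp]]])
  have "lap (\<lambda>x. cl_vec x \<odot> M x) x =
      2 *\<^sub>R (\<Sum>i\<in>UNIV. cl_e i \<odot> dird (?e i) M x) + cl_vec x \<odot> lap M x"
    unfolding lap_def 1 2 by (simp add: e sum.distrib scaleR_sum_right cl.sum_right)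
  then show ?thesis
    by (simp add: spherical_monogenics_dirac [OF M] lap_monogenic [OF M] cl.zero_right)
qed


section \<open>Polar coordinates\<close>

text \<open>The normalised surface measure, obtained by projecting the unit ball radially. It lives
  on the whole space, so membership in the sphere is an almost-everywhere statement.\<close>

definition sphere_measure :: "'a::euclidean_space measure" where
  "sphere_measure = distr (uniform_measure lborel (cball 0 1)) borel sgn"

text \<open>The distribution of the norm under Lebesgue measure. The total surface area, dimension
  times volume of the unit ball, sits here because the measure on the sphere has mass 1.\<close>

definition radial_measure :: "'a::euclidean_space itself \<Rightarrow> real measure" where
  "radial_measure _ = density lborel (\<lambda>r. ennreal (indicator {0<..} r *
     (real DIM('a) * measure lborel (cball (0::'a) 1) * r ^ (DIM('a) - 1))))"

lemma emeasure_cball_1: 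
  "emeasure lborel (cball (0::'a::euclidean_space) 1) \<noteq> 0" "emeasure lborel (cball (0::'a::euclidean_space) 1) \<noteq> \<infinity>"
proof -
  have "emeasure lborel (ball (0::'a) 1) \<le> emeasure lborel (cball (0::'a) 1)"
    by (intro emeasure_mono) auto
  moreover have "emeasure lborel (ball (0::'a) 1) \<noteq> 0"
    using emeasure_lborel_ball_finite[of "0::'a" 1] content_ball_pos[of 1 "0::'a"]
    by (auto simp: measure_def)
  ultimately show "emeasure lborel (cball (0::'a::euclidean_space) 1) \<noteq> 0"
    by (metis le_zero_eq)
  show "emeasure lborel (cball (0::'a::euclidean_space) 1) \<noteq> \<infinity>"
    using emeasure_lborel_cball_finite[of "0::'a" 1] by auto
qed

lemma sets_sphere_measure [measurable_cong, simp]: "sets sphere_measure = sets borel"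
  and space_sphere_measure [simp]: "space sphere_measure = UNIV"
  by (simp_all add: sphere_measure_def)

lemma sets_radial_measure [measurable_cong, simp]: "sets (radial_measure T) = sets borel"
  and space_radial_measure [simp]: "space (radial_measure T) = UNIV"
  by (simp_all add: radial_measure_def)

lemma emeasure_sphere_measure:
  assumes [measurable]: "B \<in> sets borel"
  shows "emeasure sphere_measure B = emeasure lborel (cball (0::'a::euclidean_space) 1 \<inter> sgn -` B) / emeasure lborel (cball (0::'a) 1)"
proof -
  have [measurable]: "sgn -` B \<inter> space borel \<in> sets borel"
    by measurable
  show ?thesis
    using \<open>sgn -` B \<inter> space borel \<in> sets borel\<close> unfolding sphere_measure_def
    by (subst emeasure_distr) (auto simp: emeasure_uniform_measure)
qed

lemma emeasure_sphere_measure_UNIV: "emeasure (sphere_measure :: 'a::euclidean_space measure) UNIV = 1"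
  using emeasure_cball_1 [where 'a='a] by (simp add: emeasure_sphere_measure less_top)

lemma finite_measure_sphere_measure: "finite_measure (sphere_measure :: 'a::euclidean_space measure)"
  by (rule finite_measureI) (simp add: emeasure_sphere_measure_UNIV)

lemma AE_sphere_measure: "AE \<omega> in (sphere_measure :: 'a::euclidean_space measure). norm \<omega> = 1"
proof -
  have "AE x in (lborel :: 'a measure). norm (sgn x) = 1"
    using AE_lborel_singleton [of "0::'a"] by eventually_elim (simp add: norm_sgn)
  then have "AE x in uniform_measure lborel (cball (0::'a) 1). norm (sgn x) = 1"
    by (intro AE_uniform_measureI) auto
  then show ?thesis
    unfolding sphere_measure_def by (subst AE_distr_iff) auto
qed

lemma emeasure_radial_measure_atMost:
  assumes "0 < R"
  shows "emeasure (radial_measure TYPE('a::euclidean_space)) {..R} =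
    ennreal (R ^ DIM('a)) * emeasure lborel (cball (0::'a) 1)"
proof -
  let ?V = "measure lborel (cball (0::'a) 1)" and ?n = "DIM('a)"
  have n: "?n > 0" by simp
  have "emeasure (radial_measure TYPE('a)) {..R} =
     (\<integral>\<^sup>+ r. ennreal (indicator {0<..} r * (real ?n * ?V * r ^ (?n - 1))) * indicator {..R} r \<partial>lborel)"
    unfolding radial_measure_def by (subst emeasure_density) auto
  also have "\<dots> = (\<integral>\<^sup>+ r. ennreal (real ?n * ?V * r ^ (?n - 1)) * indicator {0..R} r \<partial>lborel)"
    by (rule nn_integral_cong_AE) (use AE_lborel_singleton [of "0::real"] in \<open>eventually_elim, auto simp: indicator_def\<close>)
  also have "\<dots> = ennreal (?V * R ^ ?n - ?V * 0 ^ ?n)"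
    by (rule nn_integral_FTC_Icc [where F = "\<lambda>r. ?V * r ^ ?n"])
      (use assms in \<open>auto intro!: derivative_eq_intros\<close>)
  also have "\<dots> = ennreal (R ^ ?n) * ennreal ?V"
    using n assms by (simp add: power_0_left ennreal_mult mult.commute)
  also have "ennreal ?V = emeasure lborel (cball (0::'a) 1)"
    using emeasure_cball_1 [where 'a='a] by (simp add: emeasure_eq_ennreal_measure)
  finally show ?thesis .
qed

lemma emeasure_lborel_scale:
  fixes X :: "'a::euclidean_space set"
  assumes "0 < R" and X [measurable]: "X \<in> sets borel"
  shows "emeasure lborel X = ennreal (R ^ DIM('a)) * emeasure lborel ((\<lambda>x. R *\<^sub>R x) -` X)"
proof -
  have m: "(\<lambda>x. R *\<^sub>R x) -` X \<inter> space borel \<in> sets (borel :: 'a measure)" by measurable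
  have "emeasure lborel X = emeasure (density (distr lborel borel (\<lambda>x. 0 + R *\<^sub>R x)) (\<lambda>_. ennreal (\<bar>R\<bar> ^ DIM('a)))) X"
    using lborel_affine [of R "0::'a"] assms by simp
  also have "\<dots> = ennreal (R ^ DIM('a)) * emeasure lborel ((\<lambda>x. R *\<^sub>R x) -` X)"
    using assms m by (subst emeasure_density_const) (auto simp: emeasure_distr)
  finally show ?thesis .
qed

text \<open>For fixed B both sides are measures in A: a multiple of the radial measure, and the
  radial distribution of the cone over B. The half-lines {..R} generate the Borel sets and are
  closed under intersection, and on them the two agree because the cone is invariant under
  scaling.\<close>

lemma emeasure_polar_rectangle:
  fixes B :: "'a::euclidean_space set"
  assumes A: "A \<in> sets borel" and B: "B \<in> sets borel"
  shows "emeasure (radial_measure TYPE('a)) A * emeasure sphere_measure B =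
    emeasure lborel {x. norm x \<in> A \<and> sgn x \<in> B}"
proof -
  note B [measurable]
  let ?b = "emeasure sphere_measure B"
  define S where "S = sgn -` B"
  have S [measurable]: "S \<in> sets borel"
    using measurable_sets [of sgn borel borel B] B by (simp add: S_def)
  define P where "P = distr (density lborel (indicator S)) borel (norm :: 'a \<Rightarrow> real)"
  define Q where "Q = scale_measure ?b (radial_measure TYPE('a))"
  have P: "emeasure P X = emeasure lborel (norm -` X \<inter> S)" if X [measurable]: "X \<in> sets borel" for X
  proof -
    have m: "norm -` X \<in> sets (borel :: 'a measure)"
      using measurable_sets [of norm borel borel X] by simp
    then have "emeasure P X = (\<integral>\<^sup>+x. indicator S x * indicator (norm -` X) x \<partial>lborel)"
      unfolding P_def by (subst emeasure_distr) (auto simp: emeasure_density)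
    also have "\<dots> = (\<integral>\<^sup>+x. indicator (norm -` X \<inter> S) x \<partial>lborel)"
      by (intro nn_integral_cong) (auto simp: indicator_def)
    finally show ?thesis using m by simp
  qed
  have "P = Q"
  proof (rule measure_eqI_generator_eq [where E = "range atMost" and \<Omega> = UNIV and A = "\<lambda>i. {..real i}"])
    show "Int_stable (range (atMost :: real \<Rightarrow> _))"
      by (auto simp: Int_stable_def)
    show "sets P = sigma_sets UNIV (range atMost)" "sets Q = sigma_sets UNIV (range atMost)"
      unfolding P_def Q_def by (simp_all add: borel_eq_atMost)
    fix X assume "X \<in> range (atMost :: real \<Rightarrow> _)"
    then obtain R where X: "X = {..R}" by auto
    show "emeasure P X = emeasure Q X"
    proof (cases "0 < R")
      case True
      have "emeasure P X = ennreal (R ^ DIM('a)) * emeasure lborel ((\<lambda>x. R *\<^sub>R x) -` (cball 0 R \<inter> S))"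
      proof -
        have "norm -` X \<inter> S = cball 0 R \<inter> S" using X by auto
        with P [of X] X emeasure_lborel_scale [OF True, of "cball 0 R \<inter> S"] show ?thesis by auto
      qed
      also have "(\<lambda>x. R *\<^sub>R x) -` (cball 0 R \<inter> S) = cball 0 1 \<inter> sgn -` B"
        using True by (auto simp: S_def sgn_scaleR)
      also have "emeasure lborel (cball 0 1 \<inter> sgn -` B) = emeasure lborel (cball (0::'a) 1) * ?b"
      proof -
        have "emeasure lborel (cball (0::'a) 1) * ?b =
            emeasure lborel (cball 0 1 \<inter> sgn -` B) * emeasure lborel (cball (0::'a) 1) / emeasure lborel (cball (0::'a) 1)"
          unfolding emeasure_sphere_measure [OF B] ennreal_times_divide
          by (simp only: mult.commute)
        also have "\<dots> = emeasure lborel (cball 0 1 \<inter> sgn -` B)"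
          using emeasure_cball_1 [where 'a='a] by (intro mult_divide_eq_ennreal) auto
        finally show ?thesis by simp
      qed
      finally show ?thesis
        by (simp add: Q_def X emeasure_radial_measure_atMost [OF True] mult_ac)
    next
      \<comment> \<open>For R \<le> 0 only the origin can have norm at most R, and it is a null
        set.\<close>
      case False
      have "emeasure P X = 0"
      proof -
        have "norm -` X \<inter> S \<subseteq> {0}"
        proof
          fix x assume "x \<in> norm -` X \<inter> S"
          then have "norm x \<le> R" using X by simp
          then have "norm x \<le> 0" using False by linarith
          then show "x \<in> {0}" by simp
        qed
        then have "emeasure lborel (norm -` X \<inter> S) \<le> emeasure lborel {0::'a}"
          by (rule emeasure_mono) simp
        then show ?thesis using P [of X] X by simp
      qed
      moreover have "emeasure (radial_measure TYPE('a)) X = 0"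
      proof -
        have "emeasure (radial_measure TYPE('a)) X = (\<integral>\<^sup>+ r. ennreal (indicator {0<..} r *
            (real DIM('a) * measure lborel (cball (0::'a) 1) * r ^ (DIM('a) - 1))) * indicator X r \<partial>lborel)"
          unfolding radial_measure_def using X by (subst emeasure_density) auto
        also have "\<dots> = (\<integral>\<^sup>+ r. 0 \<partial>(lborel :: real measure))"
          by (intro nn_integral_cong) (use False X in \<open>auto split: split_indicator\<close>)
        finally show ?thesis by simp
      qed
      ultimately show ?thesis by (simp add: Q_def)
    qed
  next
    show "(\<Union>i. {..real i}) = UNIV"
      by (auto simp: real_arch_simple)
    fix i
    have "emeasure P {..real i} \<le> emeasure lborel (cball (0::'a) (real i))"
      using P [of "{..real i}"] by (auto intro!: emeasure_mono)
    also have "\<dots> < \<infinity>" by (rule emeasure_lborel_cball_finite)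
    finally show "emeasure P {..real i} \<noteq> \<infinity>" by simp
  qed auto
  then have "emeasure P A = emeasure Q A" by simp
  also have "emeasure P A = emeasure lborel {x. norm x \<in> A \<and> sgn x \<in> B}"
    unfolding P [OF A] by (rule arg_cong [where f = "emeasure lborel"]) (auto simp: S_def)
  finally show ?thesis by (simp add: Q_def mult.commute)
qed

lemma sigma_finite_radial_measure: "sigma_finite_measure (radial_measure TYPE('a::euclidean_space))"
proof
  let ?M = "radial_measure TYPE('a)"
  have "emeasure ?M {..real (Suc i)} \<noteq> \<infinity>" for i
    using emeasure_cball_1 [where 'a='a] by (simp add: emeasure_radial_measure_atMost ennreal_mult_eq_top_iff)
  moreover have "(\<Union>i. {..real (Suc i)}) = UNIV"
  proof -
    have "\<exists>i. x \<le> real (Suc i)" for x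
      using real_arch_simple [of x] by (metis nat_le_linear not_less_eq_eq of_nat_le_iff order_trans)
    then show ?thesis by auto
  qed
  ultimately show "\<exists>A. countable A \<and> A \<subseteq> sets ?M \<and> \<Union> A = space ?M \<and> (\<forall>a\<in>A. emeasure ?M a \<noteq> \<infinity>)"
    by (intro exI [of _ "range (\<lambda>i. {..real (Suc i)})"]) auto
qed

text \<open>A product of sigma-finite measures is determined by its values on rectangles, so the
  rectangle formula settles it.\<close>

lemma polar_coordinates:
  "distr lborel (borel \<Otimes>\<^sub>M borel) (\<lambda>x. (norm x, sgn x)) =
     radial_measure TYPE('a::euclidean_space) \<Otimes>\<^sub>M (sphere_measure :: 'a measure)"
proof (rule pair_measure_eqI [symmetric])
  interpret finite_measure "sphere_measure :: 'a measure" by (rule finite_measure_sphere_measure)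
  show "sigma_finite_measure (sphere_measure :: 'a measure)" ..
  show "sigma_finite_measure (radial_measure TYPE('a))" by (rule sigma_finite_radial_measure)
  show "sets (radial_measure TYPE('a) \<Otimes>\<^sub>M (sphere_measure :: 'a measure)) =
      sets (distr lborel (borel \<Otimes>\<^sub>M borel) (\<lambda>x::'a. (norm x, sgn x)))"
    by (simp cong: sets_pair_measure_cong)
  fix A B assume "A \<in> sets (radial_measure TYPE('a))" "B \<in> sets (sphere_measure :: 'a measure)"
  then have [measurable]: "A \<in> sets borel" "B \<in> sets borel" by simp_all
  have "(\<lambda>x. (norm x, sgn x)) -` (A \<times> B) \<inter> space lborel = {x::'a. norm x \<in> A \<and> sgn x \<in> B}"
    by auto
  then show "emeasure (radial_measure TYPE('a)) A * emeasure sphere_measure B =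
      emeasure (distr lborel (borel \<Otimes>\<^sub>M borel) (\<lambda>x::'a. (norm x, sgn x))) (A \<times> B)"
    by (subst emeasure_distr) (auto simp: emeasure_polar_rectangle)
qed

section \<open>Integration in polar coordinates\<close>

lemma
  fixes \<Phi> :: "real \<times> 'a::euclidean_space \<Rightarrow> 'b::{banach, second_countable_topology}"
  assumes \<Phi> [measurable]: "\<Phi> \<in> borel_measurable (borel \<Otimes>\<^sub>M borel)"
    and int: "integrable lborel (\<lambda>x. \<Phi> (norm x, sgn x))"
  shows integral_polar: "integral\<^sup>L lborel (\<lambda>x. \<Phi> (norm x, sgn x)) =
      (\<integral>r. (\<integral>\<omega>. \<Phi> (r, \<omega>) \<partial>sphere_measure) \<partial>radial_measure TYPE('a))"
    and integrable_polar: "integrable (radial_measure TYPE('a)) (\<lambda>r. \<integral>\<omega>. \<Phi> (r, \<omega>) \<partial>sphere_measure)"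
proof -
  interpret S: finite_measure "sphere_measure :: 'a measure" by (rule finite_measure_sphere_measure)
  interpret R: sigma_finite_measure "radial_measure TYPE('a)" by (rule sigma_finite_radial_measure)
  interpret pair_sigma_finite "radial_measure TYPE('a)" "sphere_measure :: 'a measure" ..
  have i: "integrable (radial_measure TYPE('a) \<Otimes>\<^sub>M sphere_measure) \<Phi>"
    using int by (subst polar_coordinates [symmetric]) (simp add: integrable_distr_eq)
  have "integral\<^sup>L lborel (\<lambda>x. \<Phi> (norm x, sgn x)) =
      integral\<^sup>L (radial_measure TYPE('a) \<Otimes>\<^sub>M sphere_measure) \<Phi>"
    by (subst polar_coordinates [symmetric]) (simp add: integral_distr)
  also have "\<dots> = (\<integral>r. (\<integral>\<omega>. \<Phi> (r, \<omega>) \<partial>sphere_measure) \<partial>radial_measure TYPE('a))"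
    using integral_fst' [OF i] by simp
  finally show "integral\<^sup>L lborel (\<lambda>x. \<Phi> (norm x, sgn x)) =
      (\<integral>r. (\<integral>\<omega>. \<Phi> (r, \<omega>) \<partial>sphere_measure) \<partial>radial_measure TYPE('a))" .
  show "integrable (radial_measure TYPE('a)) (\<lambda>r. \<integral>\<omega>. \<Phi> (r, \<omega>) \<partial>sphere_measure)"
    using integrable_fst' [OF i] by simp
qed

lemma integral_radial_measure:
  fixes g :: "real \<Rightarrow> 'b::{banach, second_countable_topology}"
  assumes [measurable]: "g \<in> borel_measurable borel"
  shows "integral\<^sup>L (radial_measure TYPE('a::euclidean_space)) g =
    (real DIM('a) * measure lborel (cball (0::'a) 1)) *\<^sub>R (LINT r:{0<..}|lborel. r ^ (DIM('a) - 1) *\<^sub>R g r)"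
proof -
  have "integral\<^sup>L (radial_measure TYPE('a)) g =
      (\<integral>r. (indicator {0<..} r * (real DIM('a) * measure lborel (cball (0::'a) 1) * r ^ (DIM('a) - 1))) *\<^sub>R g r \<partial>lborel)"
    unfolding radial_measure_def
    by (rule integral_density) (auto intro!: AE_I2 simp: indicator_def)
  also have "\<dots> = (\<integral>r. (real DIM('a) * measure lborel (cball (0::'a) 1)) *\<^sub>R indicator {0<..} r *\<^sub>R r ^ (DIM('a) - 1) *\<^sub>R g r \<partial>lborel)"
    by (rule Bochner_Integration.integral_cong) (auto simp: ac_simps)
  also have "\<dots> = (real DIM('a) * measure lborel (cball (0::'a) 1)) *\<^sub>R
      (\<integral>r. indicator {0<..} r *\<^sub>R r ^ (DIM('a) - 1) *\<^sub>R g r \<partial>lborel)"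
    by (rule integral_scaleR_right)
  finally show ?thesis
    by (simp only: set_lebesgue_integral_def)
qed

lemma integrable_sphere_measure_bounded:
  fixes F :: "'a::euclidean_space \<Rightarrow> 'b::{banach, second_countable_topology}"
  assumes "F \<in> borel_measurable borel" "\<And>\<omega>. norm \<omega> = 1 \<Longrightarrow> norm (F \<omega>) \<le> C"
  shows "integrable sphere_measure F"
proof -
  interpret finite_measure "sphere_measure :: 'a measure" by (rule finite_measure_sphere_measure)
  show ?thesis
    by (rule integrable_const_bound [where B = C])
      (use assms AE_sphere_measure in \<open>auto elim!: eventually_mono\<close>)
qed

lemma integrable_sphere_measure_continuous:
  fixes F :: "'a::euclidean_space \<Rightarrow> 'b::euclidean_space"
  assumes "continuous_on UNIV F" shows "integrable sphere_measure F"
proof -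
  have "compact (F ` sphere 0 1)"
    using assms by (intro compact_continuous_image) (auto intro: continuous_on_subset)
  then obtain C where "\<forall>y\<in>F ` sphere 0 1. norm y \<le> C"
    using compact_imp_bounded bounded_iff by metis
  then show ?thesis
    using assms by (intro integrable_sphere_measure_bounded [where C = C])
      (auto intro: borel_measurable_continuous_onI)
qed


section \<open>Averages over the sphere\<close>

text \<open>Homogeneity gives F(r \<omega>) = r^d F(\<omega>), so the polar integral splits into a
  radial integral and an average over the sphere.\<close>

lemma integral_hpoly_radial:
  fixes F :: "real ^ 'n::finite \<Rightarrow> 'b::euclidean_space"
  assumes F: "hpoly d F" and [measurable]: "\<phi> \<in> borel_measurable borel"
    and int: "integrable lborel (\<lambda>x. \<phi> (norm x) *\<^sub>R F x)"
  shows "(\<integral>x. \<phi> (norm x) *\<^sub>R F x \<partial>lborel) =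
    (\<integral>r. \<phi> r * r ^ d \<partial>radial_measure TYPE(real ^ 'n)) *\<^sub>R (\<integral>\<omega>. F \<omega> \<partial>sphere_measure)"
proof -
  have [measurable]: "F \<in> borel_measurable borel"
    using hpoly_continuous_on [OF F] by (rule borel_measurable_continuous_onI)
  have F': "F x = norm x ^ d *\<^sub>R F (sgn x)" for x
    using hpoly_scaleR_arg [OF F, of "norm x" "sgn x"] by (cases "x = 0") (simp_all add: sgn_div_norm)
  let ?\<Phi> = "\<lambda>(r, \<omega>). (\<phi> r * r ^ d) *\<^sub>R F \<omega>"
  have eq: "(\<lambda>x. ?\<Phi> (norm x, sgn x)) = (\<lambda>x. \<phi> (norm x) *\<^sub>R F x)"
    by (rule ext) (subst (2) F', simp)
  have int': "integrable lborel (\<lambda>x. ?\<Phi> (norm x, sgn x))"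
    unfolding eq by (rule int)
  have m: "?\<Phi> \<in> borel_measurable (borel \<Otimes>\<^sub>M borel)"
    by measurable
  have "(\<integral>x. \<phi> (norm x) *\<^sub>R F x \<partial>lborel) =
      (\<integral>r. (\<integral>\<omega>. ?\<Phi> (r, \<omega>) \<partial>sphere_measure) \<partial>radial_measure TYPE(real ^ 'n))"
    unfolding eq [symmetric] by (rule integral_polar [OF m int'])
  also have "\<dots> = (\<integral>r. (\<phi> r * r ^ d) *\<^sub>R (\<integral>\<omega>. F \<omega> \<partial>sphere_measure) \<partial>radial_measure TYPE(real ^ 'n))"
    by simp
  also have "\<dots> = (\<integral>r. \<phi> r * r ^ d \<partial>radial_measure TYPE(real ^ 'n)) *\<^sub>R (\<integral>\<omega>. F \<omega> \<partial>sphere_measure)"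
  proof (rule integral_scaleR_left)
    let ?v = "\<integral>\<omega>. F \<omega> \<partial>sphere_measure"
    \<comment> \<open>Integrability of the scalar radial factor can be extracted only when the
      average is nonzero: pairing the integrable vector function with the average recovers the
      factor up to a nonzero constant.\<close>
    assume "?v \<noteq> 0"
    have "integrable (radial_measure TYPE(real ^ 'n)) (\<lambda>r. (\<phi> r * r ^ d) *\<^sub>R ?v)"
      using integrable_polar [OF m int'] by simp
    then have "integrable (radial_measure TYPE(real ^ 'n)) (\<lambda>r. ((\<phi> r * r ^ d) *\<^sub>R ?v) \<bullet> ?v)"
      by (rule integrable_inner_left)
    with \<open>?v \<noteq> 0\<close> show "integrable (radial_measure TYPE(real ^ 'n)) (\<lambda>r. \<phi> r * r ^ d)"
      by simp
  qed
  finally show ?thesis .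
qed

text \<open>Translation invariance takes the place of the divergence theorem: every difference
  quotient of G has integral zero, and these quotients converge to the derivative while staying
  bounded and supported in a fixed ball.\<close>

lemma integral_dird_eq_0:
  fixes G :: "real ^ 'n::finite \<Rightarrow> 'b::euclidean_space"
  assumes diff: "\<And>x. G differentiable at x"
    and cont: "continuous_on UNIV (dird v G)"
    and zero: "\<And>x. norm x > 1 \<Longrightarrow> G x = 0" "\<And>x. norm x > 1 \<Longrightarrow> dird v G x = 0"
  shows "(\<integral>x. dird v G x \<partial>lborel) = 0"
proof -
  have contG: "continuous_on UNIV G"
    by (simp add: continuous_at_imp_continuous_on diff differentiable_imp_continuous_within)
  then have [measurable]: "G \<in> borel_measurable borel"
    by (rule borel_measurable_continuous_onI)
  have "compact (dird v G ` cball 0 1)"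
    using cont by (intro compact_continuous_image) (auto intro: continuous_on_subset)
  then obtain B where B: "\<forall>y\<in>dird v G ` cball 0 1. norm y \<le> B"
    using compact_imp_bounded bounded_iff by metis
  have B': "norm (dird v G x) \<le> B" for x
  proof (cases "norm x \<le> 1")
    case False
    have "norm (dird v G 0) \<le> B" using B by auto
    then have "0 \<le> B" using norm_ge_zero [of "dird v G 0"] by linarith
    with False show ?thesis by (simp add: zero)
  qed (use B in auto)
  have Gint: "integrable lborel G"
  proof -
    have "integrable lborel (\<lambda>x. indicator (cball 0 1) x *\<^sub>R G x)"
      using contG by (intro borel_integrable_compact) (auto intro: continuous_on_subset)
    moreover have "(\<lambda>x. indicator (cball 0 1) x *\<^sub>R G x) = G"
      by (rule ext) (auto simp: indicator_def zero)
    ultimately show ?thesis by simp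
  qed
  have shift: "integrable lborel (\<lambda>x. G (x + a))" "(\<integral>x. G (x + a) \<partial>lborel) = integral\<^sup>L lborel G" for a
  proof -
    have d: "distr lborel borel ((+) a) = (lborel :: (real ^ 'n) measure)" by (rule lborel_distr_plus)
    have "integrable (distr lborel borel ((+) a)) G" using Gint by (simp add: d)
    then show "integrable lborel (\<lambda>x. G (x + a))"
      by (subst (asm) integrable_distr_eq) (auto simp: add.commute)
    have "(\<integral>x. G (x + a) \<partial>lborel) = integral\<^sup>L (distr lborel borel ((+) a)) G"
      by (subst integral_distr) (auto simp: add.commute)
    then show "(\<integral>x. G (x + a) \<partial>lborel) = integral\<^sup>L lborel G" by (simp add: d)
  qed
  define g where "g n x = real (Suc n) *\<^sub>R (G (x + inverse (real (Suc n)) *\<^sub>R v) - G x)" for n x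
  have path: "((\<lambda>t. G (x + t *\<^sub>R v)) has_vector_derivative dird v G (x + t *\<^sub>R v)) (at t within S)" for x t S
  proof -
    note lin = has_derivative_linear [OF has_derivative_dird [OF diff]]
    have "((\<lambda>t. x + t *\<^sub>R v) has_derivative (\<lambda>h. h *\<^sub>R v)) (at t within S)"
      by (auto intro!: derivative_eq_intros)
    from has_derivative_compose [OF this has_derivative_dird [OF diff]]
    show ?thesis
      unfolding has_vector_derivative_def by (simp add: linear_cmul [OF lin])
  qed
  have gint: "integrable lborel (g n)" "integral\<^sup>L lborel (g n) = 0" for n
    unfolding g_def using shift Gint by auto
  have "(\<lambda>n. integral\<^sup>L lborel (g n)) \<longlonglongrightarrow> (\<integral>x. dird v G x \<partial>lborel)"
  \<comment> \<open>The step sizes are at most 1, so outside the ball of radius 1 + |v| both x and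
    its translate lie where G vanishes; inside, the mean value inequality bounds the quotient by
    B.\<close>
  proof (rule integral_dominated_convergence [where w = "\<lambda>x. indicator (cball 0 (1 + norm v)) x *\<^sub>R B"])
    show "dird v G \<in> borel_measurable lborel"
      using borel_measurable_continuous_onI [OF cont] by simp
    show "g n \<in> borel_measurable lborel" for n
      using gint(1) by (rule borel_measurable_integrable)
    show "integrable lborel (\<lambda>x::real ^ 'n. indicator (cball 0 (1 + norm v)) x *\<^sub>R B)"
      by (intro borel_integrable_compact) auto
    show "AE x in lborel. (\<lambda>n. g n x) \<longlonglongrightarrow> dird v G x"
    proof (rule AE_I2)
      fix x
      have "((\<lambda>t. (G (x + t *\<^sub>R v) - G x) /\<^sub>R t) \<longlongrightarrow> dird v G x) (at 0)"
      proof (rule LIM_zero_cancel, rule tendsto_norm_zero_cancel)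
        have "((\<lambda>t. norm (G (x + t *\<^sub>R v) - G x - t *\<^sub>R dird v G x) / \<bar>t\<bar>) \<longlongrightarrow> 0) (at 0)"
          using path [of x 0 UNIV] by (simp add: has_vector_derivative_def has_derivative_at)
        then show "((\<lambda>t. norm ((G (x + t *\<^sub>R v) - G x) /\<^sub>R t - dird v G x)) \<longlongrightarrow> 0) (at 0)"
        proof (rule Lim_transform_eventually)
          have "norm (G (x + t *\<^sub>R v) - G x - t *\<^sub>R dird v G x) / \<bar>t\<bar> =
            norm ((G (x + t *\<^sub>R v) - G x) /\<^sub>R t - dird v G x)" if "t \<noteq> 0" for t
        proof -
          have "(G (x + t *\<^sub>R v) - G x) /\<^sub>R t - dird v G x = (G (x + t *\<^sub>R v) - G x - t *\<^sub>R dird v G x) /\<^sub>R t"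
            using that by (simp add: scaleR_diff_right)
          then show ?thesis by (simp add: divide_inverse mult.commute)
        qed
          then show "\<forall>\<^sub>F t in at 0. norm (G (x + t *\<^sub>R v) - G x - t *\<^sub>R dird v G x) / \<bar>t\<bar> =
              norm ((G (x + t *\<^sub>R v) - G x) /\<^sub>R t - dird v G x)"
            by (auto simp: eventually_at_filter)
        qed
      qed
      moreover have "filterlim (\<lambda>n. inverse (real (Suc n))) (at 0) sequentially"
        using LIMSEQ_inverse_real_of_nat by (auto simp: filterlim_at)
      ultimately have "(\<lambda>n. (G (x + inverse (real (Suc n)) *\<^sub>R v) - G x) /\<^sub>R inverse (real (Suc n))) \<longlonglongrightarrow> dird v G x"
        by (rule filterlim_compose)
      then show "(\<lambda>n. g n x) \<longlonglongrightarrow> dird v G x"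
        by (simp add: g_def)
    qed
    show "AE x in lborel. norm (g n x) \<le> indicator (cball 0 (1 + norm v)) x *\<^sub>R B" for n
    proof (rule AE_I2)
      fix x :: "real ^ 'n"
      let ?h = "inverse (real (Suc n))"
      have h: "0 < ?h" "?h \<le> 1" by (auto simp: inverse_le_1_iff)
      show "norm (g n x) \<le> indicator (cball 0 (1 + norm v)) x *\<^sub>R B"
      proof (cases "norm x \<le> 1 + norm v")
        case True
        have "norm (G (x + ?h *\<^sub>R v) - G (x + 0 *\<^sub>R v)) \<le> B * norm (?h - 0)"
        proof (rule differentiable_bound [where S = "{0..?h}" and f = "\<lambda>t. G (x + t *\<^sub>R v)"])
          fix t
          show "((\<lambda>t. G (x + t *\<^sub>R v)) has_derivative (\<lambda>h. h *\<^sub>R dird v G (x + t *\<^sub>R v))) (at t within {0..?h})"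
            using path by (simp add: has_vector_derivative_def)
          show "onorm (\<lambda>h. h *\<^sub>R dird v G (x + t *\<^sub>R v)) \<le> B"
            using B' by (intro onorm_le) (simp add: mult.commute [of B] mult_left_mono)
        qed (use h in auto)
        then have "norm (g n x) \<le> real (Suc n) * (B * ?h)"
          unfolding g_def norm_scaleR using h by (intro mult_mono) auto
        also have "\<dots> = B" by simp
        finally show ?thesis using True by simp
      next
        case False
        have "norm (?h *\<^sub>R v) \<le> norm v"
          using h mult_right_mono [of ?h 1 "norm v"] by simp
        moreover have "norm x \<le> norm (x + ?h *\<^sub>R v) + norm (?h *\<^sub>R v)"
          using norm_triangle_ineq4 [of "x + ?h *\<^sub>R v" "?h *\<^sub>R v"] by (simp only: add_diff_cancel_right')
        ultimately have "norm (x + ?h *\<^sub>R v) > 1" "norm x > 1"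
          using False norm_ge_zero [of v] by linarith+
        then show ?thesis using False by (simp add: g_def zero)
      qed
    qed
  qed
  then show ?thesis
    by (simp add: gint LIMSEQ_const_iff)
qed

text \<open>The square makes the truncation differentiable even at the kink u = 0. Thus (1 -
  |x|^2)^2, cut off outside the unit ball, is a continuously differentiable function of compact
  support whose radial moments are elementary.\<close>

lemma has_real_derivative_max_0_square:
  "((\<lambda>u::real. (max 0 u)\<^sup>2) has_real_derivative 2 * max 0 u) (at u)"
proof -
  consider "u < 0" | "u > 0" | "u = 0" by linarith
  then show ?thesis
  proof cases
    case 1
    have "((\<lambda>u. 0) has_real_derivative 0) (at u)" by simp
    then have "((\<lambda>u::real. (max 0 u)\<^sup>2) has_real_derivative 0) (at u)"
      by (rule has_field_derivative_transform_within_open [where S = "{..<0}"]) (use 1 in auto)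
    with 1 show ?thesis by simp
  next
    case 2
    have "((\<lambda>u. u\<^sup>2) has_real_derivative 2 * u) (at u)" by (auto intro!: derivative_eq_intros)
    then have "((\<lambda>u::real. (max 0 u)\<^sup>2) has_real_derivative 2 * u) (at u)"
      by (rule has_field_derivative_transform_within_open [where S = "{0<..}"]) (use 2 in auto)
    with 2 show ?thesis by simp
  next
    case 3
    have "((\<lambda>h. (max 0 h)\<^sup>2 / h) \<longlongrightarrow> 0) (at (0::real))"
    proof (rule Lim_null_comparison)
      show "\<forall>\<^sub>F h in at 0. norm ((max 0 h)\<^sup>2 / h) \<le> \<bar>h::real\<bar>"
        by (rule always_eventually) (auto simp: max_def power2_eq_square)
      show "((\<lambda>h::real. \<bar>h\<bar>) \<longlongrightarrow> 0) (at 0)"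
        by (rule tendsto_eq_intros refl)+ simp
    qed
    with 3 show ?thesis by (simp add: DERIV_def)
  qed
qed

text \<open>The first integrand contains the bump, the second the scalar factor of its gradient -4
  (1 - |x|^2) x. For d > 0, the second value at degree d + 1 divided by the first at degree d - 1 is
  d + m - 1, the constant in the identity for averages.\<close>

lemma integral_radial_measure_bump:
  fixes d k :: nat
  defines "\<sigma> \<equiv> real CARD('n) * measure lborel (cball (0::real ^ 'n::finite) 1)"
    and "k \<equiv> d + (CARD('n) - 1)"
  shows "(\<integral>r. (max 0 (1 - r\<^sup>2))\<^sup>2 * r ^ d \<partial>radial_measure TYPE(real ^ 'n)) =
      \<sigma> * (8 / ((real k + 1) * (real k + 3) * (real k + 5)))"
    and "(\<integral>r. (4 * max 0 (1 - r\<^sup>2)) * r ^ d \<partial>radial_measure TYPE(real ^ 'n)) =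
      \<sigma> * (8 / ((real k + 1) * (real k + 3)))"
proof -
  have set: "(LINT r:{0<..}|lborel. r ^ (CARD('n) - 1) *\<^sub>R (\<phi> r * r ^ d)) = (\<integral>r. (\<psi> r * r ^ k) * indicator {0..1} r \<partial>lborel)"
    if [measurable]: "\<phi> \<in> borel_measurable borel" "\<psi> \<in> borel_measurable borel"
      and "\<And>r. 0 < r \<Longrightarrow> r \<le> 1 \<Longrightarrow> \<phi> r = \<psi> r" "\<And>r. r > 1 \<Longrightarrow> \<phi> r = 0" for \<phi> \<psi> :: "real \<Rightarrow> real"
    unfolding set_lebesgue_integral_def
  proof (rule integral_cong_AE)
    have k: "k = CARD('n) - 1 + d" by (simp add: k_def)
    show "AE r in lborel. indicat_real {0<..} r *\<^sub>R r ^ (CARD('n) - 1) *\<^sub>R (\<phi> r * r ^ d) =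
        \<psi> r * r ^ k * indicat_real {0..1} r"
      using AE_lborel_singleton [of "0::real"]
      by eventually_elim (auto simp: indicator_def that(3,4) k simp flip: power_add)
  qed simp_all
  have pos: "r\<^sup>2 \<le> 1" if "0 < r" "r \<le> 1" for r :: real
    using that by (simp add: abs_square_le_1)
  have neg: "r\<^sup>2 > 1" if "r > 1" for r :: real
    using that by (simp add: one_less_power)
  have *: "(\<integral>r. (max 0 (1 - r\<^sup>2))\<^sup>2 * r ^ d \<partial>radial_measure TYPE(real ^ 'n)) =
      \<sigma> * (\<integral>r. ((1 - r\<^sup>2)\<^sup>2 * r ^ k) * indicator {0..1} r \<partial>lborel)"
    unfolding \<sigma>_def
    by (subst integral_radial_measure, simp, subst set [symmetric, where \<phi> = "\<lambda>r. (max 0 (1 - r\<^sup>2))\<^sup>2"])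
      (auto simp: pos max_def dest: neg)
  have **: "(\<integral>r. (4 * max 0 (1 - r\<^sup>2)) * r ^ d \<partial>radial_measure TYPE(real ^ 'n)) =
      \<sigma> * (\<integral>r. (4 * (1 - r\<^sup>2) * r ^ k) * indicator {0..1} r \<partial>lborel)"
    unfolding \<sigma>_def
    by (subst integral_radial_measure, simp, subst set [symmetric, where \<phi> = "\<lambda>r. 4 * max 0 (1 - r\<^sup>2)"])
      (auto simp: pos max_def dest: neg)
  have "(\<integral>r. ((1 - r\<^sup>2)\<^sup>2 * r ^ k) * indicator {0..1} r \<partial>lborel) =
     (\<lambda>r::real. r ^ (k + 1) / (k + 1) - 2 * r ^ (k + 3) / (k + 3) + r ^ (k + 5) / (k + 5)) 1 -
     (\<lambda>r::real. r ^ (k + 1) / (k + 1) - 2 * r ^ (k + 3) / (k + 3) + r ^ (k + 5) / (k + 5)) 0"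
  proof (rule integral_FTC_Icc_real)
    fix x :: real
    have "((\<lambda>r. r ^ n / n) has_real_derivative x ^ (n - 1)) (at x)" if "n > 0" for n :: nat
      using that by (auto intro!: derivative_eq_intros)
    from this [of "k + 1"] this [of "k + 3"] this [of "k + 5"]
    have "((\<lambda>r. r ^ (k + 1) / (k + 1) - 2 * (r ^ (k + 3) / (k + 3)) + r ^ (k + 5) / (k + 5)) has_real_derivative
        x ^ k - 2 * x ^ (k + 2) + x ^ (k + 4)) (at x)"
      by (intro DERIV_add DERIV_diff DERIV_cmult) (simp_all add: numeral_eq_Suc)
    then show "((\<lambda>r. r ^ (k + 1) / (k + 1) - 2 * r ^ (k + 3) / (k + 3) + r ^ (k + 5) / (k + 5)) has_real_derivative
        (1 - x\<^sup>2)\<^sup>2 * x ^ k) (at x)"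
      by (simp add: algebra_simps power_add power2_eq_square numeral_eq_Suc)
  qed (auto intro!: continuous_intros)
  also have "\<dots> = 8 / ((real k + 1) * (real k + 3) * (real k + 5))"
    by (simp add: divide_simps zero_power) (simp add: algebra_simps)
  finally show "(\<integral>r. (max 0 (1 - r\<^sup>2))\<^sup>2 * r ^ d \<partial>radial_measure TYPE(real ^ 'n)) =
      \<sigma> * (8 / ((real k + 1) * (real k + 3) * (real k + 5)))"
    unfolding * by simp
  have "(\<integral>r. (4 * (1 - r\<^sup>2) * r ^ k) * indicator {0..1} r \<partial>lborel) =
     (\<lambda>r::real. 4 * r ^ (k + 1) / (k + 1) - 4 * r ^ (k + 3) / (k + 3)) 1 -
     (\<lambda>r::real. 4 * r ^ (k + 1) / (k + 1) - 4 * r ^ (k + 3) / (k + 3)) 0"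
  proof (rule integral_FTC_Icc_real)
    fix x :: real
    have "((\<lambda>r. r ^ n / n) has_real_derivative x ^ (n - 1)) (at x)" if "n > 0" for n :: nat
      using that by (auto intro!: derivative_eq_intros)
    from this [of "k + 1"] this [of "k + 3"]
    have "((\<lambda>r. 4 * (r ^ (k + 1) / (k + 1)) - 4 * (r ^ (k + 3) / (k + 3))) has_real_derivative
        4 * x ^ k - 4 * x ^ (k + 2)) (at x)"
      by (intro DERIV_diff DERIV_cmult) (simp_all add: numeral_eq_Suc)
    then show "((\<lambda>r. 4 * r ^ (k + 1) / (k + 1) - 4 * r ^ (k + 3) / (k + 3)) has_real_derivative
        4 * (1 - x\<^sup>2) * x ^ k) (at x)"
      by (simp add: algebra_simps power_add power2_eq_square numeral_eq_Suc)
  qed (auto intro!: continuous_intros)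
  also have "\<dots> = 8 / ((real k + 1) * (real k + 3))"
    by (simp add: divide_simps zero_power)
  finally show "(\<integral>r. (4 * max 0 (1 - r\<^sup>2)) * r ^ d \<partial>radial_measure TYPE(real ^ 'n)) =
      \<sigma> * (8 / ((real k + 1) * (real k + 3)))"
    unfolding ** by simp
qed

text \<open>A bump times F has compact support, so its derivative along v integrates to zero. By the
  product rule this equates two integrals of radial functions times homogeneous polynomials, of
  degrees d - 1 and d + 1; after the radial integrals are split off, the averages remain.\<close>

lemma integral_sphere_dird:
  fixes F :: "real ^ 'n::finite \<Rightarrow> 'b::euclidean_space"
  assumes F: "hpoly d F"
  shows "(\<integral>\<omega>. dird v F \<omega> \<partial>sphere_measure) =
    (real d + real CARD('n) - 1) *\<^sub>R (\<integral>\<omega>. (\<omega> \<bullet> v) *\<^sub>R F \<omega> \<partial>sphere_measure)"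
proof -
  define \<phi> where "\<phi> r = (max 0 (1 - r\<^sup>2))\<^sup>2" for r :: real
  \<comment> \<open>The derivative of the bump along v is - \<open>\<psi>\<close> times <x,
    v>.\<close>
  define \<psi> where "\<psi> r = 4 * max 0 (1 - r\<^sup>2)" for r :: real
  have [measurable]: "\<phi> \<in> borel_measurable borel" "\<psi> \<in> borel_measurable borel"
    unfolding \<phi>_def \<psi>_def by measurable
  define G where "G x = \<phi> (norm x) *\<^sub>R F x" for x
  have G: "(G has_derivative (\<lambda>h. \<phi> (norm x) *\<^sub>R dird h F x - \<psi> (norm x) *\<^sub>R (x \<bullet> h) *\<^sub>R F x)) (at x)" for x
  proof -
    have 1: "((\<lambda>x. 1 - x \<bullet> x) has_derivative (\<lambda>h. - 2 * (x \<bullet> h))) (at x)"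
      by (auto intro!: derivative_eq_intros simp: inner_commute)
    have "((\<lambda>x. (max 0 (1 - x \<bullet> x))\<^sup>2) has_derivative (\<lambda>h. (- 2 * (x \<bullet> h)) * (2 * max 0 (1 - x \<bullet> x)))) (at x)"
      using has_derivative_compose [OF 1 has_real_derivative_max_0_square [of "1 - x \<bullet> x", unfolded has_field_derivative_def]]
      by (simp add: mult.commute)
    from has_derivative_scaleR [OF this has_derivative_dird [OF hpoly_differentiable [OF F]]]
    show ?thesis
      unfolding G_def \<phi>_def \<psi>_def power2_norm_eq_inner
      by (rule has_derivative_eq_rhs) (auto simp: algebra_simps)
  qed
  have dG: "dird v G = (\<lambda>x. \<phi> (norm x) *\<^sub>R dird v F x - \<psi> (norm x) *\<^sub>R (x \<bullet> v) *\<^sub>R F x)"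
    by (rule ext) (rule dird_eqI [OF G])
  have zero: "\<phi> (norm x) = 0" "\<psi> (norm x) = 0" if "norm x > 1" for x :: "real ^ 'n"
    using that one_less_power [of "norm x" 2] by (auto simp: \<phi>_def \<psi>_def)
  note hF = hpoly_dird [OF F, of v] hpoly_inner [OF F, of v]
  have cont: "continuous_on UNIV (\<lambda>x. \<phi> (norm x) *\<^sub>R dird v F x)" "continuous_on UNIV (\<lambda>x. \<psi> (norm x) *\<^sub>R (x \<bullet> v) *\<^sub>R F x)"
    unfolding \<phi>_def \<psi>_def
    by (intro continuous_intros hpoly_continuous_on [OF F] hpoly_continuous_on [OF hF(1)])+
  have int: "integrable lborel h" if "continuous_on UNIV h" "\<And>x. norm x > 1 \<Longrightarrow> h x = 0" for h :: "real ^ 'n \<Rightarrow> 'b"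
  proof -
    have "integrable lborel (\<lambda>x. indicator (cball 0 1) x *\<^sub>R h x)"
      using that(1) by (intro borel_integrable_compact) (auto intro: continuous_on_subset)
    moreover have "(\<lambda>x. indicator (cball 0 1) x *\<^sub>R h x) = h"
      by (rule ext) (auto simp: indicator_def that(2))
    ultimately show ?thesis by simp
  qed
  have i1: "integrable lborel (\<lambda>x. \<phi> (norm x) *\<^sub>R dird v F x)"
    by (rule int [OF cont(1)]) (simp add: zero)
  have i2: "integrable lborel (\<lambda>x. \<psi> (norm x) *\<^sub>R (x \<bullet> v) *\<^sub>R F x)"
    by (rule int [OF cont(2)]) (simp add: zero)
  have "(\<integral>x. dird v G x \<partial>lborel) = 0"
  proof (rule integral_dird_eq_0)
    show "G differentiable at x" for x
      using G by (rule differentiableI)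
    show "continuous_on UNIV (dird v G)"
      unfolding dG by (intro continuous_on_diff cont)
  qed (simp_all add: G_def dG zero)
  then have "(\<integral>x. \<phi> (norm x) *\<^sub>R dird v F x \<partial>lborel) = (\<integral>x. \<psi> (norm x) *\<^sub>R (x \<bullet> v) *\<^sub>R F x \<partial>lborel)"
    unfolding dG Bochner_Integration.integral_diff [OF i1 i2] by simp
  then have eq: "(\<integral>r. \<phi> r * r ^ (d - 1) \<partial>radial_measure TYPE(real ^ 'n)) *\<^sub>R (\<integral>\<omega>. dird v F \<omega> \<partial>sphere_measure) =
      (\<integral>r. \<psi> r * r ^ Suc d \<partial>radial_measure TYPE(real ^ 'n)) *\<^sub>R (\<integral>\<omega>. (\<omega> \<bullet> v) *\<^sub>R F \<omega> \<partial>sphere_measure)"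
    by (simp only: integral_hpoly_radial [OF hF(1) _ i1] integral_hpoly_radial [OF hF(2) _ i2]
       \<open>\<phi> \<in> borel_measurable borel\<close> \<open>\<psi> \<in> borel_measurable borel\<close>)
  have \<sigma>: "measure lborel (cball (0::real ^ 'n) 1) > 0"
    using emeasure_cball_1 [where 'a="real ^ 'n"]
    by (metis emeasure_eq_ennreal_measure ennreal_0 ennreal_less_zero_iff ennreal_eq_0_iff infinity_ennreal_def less_le
        measure_nonneg not_less)
  note rad = integral_radial_measure_bump [where 'n='n]
  show ?thesis
  proof (cases d)
    \<comment> \<open>Here d - 1 is truncated and the quotient of the radial integrals is not the
      right constant. Instead the derivative vanishes, which forces the other average to be zero
      because its radial factor is positive.\<close>
    case 0
    have "dird v F = (\<lambda>x. 0)" using F unfolding 0 by (rule dird_hpoly_0)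
    with eq show ?thesis
      using \<sigma> unfolding \<phi>_def \<psi>_def rad by simp
  next
    case (Suc e)
    define k where "k = e + (CARD('n) - 1)"
    have k: "real d + real CARD('n) - 1 = real k + 1"
      unfolding Suc k_def using zero_less_card_finite [where 'a='n] by (simp add: of_nat_diff Suc_le_eq)
    have k': "Suc d + (CARD('n) - 1) = k + 2" "d - 1 + (CARD('n) - 1) = k" by (simp_all add: Suc k_def)
    have "(8 / ((real k + 1) * (real k + 3) * (real k + 5))) *\<^sub>R (\<integral>\<omega>. dird v F \<omega> \<partial>sphere_measure) =
       (8 / ((real k + 3) * (real k + 5))) *\<^sub>R (\<integral>\<omega>. (\<omega> \<bullet> v) *\<^sub>R F \<omega> \<partial>sphere_measure)"
    proof -
      define C where "C = real CARD('n) * measure lborel (cball (0::real ^ 'n) 1)"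
      have C: "C \<noteq> 0" using \<sigma> by (simp add: C_def)
      have k2: "real (k + 2) + 1 = real k + 3" "real (k + 2) + 3 = real k + 5" by simp_all
      have "C *\<^sub>R (8 / ((real k + 1) * (real k + 3) * (real k + 5))) *\<^sub>R (\<integral>\<omega>. dird v F \<omega> \<partial>sphere_measure) =
        C *\<^sub>R (8 / ((real k + 3) * (real k + 5))) *\<^sub>R (\<integral>\<omega>. (\<omega> \<bullet> v) *\<^sub>R F \<omega> \<partial>sphere_measure)"
        using eq unfolding \<phi>_def \<psi>_def rad k' k2 C_def scaleR_scaleR .
      with C show ?thesis by (simp only: scaleR_cancel_left) simp
    qed
    then have "((real k + 1) * (real k + 3) * (real k + 5) / 8) *\<^sub>R (8 / ((real k + 1) * (real k + 3) * (real k + 5))) *\<^sub>R (\<integral>\<omega>. dird v F \<omega> \<partial>sphere_measure) =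
       ((real k + 1) * (real k + 3) * (real k + 5) / 8) *\<^sub>R (8 / ((real k + 3) * (real k + 5))) *\<^sub>R (\<integral>\<omega>. (\<omega> \<bullet> v) *\<^sub>R F \<omega> \<partial>sphere_measure)"
      by (rule arg_cong)
    moreover have "((real k + 1) * (real k + 3) * (real k + 5) / 8) * (8 / ((real k + 1) * (real k + 3) * (real k + 5))) = 1"
      "((real k + 1) * (real k + 3) * (real k + 5) / 8) * (8 / ((real k + 3) * (real k + 5))) = real k + 1"
    proof -
      have "real k + 1 \<noteq> 0" "real k + 3 \<noteq> 0" "real k + 5 \<noteq> 0" by linarith+
      then show "((real k + 1) * (real k + 3) * (real k + 5) / 8) * (8 / ((real k + 1) * (real k + 3) * (real k + 5))) = 1"
        "((real k + 1) * (real k + 3) * (real k + 5) / 8) * (8 / ((real k + 3) * (real k + 5))) = real k + 1"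
        by simp_all
    qed
    ultimately show ?thesis
      unfolding k scaleR_scaleR by simp
  qed
qed


text \<open>The factor by which averaging <\<omega>, \<eta>>^n H(\<omega>) multiplies H(\<eta>), for
  H harmonic of degree j and 2 \<mu> the dimension. The recursion is the identity for averages with
  the derivative taken along \<eta>; where n - 1 or j - 1 is truncated, its coefficient is
  zero.\<close>

fun sphere_moment :: "real \<Rightarrow> nat \<Rightarrow> nat \<Rightarrow> real" where
  "sphere_moment \<mu> 0 j = (if j = 0 then 1 else 0)"
| "sphere_moment \<mu> (Suc n) j =
     (real n * sphere_moment \<mu> (n - 1) j + real j * sphere_moment \<mu> n (j - 1)) / (real n + real j + 2 * \<mu> - 1)"

lemma integral_sphere_const: "(\<integral>\<omega>. v \<partial>(sphere_measure :: 'a::euclidean_space measure)) = (v :: 'b::euclidean_space)"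
  by (simp add: measure_def emeasure_sphere_measure_UNIV)

text \<open>Euler's formula writes j H as a sum of coordinates times partial derivatives; the
  identity for averages turns each summand into a second derivative, and together they form the
  Laplacian. The factor j + m - 2 that appears is positive because m \<ge> 2 and j > 0.\<close>

lemma integral_sphere_harmonic:
  fixes H :: "real ^ 'n::finite \<Rightarrow> 'b::euclidean_space"
  assumes m: "CARD('n) \<ge> 2" and H: "hpoly j H" "\<And>x. lap H x = 0" and j: "j > 0"
  shows "(\<integral>\<omega>. H \<omega> \<partial>sphere_measure) = 0"
proof -
  let ?e = "\<lambda>i::'n. axis i (1::real)"
  let ?c = "real (j - 1) + real CARD('n) - 1"
  have ii: "integrable sphere_measure (\<lambda>\<omega>. (\<omega> \<bullet> ?e i) *\<^sub>R dird (?e i) H \<omega>)"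
    "integrable sphere_measure (\<lambda>\<omega>. dird (?e i) (dird (?e i) H) \<omega>)" for i
    by (rule integrable_sphere_measure_continuous,
        rule hpoly_continuous_on [OF hpoly_inner [OF hpoly_dird [OF H(1)]]])
      (rule integrable_sphere_measure_continuous,
        rule hpoly_continuous_on [OF hpoly_dird [OF hpoly_dird [OF H(1)]]])
  have "real j *\<^sub>R (\<integral>\<omega>. H \<omega> \<partial>sphere_measure) = (\<integral>\<omega>. dird \<omega> H \<omega> \<partial>sphere_measure)"
    by (simp add: dird_euler [OF H(1)])
  also have "\<dots> = (\<integral>\<omega>. (\<Sum>i\<in>UNIV. (\<omega> \<bullet> ?e i) *\<^sub>R dird (?e i) H \<omega>) \<partial>sphere_measure)"
    by (subst dird_vec_sum [OF hpoly_differentiable [OF H(1)]]) (simp add: inner_axis)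
  also have "\<dots> = (\<Sum>i\<in>UNIV. \<integral>\<omega>. (\<omega> \<bullet> ?e i) *\<^sub>R dird (?e i) H \<omega> \<partial>sphere_measure)"
    by (rule Bochner_Integration.integral_sum) (rule ii)
  finally have eq: "real j *\<^sub>R (\<integral>\<omega>. H \<omega> \<partial>sphere_measure) =
    (\<Sum>i\<in>UNIV. \<integral>\<omega>. (\<omega> \<bullet> ?e i) *\<^sub>R dird (?e i) H \<omega> \<partial>sphere_measure)" .
  have "?c *\<^sub>R (real j *\<^sub>R (\<integral>\<omega>. H \<omega> \<partial>sphere_measure)) =
      (\<Sum>i\<in>UNIV. \<integral>\<omega>. dird (?e i) (dird (?e i) H) \<omega> \<partial>sphere_measure)"
    unfolding eq scaleR_sum_right by (simp only: integral_sphere_dird [OF hpoly_dird [OF H(1)]])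
  also have "\<dots> = (\<integral>\<omega>. lap H \<omega> \<partial>sphere_measure)"
    unfolding lap_def by (rule Bochner_Integration.integral_sum [symmetric]) (rule ii)
  also have "\<dots> = 0" by (simp add: H(2))
  finally show ?thesis using m j by simp
qed

text \<open>The derivative of <x, \<eta>>^k H along \<eta> has two terms: one lowers the power, the
  other replaces H by its derivative, again harmonic. Both are covered by the strong induction over
  n with H arbitrary, and Euler's formula at \<eta> turns the value of the derivative into j
  H(\<eta>).\<close>

lemma integral_sphere_inner_power_harmonic:
  fixes H :: "real ^ 'n::finite \<Rightarrow> 'b::euclidean_space"
  assumes m: "CARD('n) \<ge> 2" and H: "hpoly j H" "\<And>x. lap H x = 0" and \<eta>: "norm \<eta> = 1"
  shows "(\<integral>\<omega>. (\<omega> \<bullet> \<eta>) ^ n *\<^sub>R H \<omega> \<partial>sphere_measure) = sphere_moment (real CARD('n) / 2) n j *\<^sub>R H \<eta>"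
  using H
proof (induction n arbitrary: j H rule: less_induct)
  case (less n)
  note H = less.prems
  show ?case
  proof (cases n)
    case 0
    show ?thesis
    proof (cases "j = 0")
      case True
      have "H x = H 0" for x
        using hpoly_scaleR_arg [OF H(1), of 0 x] True by simp
      then have "(\<integral>\<omega>. H \<omega> \<partial>sphere_measure) = (\<integral>\<omega>. H \<eta> \<partial>(sphere_measure :: (real ^ 'n) measure))"
        by metis
      then show ?thesis
        unfolding integral_sphere_const using 0 True by simp
    next
      case False
      then show ?thesis using 0 integral_sphere_harmonic [OF m H] by simp
    qed
  next
    case (Suc k)
    define F where "F x = (x \<bullet> \<eta>) ^ k *\<^sub>R H x" for x
    have F: "hpoly (k + j) F"
      unfolding F_def by (rule hpoly_inner_power [OF H(1)])
    have \<eta>\<eta>: "\<eta> \<bullet> \<eta> = 1" using \<eta> by (simp add: dot_square_norm)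
    have dF: "dird \<eta> F = (\<lambda>x. real k *\<^sub>R ((x \<bullet> \<eta>) ^ (k - 1) *\<^sub>R H x) + (x \<bullet> \<eta>) ^ k *\<^sub>R dird \<eta> H x)"
    proof
      fix x
      have "((\<lambda>x. (x \<bullet> \<eta>) ^ k) has_derivative (\<lambda>h. (h \<bullet> \<eta>) * (real k * (x \<bullet> \<eta>) ^ (k - 1)))) (at x)"
        by (auto intro!: derivative_eq_intros simp: mult_ac)
      from dird_eqI [OF has_derivative_scaleR [OF this has_derivative_dird [OF hpoly_differentiable [OF H(1)]]]]
      show "dird \<eta> F x = real k *\<^sub>R ((x \<bullet> \<eta>) ^ (k - 1) *\<^sub>R H x) + (x \<bullet> \<eta>) ^ k *\<^sub>R dird \<eta> H x"
        unfolding F_def by (simp add: \<eta>\<eta>)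
    qed
    have lap': "lap (dird \<eta> H) x = 0" for x
    proof -
      have "lap H = (\<lambda>x. 0)" using H(2) by (rule ext)
      then show ?thesis by (simp add: lap_dird [OF H(1)] dird_const)
    qed
    have int: "integrable sphere_measure (\<lambda>x. (x \<bullet> \<eta>) ^ i *\<^sub>R H x)" "integrable sphere_measure (\<lambda>x. (x \<bullet> \<eta>) ^ i *\<^sub>R dird \<eta> H x)" for i
      by (rule integrable_sphere_measure_continuous,
          rule hpoly_continuous_on [OF hpoly_inner_power [OF H(1)]])
        (rule integrable_sphere_measure_continuous,
          rule hpoly_continuous_on [OF hpoly_inner_power [OF hpoly_dird [OF H(1)]]])
    have "(real (k + j) + real CARD('n) - 1) *\<^sub>R (\<integral>\<omega>. (\<omega> \<bullet> \<eta>) ^ n *\<^sub>R H \<omega> \<partial>sphere_measure) =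
        (\<integral>\<omega>. dird \<eta> F \<omega> \<partial>sphere_measure)"
      unfolding integral_sphere_dird [OF F] by (simp add: F_def Suc)
    also have "\<dots> = real k *\<^sub>R (\<integral>\<omega>. (\<omega> \<bullet> \<eta>) ^ (k - 1) *\<^sub>R H \<omega> \<partial>sphere_measure) +
        (\<integral>\<omega>. (\<omega> \<bullet> \<eta>) ^ k *\<^sub>R dird \<eta> H \<omega> \<partial>sphere_measure)"
      unfolding dF Bochner_Integration.integral_add [OF integrable_scaleR_right [OF int(1)] int(2)]
      by (simp only: integral_scaleR_right)
    also have "(\<integral>\<omega>. (\<omega> \<bullet> \<eta>) ^ (k - 1) *\<^sub>R H \<omega> \<partial>sphere_measure) = sphere_moment (real CARD('n) / 2) (k - 1) j *\<^sub>R H \<eta>"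
      by (rule less.IH) (use Suc H in auto)
    also have "(\<integral>\<omega>. (\<omega> \<bullet> \<eta>) ^ k *\<^sub>R dird \<eta> H \<omega> \<partial>sphere_measure) = sphere_moment (real CARD('n) / 2) k (j - 1) *\<^sub>R dird \<eta> H \<eta>"
      by (rule less.IH) (use Suc hpoly_dird [OF H(1)] lap' in auto)
    also have "dird \<eta> H \<eta> = real j *\<^sub>R H \<eta>"
      by (rule dird_euler [OF H(1)])
    finally have "(real (k + j) + real CARD('n) - 1) *\<^sub>R (\<integral>\<omega>. (\<omega> \<bullet> \<eta>) ^ n *\<^sub>R H \<omega> \<partial>sphere_measure) =
        (real k * sphere_moment (real CARD('n) / 2) (k - 1) j + real j * sphere_moment (real CARD('n) / 2) k (j - 1)) *\<^sub>R H \<eta>"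
      by (simp add: algebra_simps)
    moreover have "sphere_moment (real CARD('n) / 2) n j = (real k * sphere_moment (real CARD('n) / 2) (k - 1) j +
        real j * sphere_moment (real CARD('n) / 2) k (j - 1)) / (real (k + j) + real CARD('n) - 1)"
      by (simp add: Suc)
    moreover have "real (k + j) + real CARD('n) - 1 \<noteq> 0"
      using m by linarith
    ultimately show ?thesis
      by (simp add: eq_vector_fraction_iff)
  qed
qed

text \<open>Each step of the recursion lowers n - j by two or keeps it, and the only nonzero initial
  value is at n = j = 0.\<close>

lemma sphere_moment_eq_0: "(\<And>p. n \<noteq> j + 2 * p) \<Longrightarrow> sphere_moment \<mu> n j = 0"
proof (induction n arbitrary: j rule: less_induct)
  case (less n)
  show ?case
  proof (cases n)
    case 0
    with less.prems [of 0] show ?thesis by simp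
  next
    case (Suc k)
    have "real k * sphere_moment \<mu> (k - 1) j = 0"
    proof (cases "k = 0")
      case False
      have "k - 1 \<noteq> j + 2 * p" for p using less.prems [of "Suc p"] False Suc by auto
      with less.IH [of "k - 1" j] Suc show ?thesis by simp
    qed simp
    moreover have "real j * sphere_moment \<mu> k (j - 1) = 0"
    proof (cases "j = 0")
      case False
      have "k \<noteq> j - 1 + 2 * p" for p using less.prems [of p] False Suc by auto
      with less.IH [of k "j - 1"] Suc show ?thesis by simp
    qed simp
    ultimately show ?thesis
      unfolding Suc sphere_moment.simps by (simp only: add_0 div_0)
  qed
qed

text \<open>Induction on j + 2 p = n + 1. The two terms of the recursion carry 2 p and j over a
  common denominator \<open>D\<close>; their sum supplies the new factor of the factorial, and n + j
  + 2 \<mu> - 1 = 2 (\<mu> + q) supplies the new factors of the denominator.\<close>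

lemma sphere_moment_closed:
  assumes \<mu>: "\<mu> > 0"
  shows "sphere_moment \<mu> (j + 2 * p) j = fact (j + 2 * p) / (2 ^ (j + 2 * p) * fact p * pochhammer \<mu> (j + p))"
proof (induction "j + 2 * p" arbitrary: j p rule: less_induct)
  case less
  show ?case
  proof (cases "j + 2 * p")
    case 0
    then show ?thesis by simp
  next
    case (Suc n)
    then obtain q where q: "j + p = Suc q" by (cases "j + p") auto
    have P: "pochhammer \<mu> q > 0" using \<mu> by (rule pochhammer_pos)
    define D where "D = 2 ^ n * fact p * pochhammer \<mu> q"
    have D: "D > 0" using P by (simp add: D_def)
    have a: "real n * sphere_moment \<mu> (n - 1) j = real (2 * p) * fact n / D"
    proof (cases p)
      \<comment> \<open>With p = 0 the first reduced moment has exponent n - 1 below its degree j,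
        so the term is zero, in accordance with the factor 2 p.\<close>
      case 0
      have "n - 1 \<noteq> j + 2 * p'" if "n \<noteq> 0" for p' using Suc 0 that by auto
      then have "real n * sphere_moment \<mu> (n - 1) j = 0"
        using sphere_moment_eq_0 [of "n - 1" j \<mu>] by (cases "n = 0") auto
      then show ?thesis by (simp add: 0)
    next
      case (Suc p')
      have n: "n = Suc (j + 2 * p')" using \<open>j + 2 * p = Suc n\<close> Suc by simp
      have "sphere_moment \<mu> (n - 1) j = fact (j + 2 * p') / (2 ^ (j + 2 * p') * fact p' * pochhammer \<mu> (j + p'))"
        using less.hyps [of j p'] n Suc by simp
      also have "j + p' = q" using q Suc by simp
      finally have m: "sphere_moment \<mu> (n - 1) j = fact (n - 1) / (2 ^ (n - 1) * fact p' * pochhammer \<mu> q)"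
        by (simp add: n)
      have D': "D = real (2 * p) * (2 ^ (n - 1) * fact p' * pochhammer \<mu> q)"
        by (simp add: D_def n Suc)
      have "(fact n :: real) = real n * fact (n - 1)"
        by (simp add: n)
      then show ?thesis
        using Suc unfolding m D' by simp
    qed
    have b: "real j * sphere_moment \<mu> n (j - 1) = real j * fact n / D"
    proof (cases j)
      case (Suc j')
      have n: "n = j' + 2 * p" using \<open>j + 2 * p = Suc n\<close> Suc by simp
      have "sphere_moment \<mu> n (j - 1) = fact (j' + 2 * p) / (2 ^ (j' + 2 * p) * fact p * pochhammer \<mu> (j' + p))"
        using less.hyps [of j' p] n Suc by simp
      also have "j' + p = q" using q Suc by simp
      finally show ?thesis by (simp add: D_def n)
    qed simp
    have nj: "real n + real j + 2 * \<mu> - 1 = 2 * (\<mu> + real q)"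
    proof -
      have "real n + real j = 2 * real q + 1"
        using Suc q by (metis (no_types, lifting) ab_semigroup_add_class.add_ac(1) add.commute add_Suc_right mult_2 nat.inject of_nat_Suc of_nat_add of_nat_mult of_nat_numeral)
      then show ?thesis by simp
    qed
    have "sphere_moment \<mu> (Suc n) j = (real (2 * p) * fact n / D + real j * fact n / D) / (2 * (\<mu> + real q))"
      by (simp only: sphere_moment.simps a b nj)
    also have "real (2 * p) * fact n / D + real j * fact n / D = fact (Suc n) / D"
    proof -
      have "real (Suc n) = real (2 * p) + real j" using Suc by (metis add.commute of_nat_add)
      then have "(fact (Suc n) :: real) = (real (2 * p) + real j) * fact n" by (simp only: fact_Suc of_nat_mult of_nat_fact)
      then show ?thesis by (simp add: add_divide_distrib distrib_right)
    qed
    finally show ?thesis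
      unfolding Suc q D_def by (simp add: pochhammer_Suc)
  qed
qed

text \<open>The n-th finite difference of a monic polynomial of degree n is n!. One difference of a
  rising factorial of length n + 1 is n + 1 times the one of length n, and Pascal's rule peels off
  that difference.\<close>

lemma alternating_binomial_pochhammer:
  fixes x :: real
  shows "(\<Sum>i\<le>n. (-1) ^ i * real (n choose i) * pochhammer (x - real i) n) = fact n"
proof (induction n arbitrary: x)
  case (Suc n)
  define g where "g i = pochhammer (x - real i) (Suc n)" for i
  have diff: "g i - g (Suc i) = real (Suc n) * pochhammer (x - real i) n" for i
  proof -
    have "g i = pochhammer (x - real i) n * (x - real i + real n)"
      by (simp add: g_def pochhammer_Suc)
    moreover have "g (Suc i) = (x - real i - 1) * pochhammer (x - real i) n"
      using pochhammer_rec [of "x - real (Suc i)" n] by (simp add: g_def algebra_simps)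
    ultimately show ?thesis by (simp add: algebra_simps)
  qed
  have "(\<Sum>i\<le>Suc n. (-1) ^ i * real (Suc n choose i) * g i) =
      g 0 + (\<Sum>i\<le>n. (-1) ^ Suc i * real (Suc n choose Suc i) * g (Suc i))"
    by (subst sum.atMost_Suc_shift) simp
  also have "(\<Sum>i\<le>n. (-1) ^ Suc i * real (Suc n choose Suc i) * g (Suc i)) =
     (\<Sum>i\<le>n. (-1) ^ Suc i * real (n choose Suc i) * g (Suc i)) - (\<Sum>i\<le>n. (-1) ^ i * real (n choose i) * g (Suc i))"
    unfolding sum_subtractf [symmetric] by (rule sum.cong) (simp_all add: algebra_simps)
  also have "g 0 + \<dots> = (\<Sum>i\<le>Suc n. (-1) ^ i * real (n choose i) * g i) - (\<Sum>i\<le>n. (-1) ^ i * real (n choose i) * g (Suc i))"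
  proof -
    have "(\<Sum>i\<le>Suc n. (-1) ^ i * real (n choose i) * g i) =
        g 0 + (\<Sum>i\<le>n. (-1) ^ Suc i * real (n choose Suc i) * g (Suc i))"
      by (subst sum.atMost_Suc_shift) simp
    then show ?thesis by (simp only: add_diff_eq)
  qed
  also have "\<dots> = (\<Sum>i\<le>n. (-1) ^ i * real (n choose i) * g i) - (\<Sum>i\<le>n. (-1) ^ i * real (n choose i) * g (Suc i))"
    by simp
  also have "\<dots> = (\<Sum>i\<le>n. (-1) ^ i * real (n choose i) * (g i - g (Suc i)))"
    unfolding sum_subtractf [symmetric] by (rule sum.cong) (simp_all add: algebra_simps)
  also have "\<dots> = real (Suc n) * (\<Sum>i\<le>n. (-1) ^ i * real (n choose i) * pochhammer (x - real i) n)"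
    unfolding diff sum_distrib_left by (rule sum.cong) (simp_all add: mult_ac)
  finally show ?case
    by (simp only: g_def Suc.IH fact_Suc of_nat_mult of_nat_fact)
qed simp

text \<open>Put n = (k - l)/2. The closed form cancels the powers of two and (k - 2 i)!, the
  quotient of the rising factorials is the one of length n starting at \<mu> + l + n - i, and 1/(i!
  (n - i)!) is a binomial coefficient over n!. What remains is an n-th finite difference.\<close>

lemma gegenbauer_sphere_moment:
  assumes \<mu>: "\<mu> > 0"
  shows "(\<Sum>j\<le>k div 2. (-1) ^ j * pochhammer \<mu> (k - j) / (fact j * fact (k - 2 * j)) * 2 ^ (k - 2 * j) *
      sphere_moment \<mu> (k - 2 * j) l) = (if l \<le> k \<and> even (k - l) then 1 else 0)"
proof (cases "l \<le> k \<and> even (k - l)")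
  case False
  have "sphere_moment \<mu> (k - 2 * j) l = 0" if "j \<le> k div 2" for j
  proof (rule sphere_moment_eq_0)
    fix p
    show "k - 2 * j \<noteq> l + 2 * p"
    proof
      assume "k - 2 * j = l + 2 * p"
      then have "k = l + 2 * (p + j)" using that by simp
      with False show False by simp
    qed
  qed
  then show ?thesis using False by simp
next
  case True
  then obtain n where k: "k = l + 2 * n" by (metis evenE le_add_diff_inverse)
  let ?t = "\<lambda>j. (-1) ^ j * pochhammer \<mu> (k - j) / (fact j * fact (k - 2 * j)) * 2 ^ (k - 2 * j) * sphere_moment \<mu> (k - 2 * j) l"
  \<comment> \<open>Beyond i = n the exponent k - 2 i drops below the degree l, and the moment
    vanishes.\<close>
  have "sum ?t {..k div 2} = sum ?t {..n}"
  proof (rule sum.mono_neutral_right)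
    show "{..n} \<subseteq> {..k div 2}" using k by auto
    show "\<forall>i\<in>{..k div 2} - {..n}. ?t i = 0"
    proof
      fix i assume i: "i \<in> {..k div 2} - {..n}"
      have "k - 2 * i \<noteq> l + 2 * p" for p using i k by auto
      from sphere_moment_eq_0 [OF this] show "?t i = 0" by simp
    qed
  qed simp
  also have "\<dots> = (\<Sum>i\<le>n. ((-1) ^ i * real (n choose i) * pochhammer ((\<mu> + real (l + n)) - real i) n) / fact n)"
  proof (rule sum.cong [OF refl])
    fix i assume "i \<in> {..n}"
    then have i: "i \<le> n" by simp
    have e1: "k - 2 * i = l + 2 * (n - i)" and e2: "l + (n - i) = l + n - i" and e3: "k - i = (l + n - i) + n"
      using i k by simp_all
    have m: "sphere_moment \<mu> (k - 2 * i) l = fact (k - 2 * i) / (2 ^ (k - 2 * i) * fact (n - i) * pochhammer \<mu> (l + n - i))"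
      using sphere_moment_closed [OF \<mu>, of l "n - i"] unfolding e1 e2 by simp
    have P: "pochhammer \<mu> (l + n - i) > 0" using \<mu> by (rule pochhammer_pos)
    have poch: "pochhammer \<mu> (k - i) = pochhammer \<mu> (l + n - i) * pochhammer (\<mu> + real (l + n) - real i) n"
      unfolding e3 pochhammer_product' using i by (simp add: of_nat_diff algebra_simps)
    have ch: "real (n choose i) / fact n = 1 / (fact i * fact (n - i))"
      using i by (simp add: binomial_fact)
    have "?t i = (-1) ^ i * pochhammer (\<mu> + real (l + n) - real i) n * (1 / (fact i * fact (n - i)))"
      unfolding m poch using P by (simp add: field_simps)
    then show "?t i = ((-1) ^ i * real (n choose i) * pochhammer ((\<mu> + real (l + n)) - real i) n) / fact n"
      unfolding ch [symmetric] by simp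
  qed
  also have "\<dots> = 1"
    unfolding sum_divide_distrib [symmetric] alternating_binomial_pochhammer by simp
  finally show ?thesis unfolding if_P [OF True] .
qed

text \<open>With parameter m/2, the Gegenbauer polynomial is the sum of the reproducing kernels for
  spherical harmonics of degrees k, k - 2, and so on; here this is read off from its moments, power
  by power.\<close>

lemma integral_sphere_gegenbauer_harmonic:
  fixes H :: "real ^ 'n::finite \<Rightarrow> 'b::euclidean_space"
  assumes m: "CARD('n) \<ge> 2" and H: "hpoly l H" "\<And>x. lap H x = 0" and \<eta>: "norm \<eta> = 1"
  shows "(\<integral>\<omega>. gegenbauer k (real CARD('n) / 2) (\<omega> \<bullet> \<eta>) *\<^sub>R H \<omega> \<partial>sphere_measure) =
    (if l \<le> k \<and> even (k - l) then H \<eta> else 0)"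
proof -
  let ?\<mu> = "real CARD('n) / 2"
  let ?c = "\<lambda>j. (-1) ^ j * pochhammer ?\<mu> (k - j) / (fact j * fact (k - 2 * j)) * 2 ^ (k - 2 * j)"
  have int: "integrable sphere_measure (\<lambda>x. ?c j *\<^sub>R ((x \<bullet> \<eta>) ^ i *\<^sub>R H x))" for i j
    by (intro integrable_scaleR_right integrable_sphere_measure_continuous
        hpoly_continuous_on [OF hpoly_inner_power [OF H(1)]])
  have "(\<integral>\<omega>. gegenbauer k ?\<mu> (\<omega> \<bullet> \<eta>) *\<^sub>R H \<omega> \<partial>sphere_measure) =
      (\<integral>\<omega>. (\<Sum>j\<le>k div 2. ?c j *\<^sub>R ((\<omega> \<bullet> \<eta>) ^ (k - 2 * j) *\<^sub>R H \<omega>)) \<partial>sphere_measure)"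
    by (simp add: gegenbauer_def scaleR_sum_left power_mult_distrib mult.assoc)
  also have "\<dots> = (\<Sum>j\<le>k div 2. ?c j *\<^sub>R sphere_moment ?\<mu> (k - 2 * j) l *\<^sub>R H \<eta>)"
    by (subst Bochner_Integration.integral_sum, rule int,
        simp only: integral_scaleR_right integral_sphere_inner_power_harmonic [OF m H \<eta>])
  also have "\<dots> = (\<Sum>j\<le>k div 2. ?c j * sphere_moment ?\<mu> (k - 2 * j) l) *\<^sub>R H \<eta>"
    by (simp only: scaleR_scaleR scaleR_sum_left)
  also have "(\<Sum>j\<le>k div 2. ?c j * sphere_moment ?\<mu> (k - 2 * j) l) = (if l \<le> k \<and> even (k - l) then 1 else 0)"
    by (rule gegenbauer_sphere_moment) (use m in simp)
  finally show ?thesis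
    by (cases "l \<le> k \<and> even (k - l)") (simp_all only: simp_thms if_True if_False scaleR_one scaleR_zero_left)
qed

section \<open>Gegenbauer polynomials\<close>

text \<open>Extended by zero beyond \<open>k div 2\<close>, so that polynomials of different degree
  can be summed over one index range and compared power by power in 2 w.\<close>

definition gegenbauer_coeff :: "nat \<Rightarrow> real \<Rightarrow> nat \<Rightarrow> real" where
  "gegenbauer_coeff k \<mu> j =
     (if 2 * j \<le> k then (-1) ^ j * pochhammer \<mu> (k - j) / (fact j * fact (k - 2 * j)) else 0)"

lemma gegenbauer_eq_sum:
  assumes "k div 2 \<le> n"
  shows "gegenbauer k \<mu> w = (\<Sum>j\<le>n. gegenbauer_coeff k \<mu> j * (2 * w) ^ (k - 2 * j))"
proof -
  have "gegenbauer k \<mu> w = (\<Sum>j\<le>k div 2. gegenbauer_coeff k \<mu> j * (2 * w) ^ (k - 2 * j))"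
    unfolding gegenbauer_def by (rule sum.cong) (auto simp: gegenbauer_coeff_def)
  also have "\<dots> = (\<Sum>j\<le>n. gegenbauer_coeff k \<mu> j * (2 * w) ^ (k - 2 * j))"
    by (rule sum.mono_neutral_left) (use assms in \<open>auto simp: gegenbauer_coeff_def\<close>)
  finally show ?thesis .
qed

lemma times_gegenbauer_eq_sum:
  "w * gegenbauer k \<mu> w = (\<Sum>j\<le>Suc k. gegenbauer_coeff k \<mu> j / 2 * (2 * w) ^ (Suc k - 2 * j))"
proof -
  have "w * gegenbauer k \<mu> w = (\<Sum>j\<le>Suc k. w * (gegenbauer_coeff k \<mu> j * (2 * w) ^ (k - 2 * j)))"
    unfolding sum_distrib_left [symmetric] by (subst gegenbauer_eq_sum [of k "Suc k"]) simp_all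
  also have "\<dots> = (\<Sum>j\<le>Suc k. gegenbauer_coeff k \<mu> j / 2 * (2 * w) ^ (Suc k - 2 * j))"
    by (rule sum.cong) (auto simp: gegenbauer_coeff_def Suc_diff_le)
  finally show ?thesis .
qed

text \<open>All three coefficients are a common factor times a linear expression, because
  (\<mu>)_(i+1) = \<mu> (\<mu> + 1)_i. The halved term stems from multiplication by w = (2
  w)/2.\<close>

lemma gegenbauer_coeff_plus:
  assumes \<mu>: "\<mu> \<noteq> 0"
  shows "(real (Suc k) + 2 * \<mu>) / (2 * \<mu>) * gegenbauer_coeff (Suc k) \<mu> j =
    gegenbauer_coeff (Suc k) (\<mu> + 1) j - gegenbauer_coeff k (\<mu> + 1) j / 2"
proof (cases "2 * j \<le> Suc k")
  case True
  define i where "i = k - j"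
  have i: "Suc k - j = Suc i" using True by (simp add: i_def)
  define P where "P = pochhammer (\<mu> + 1) i"
  have 1: "pochhammer \<mu> (Suc i) = \<mu> * P" "pochhammer (\<mu> + 1) (Suc i) = P * (\<mu> + 1 + real i)"
    unfolding P_def by (rule pochhammer_rec) (simp add: pochhammer_Suc)
  have key: "X * (C * \<mu>) = C * Y - C * Q / 2" if "X * \<mu> = Y - Q / 2" for X Y Q C :: real
    using that by (metis mult.left_commute right_diff_distrib times_divide_eq_right)
  show ?thesis
  proof (cases "2 * j = Suc k")
    \<comment> \<open>At the top index the coefficient of the polynomial of degree k lies outside
      its range and is zero by convention.\<close>
    case eq: True
    then have "real (Suc k) = 2 * real j" "real j = 1 + real i" using i by linarith+
    then have X: "(real (Suc k) + 2 * \<mu>) / (2 * \<mu>) * \<mu> = (\<mu> + 1 + real i) - 0 / 2"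
      using \<mu> by (simp add: field_simps)
    let ?c = "(-1) ^ j * P / (fact j)"
    have a: "gegenbauer_coeff (Suc k) \<mu> j = ?c * \<mu>" "gegenbauer_coeff (Suc k) (\<mu> + 1) j = ?c * (\<mu> + 1 + real i)"
      "gegenbauer_coeff k (\<mu> + 1) j = ?c * 0"
      using eq by (simp_all add: gegenbauer_coeff_def i 1)
    show ?thesis unfolding a by (rule key [OF X])
  next
    case False
    define q where "q = k - 2 * j"
    have q: "Suc k - 2 * j = Suc q" "k - 2 * j = q" using True False by (simp_all add: q_def)
    have r: "real k = real q + 2 * real j" "real i = real q + real j"
      using True False by (simp_all add: q_def i_def of_nat_diff)
    let ?c = "(-1) ^ j * P / (fact j * fact (Suc q))"
    have a: "gegenbauer_coeff (Suc k) \<mu> j = ?c * \<mu>" "gegenbauer_coeff (Suc k) (\<mu> + 1) j = ?c * (\<mu> + 1 + real i)"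
      using True by (simp_all add: gegenbauer_coeff_def i 1 q)
    have b: "gegenbauer_coeff k (\<mu> + 1) j = ?c * real (Suc q)"
      using True False by (simp add: gegenbauer_coeff_def i_def [symmetric] P_def [symmetric] q)
    have "(real (Suc k) + 2 * \<mu>) / (2 * \<mu>) * \<mu> = (\<mu> + 1 + real i) - real (Suc q) / 2"
      using \<mu> by (simp add: r field_simps)
    then show ?thesis unfolding a b by (rule key)
  qed
qed (simp add: gegenbauer_coeff_def)

text \<open>Lowering the degree by two shifts the power index by one, hence the coefficient at j - 1
  with the separate value 0 at j = 0.\<close>

lemma gegenbauer_coeff_minus:
  assumes \<mu>: "\<mu> \<noteq> 0"
  shows "real (Suc (Suc k)) / (2 * \<mu>) * gegenbauer_coeff (Suc (Suc k)) \<mu> j =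
    gegenbauer_coeff (Suc k) (\<mu> + 1) j / 2 - (if j = 0 then 0 else gegenbauer_coeff k (\<mu> + 1) (j - 1))"
proof (cases "2 * j \<le> Suc (Suc k)")
  case True
  define i where "i = Suc k - j"
  have i: "Suc (Suc k) - j = Suc i" using True by (simp add: i_def)
  define P where "P = pochhammer (\<mu> + 1) i"
  have 1: "pochhammer \<mu> (Suc i) = \<mu> * P"
    by (simp_all add: P_def pochhammer_rec)
  define q where "q = Suc (Suc k) - 2 * j"
  have q: "Suc (Suc k) - 2 * j = q" "real (Suc (Suc k)) = real q + 2 * real j"
    using True by (simp_all add: q_def of_nat_diff)
  let ?c = "(-1) ^ j * P / (fact j * fact q)"
  have a: "gegenbauer_coeff (Suc (Suc k)) \<mu> j = ?c * \<mu>"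
    using True by (simp add: gegenbauer_coeff_def i 1 q)
  have b: "gegenbauer_coeff (Suc k) (\<mu> + 1) j = ?c * real q"
  proof (cases q)
    case 0
    then have "\<not> 2 * j \<le> Suc k" using True by (simp add: q_def)
    then show ?thesis by (simp add: gegenbauer_coeff_def 0)
  next
    case (Suc q')
    have "2 * j \<le> Suc k" "Suc k - 2 * j = q'" using Suc by (simp_all add: q_def)
    then show ?thesis by (simp add: gegenbauer_coeff_def Suc i_def [symmetric] P_def [symmetric])
  qed
  have d: "(if j = 0 then 0 else gegenbauer_coeff k (\<mu> + 1) (j - 1)) = - ?c * real j"
  proof (cases j)
    case (Suc j')
    have "2 * j' \<le> k" "k - 2 * j' = q" "k - j' = i" using Suc True by (simp_all add: q_def i_def)
    then show ?thesis by (simp add: gegenbauer_coeff_def Suc P_def [symmetric])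
  qed simp
  show ?thesis
    unfolding a b d q using \<mu> by (simp add: field_simps)
qed (auto simp: gegenbauer_coeff_def)

text \<open>Index k - 1 with the value 0 at index -1; truncated subtraction alone would give the
  constant 1 at k = 0. Consequently \<open>gegenbauer_pred (k - 1)\<close> has index k - 2 and is
  zero for k < 2.\<close>

definition gegenbauer_pred :: "nat \<Rightarrow> real \<Rightarrow> real \<Rightarrow> real" where
  "gegenbauer_pred k \<mu> w = (case k of 0 \<Rightarrow> 0 | Suc k' \<Rightarrow> gegenbauer k' \<mu> w)"

lemma gegenbauer_0 [simp]: "gegenbauer 0 \<mu> w = 1"
  by (simp add: gegenbauer_def)

lemma gegenbauer_plus_identity:
  assumes \<mu>: "\<mu> \<noteq> 0"
  shows "(real k + 2 * \<mu>) / (2 * \<mu>) * gegenbauer k \<mu> w =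
    gegenbauer k (\<mu> + 1) w - w * gegenbauer_pred k (\<mu> + 1) w"
proof (cases k)
  case 0
  with \<mu> show ?thesis by (simp add: gegenbauer_pred_def)
next
  case (Suc k')
  have "(real k + 2 * \<mu>) / (2 * \<mu>) * gegenbauer k \<mu> w =
      (\<Sum>j\<le>k. ((real k + 2 * \<mu>) / (2 * \<mu>) * gegenbauer_coeff k \<mu> j) * (2 * w) ^ (k - 2 * j))"
    by (subst gegenbauer_eq_sum [of k k]) (simp_all add: sum_distrib_left mult.assoc)
  also have "\<dots> = (\<Sum>j\<le>k. gegenbauer_coeff k (\<mu> + 1) j * (2 * w) ^ (k - 2 * j)) -
      (\<Sum>j\<le>k. gegenbauer_coeff k' (\<mu> + 1) j / 2 * (2 * w) ^ (k - 2 * j))"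
    unfolding Suc gegenbauer_coeff_plus [OF \<mu>] left_diff_distrib sum_subtractf ..
  also have "\<dots> = gegenbauer k (\<mu> + 1) w - w * gegenbauer k' (\<mu> + 1) w"
    by (subst gegenbauer_eq_sum [of k k]) (simp_all add: Suc times_gegenbauer_eq_sum)
  finally show ?thesis by (simp add: Suc gegenbauer_pred_def)
qed

lemma gegenbauer_minus_identity:
  assumes \<mu>: "\<mu> \<noteq> 0"
  shows "real k / (2 * \<mu>) * gegenbauer k \<mu> w =
    w * gegenbauer_pred k (\<mu> + 1) w - gegenbauer_pred (k - 1) (\<mu> + 1) w"
proof -
  consider "k = 0" | "k = 1" | k' where "k = Suc (Suc k')"
    by (metis One_nat_def not0_implies_Suc)
  then show ?thesis
  proof cases
    case 3
    have "real k / (2 * \<mu>) * gegenbauer k \<mu> w =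
        (\<Sum>j\<le>k. (real k / (2 * \<mu>) * gegenbauer_coeff k \<mu> j) * (2 * w) ^ (k - 2 * j))"
      by (subst gegenbauer_eq_sum [of k k]) (simp_all add: sum_distrib_left mult.assoc)
    also have "\<dots> = (\<Sum>j\<le>k. gegenbauer_coeff (Suc k') (\<mu> + 1) j / 2 * (2 * w) ^ (k - 2 * j)) -
        (\<Sum>j\<le>k. (if j = 0 then 0 else gegenbauer_coeff k' (\<mu> + 1) (j - 1)) * (2 * w) ^ (k - 2 * j))"
      unfolding 3 gegenbauer_coeff_minus [OF \<mu>] left_diff_distrib sum_subtractf ..
    also have "(\<Sum>j\<le>k. (if j = 0 then 0 else gegenbauer_coeff k' (\<mu> + 1) (j - 1)) * (2 * w) ^ (k - 2 * j)) =
        gegenbauer k' (\<mu> + 1) w"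
      unfolding 3 by (subst sum.atMost_Suc_shift, subst gegenbauer_eq_sum [of k' "Suc k'"]) auto
    finally show ?thesis by (simp add: 3 gegenbauer_pred_def times_gegenbauer_eq_sum)
  qed (use \<mu> in \<open>simp_all add: gegenbauer_pred_def gegenbauer_def\<close>)
qed

section \<open>Continuity in the parameter and the limit case m = 2\<close>

lemma tendsto_pochhammer [tendsto_intros]:
  fixes a :: real
  shows "(f \<longlongrightarrow> a) F \<Longrightarrow> ((\<lambda>x. pochhammer (f x) n) \<longlongrightarrow> pochhammer a n) F"
  by (induction n) (auto simp: pochhammer_Suc intro!: tendsto_intros)

lemma tendsto_gegenbauer [tendsto_intros]:
  "(f \<longlongrightarrow> a) F \<Longrightarrow> ((\<lambda>x. gegenbauer k (f x) w) \<longlongrightarrow> gegenbauer k a w) F"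
  unfolding gegenbauer_def by (intro tendsto_intros) auto

lemma tendsto_gegenbauer_pred [tendsto_intros]:
  "(f \<longlongrightarrow> a) F \<Longrightarrow> ((\<lambda>x. gegenbauer_pred k (f x) w) \<longlongrightarrow> gegenbauer_pred k a w) F"
  unfolding gegenbauer_pred_def by (cases k) (auto intro: tendsto_intros)

text \<open>The form with raised parameter is continuous at \<mu> = 0, so it gives the limit there
  and the quotient elsewhere.\<close>

lemma gegenbauer_plus_eq:
  "gegenbauer_plus k \<mu> w = gegenbauer k (\<mu> + 1) w - w * gegenbauer_pred k (\<mu> + 1) w"
proof (cases "\<mu> = 0")
  case True
  have "((\<lambda>\<nu>. gegenbauer k (\<nu> + 1) w - w * gegenbauer_pred k (\<nu> + 1) w) \<longlongrightarrow>
      gegenbauer k (0 + 1) w - w * gegenbauer_pred k (0 + 1) w) (at 0)"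
    by (intro tendsto_intros)
  then have "((\<lambda>\<nu>. (real k + 2 * \<nu>) / (2 * \<nu>) * gegenbauer k \<nu> w) \<longlongrightarrow>
      gegenbauer k (0 + 1) w - w * gegenbauer_pred k (0 + 1) w) (at 0)"
    by (rule Lim_transform_eventually)
      (rule eventually_mono [OF eventually_neq_at_within], erule gegenbauer_plus_identity [symmetric])
  then show ?thesis
    by (simp add: gegenbauer_plus_def True tendsto_Lim)
next
  case False
  show ?thesis
    unfolding gegenbauer_plus_def gegenbauer_plus_identity [OF False, symmetric] using False by (simp only: if_False)
qed

lemma gegenbauer_minus_eq:
  "gegenbauer_minus k \<mu> w = w * gegenbauer_pred k (\<mu> + 1) w - gegenbauer_pred (k - 1) (\<mu> + 1) w"
proof (cases "\<mu> = 0")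
  case True
  have "((\<lambda>\<nu>. w * gegenbauer_pred k (\<nu> + 1) w - gegenbauer_pred (k - 1) (\<nu> + 1) w) \<longlongrightarrow>
      w * gegenbauer_pred k (0 + 1) w - gegenbauer_pred (k - 1) (0 + 1) w) (at 0)"
    by (intro tendsto_intros)
  then have "((\<lambda>\<nu>. real k / (2 * \<nu>) * gegenbauer k \<nu> w) \<longlongrightarrow>
      w * gegenbauer_pred k (0 + 1) w - gegenbauer_pred (k - 1) (0 + 1) w) (at 0)"
    by (rule Lim_transform_eventually)
      (rule eventually_mono [OF eventually_neq_at_within], erule gegenbauer_minus_identity [symmetric])
  then show ?thesis
    by (simp add: gegenbauer_minus_def True tendsto_Lim)
next
  case False
  show ?thesis
    unfolding gegenbauer_minus_def gegenbauer_minus_identity [OF False, symmetric] using False by (simp only: if_False)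
qed


section \<open>Bounds for the special functions\<close>

text \<open>Since \<nu> + 1 \<ge> 1/2, the rising factorial of length j at \<nu> + 1 is at least
  2^(-j). Hence 1/\<Gamma>(\<nu> + j + 1) is at most 2^j/\<Gamma>(\<nu> + 1), and the series is
  dominated by that of exp (z^2/2).\<close>

lemma abs_bessel_J_le:
  assumes \<nu>: "\<nu> \<ge> - 1 / 2" and z: "z > 0"
  shows "\<bar>bessel_J \<nu> z\<bar> \<le> (z / 2) powr \<nu> * rGamma (\<nu> + 1) * exp (z\<^sup>2 / 2)"
proof -
  let ?t = "\<lambda>j. (-1) ^ j * rGamma (real j + \<nu> + 1) / fact j * (z / 2) powr (2 * real j + \<nu>)"
  let ?C = "(z / 2) powr \<nu> * rGamma (\<nu> + 1)"
  have G: "rGamma (\<nu> + 1) > 0"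
    using \<nu> by (simp add: rGamma_inverse_Gamma)
  have t: "norm (?t j) \<le> ?C * ((z\<^sup>2 / 2) ^ j /\<^sub>R fact j)" for j
  proof -
    have p: "(1 / 2) ^ j \<le> pochhammer (\<nu> + 1) j"
    proof (induction j)
      case (Suc j)
      have "(1 / 2) ^ j * (1 / 2) \<le> pochhammer (\<nu> + 1) j * (\<nu> + 1 + real j)"
        using Suc \<nu> by (intro mult_mono) (auto intro: order_trans [OF _ Suc])
      then show ?case by (simp add: pochhammer_Suc mult.commute)
    qed simp
    have "0 < pochhammer (\<nu> + 1) j" using p by (rule less_le_trans [rotated]) simp
    moreover have "rGamma (\<nu> + 1) = pochhammer (\<nu> + 1) j * rGamma (\<nu> + 1 + real j)"
      by (rule pochhammer_rGamma)
    ultimately have r: "rGamma (real j + \<nu> + 1) = rGamma (\<nu> + 1) / pochhammer (\<nu> + 1) j"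
      by (simp add: field_simps add_ac)
    also have "\<dots> \<le> rGamma (\<nu> + 1) / (1 / 2) ^ j"
      using p G by (intro divide_left_mono) (auto intro!: mult_pos_pos \<open>0 < pochhammer (\<nu> + 1) j\<close>)
    finally have r1: "rGamma (real j + \<nu> + 1) \<le> rGamma (\<nu> + 1) * 2 ^ j"
      by (simp add: power_divide)
    have r0: "0 \<le> rGamma (real j + \<nu> + 1)"
      unfolding r using G \<open>0 < pochhammer (\<nu> + 1) j\<close> by simp
    have pw: "(z / 2) powr (2 * real j + \<nu>) = (z / 2) powr \<nu> * (z\<^sup>2 / 4) ^ j"
    proof -
      have "(z / 2) powr (2 * real j) = (z / 2) ^ (2 * j)"
        using powr_realpow [of "z / 2" "2 * j"] z by simp
      also have "\<dots> = (z\<^sup>2 / 4) ^ j"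
        by (simp add: power_mult power_divide)
      finally show ?thesis by (simp add: powr_add mult.commute)
    qed
    have "norm (?t j) = rGamma (real j + \<nu> + 1) * ((z / 2) powr (2 * real j + \<nu>) / fact j)"
      using r0 by (simp add: abs_mult)
    also have "\<dots> \<le> rGamma (\<nu> + 1) * 2 ^ j * ((z / 2) powr (2 * real j + \<nu>) / fact j)"
      using r1 by (intro mult_right_mono) auto
    also have "\<dots> = ?C * ((z\<^sup>2 / 2) ^ j /\<^sub>R fact j)"
      unfolding pw by (simp add: field_simps power_divide flip: power_mult_distrib)
    finally show ?thesis .
  qed
  have s: "(\<lambda>j. ?C * ((z\<^sup>2 / 2) ^ j /\<^sub>R fact j)) sums (?C * exp (z\<^sup>2 / 2))"
    by (intro sums_mult exp_converges)
  have "norm (suminf ?t) \<le> (\<Sum>j. ?C * ((z\<^sup>2 / 2) ^ j /\<^sub>R fact j))"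
    by (rule norm_suminf_le [OF t]) (rule sums_summable [OF s])
  then show ?thesis
    using sums_unique [OF s] by (simp add: bessel_J_def)
qed

text \<open>Euler's integral is restricted to [Y, Y + 1], an interval of length 1 on which the
  integrand is at least the stated value. The free parameter Y is later chosen to beat a given
  geometric growth.\<close>

lemma Gamma_ge_powr:
  assumes x: "x \<ge> 1" and Y: "Y > (0::real)"
  shows "Y powr (x - 1) * exp (- (Y + 1)) \<le> Gamma x"
proof (rule has_integral_le)
  let ?c = "Y powr (x - 1) * exp (- (Y + 1))"
  have "((\<lambda>t. ?c) has_integral ?c) {Y..Y + 1}"
    using has_integral_const_real [of ?c Y "Y + 1"] by (simp only: content_real) simp
  then show "((\<lambda>t. if t \<in> {Y..Y + 1} then ?c else 0) has_integral ?c) {0..}"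
    using Y by (subst has_integral_restrict) auto
  show "((\<lambda>t. t powr (x - 1) / exp t) has_integral Gamma x) {0..}"
    using x by (intro Gamma_integral_real) simp
  fix t :: real assume "t \<in> {0..}"
  show "(if t \<in> {Y..Y + 1} then ?c else 0) \<le> t powr (x - 1) / exp t"
  proof (cases "t \<in> {Y..Y + 1}")
    case True
    then have "Y powr (x - 1) * exp (- (Y + 1)) \<le> t powr (x - 1) * exp (- t)"
      using x Y by (intro mult_mono powr_mono2) auto
    with True show ?thesis by (simp add: exp_minus field_simps)
  qed auto
qed

lemma summable_power_mult_rGamma:
  fixes X \<kappa> b :: real
  assumes \<kappa>: "\<kappa> > 0" and X: "X > 0"
  shows "summable (\<lambda>k. X ^ k * rGamma (b + real k * \<kappa>))"
proof (rule summable_comparison_test_ev)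
  \<comment> \<open>Chosen so that Y^\<kappa> = 2 X; then X^k/\<Gamma>(b + k \<kappa>) is eventually
    at most a constant times 2^(-k).\<close>
  define Y where "Y = (2 * X) powr (1 / \<kappa>)"
  have Y: "Y > 0" using X by (simp add: Y_def)
  let ?C = "exp (Y + 1) * Y powr (1 - b)"
  show "summable (\<lambda>k. ?C * (1 / 2) ^ k)"
    by (intro summable_mult summable_geometric) simp
  \<comment> \<open>From K on the argument of \<Gamma> is at least 1, as the lower bound for
    \<Gamma> requires.\<close>
  obtain K where K: "(1 - b) / \<kappa> \<le> real K" using real_arch_simple by blast
  show "\<forall>\<^sub>F k in sequentially. norm (X ^ k * rGamma (b + real k * \<kappa>)) \<le> ?C * (1 / 2) ^ k"
    using eventually_ge_at_top [of K]
  proof eventually_elim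
    case (elim k)
    have "(1 - b) / \<kappa> \<le> real k" using K elim by linarith
    then have x: "b + real k * \<kappa> \<ge> 1" using \<kappa> by (simp add: field_simps)
    have pos: "Y powr (b + real k * \<kappa> - 1) * exp (- (Y + 1)) > 0" using Y by simp
    have "rGamma (b + real k * \<kappa>) \<le> inverse (Y powr (b + real k * \<kappa> - 1) * exp (- (Y + 1)))"
      unfolding rGamma_inverse_Gamma using Gamma_ge_powr [OF x Y] pos by (rule le_imp_inverse_le)
    also have "\<dots> = exp (Y + 1) * Y powr (1 - b - real k * \<kappa>)"
    proof -
      have "inverse (Y powr (b + real k * \<kappa> - 1)) = Y powr (1 - b - real k * \<kappa>)"
        by (simp add: algebra_simps flip: powr_minus)
      moreover have "inverse (exp (- (Y + 1))) = exp (Y + 1)"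
        by (simp only: exp_minus inverse_inverse_eq)
      ultimately show ?thesis by (simp only: inverse_mult_distrib mult.commute)
    qed
    also have "Y powr (1 - b - real k * \<kappa>) = Y powr (1 - b) * Y powr (- (real k * \<kappa>))"
      by (simp flip: powr_add)
    also have "Y powr (- (real k * \<kappa>)) = inverse ((2 * X) ^ k)"
      using \<kappa> X by (simp add: Y_def powr_powr powr_minus powr_realpow)
    finally have le: "rGamma (b + real k * \<kappa>) \<le> ?C * inverse ((2 * X) ^ k)" by simp
    have "rGamma (b + real k * \<kappa>) \<ge> 0" using x by (simp add: rGamma_inverse_Gamma)
    then have "norm (X ^ k * rGamma (b + real k * \<kappa>)) = X ^ k * rGamma (b + real k * \<kappa>)"
      using X by (simp add: abs_mult)
    also have "\<dots> \<le> X ^ k * (?C * inverse ((2 * X) ^ k))"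
      using le X by (intro mult_left_mono) auto
    also have "\<dots> = ?C * (1 / 2) ^ k"
      using X by (simp add: power_mult_distrib power_divide field_simps)
    finally show ?case .
  qed
qed

text \<open>In the base 8 N, the factor N comes from (\<mu>)_n \<le> N^n n!, and one factor 2 each
  from the binomial coefficient, from |2 w| \<le> 2 and from counting the summands.\<close>

lemma abs_gegenbauer_le:
  assumes \<mu>: "0 \<le> \<mu>" "\<mu> \<le> N" and N: "1 \<le> N" and w: "\<bar>w\<bar> \<le> 1"
  shows "\<bar>gegenbauer k \<mu> w\<bar> \<le> (8 * N) ^ k"
proof -
  have p: "pochhammer \<mu> n \<le> N ^ n * fact n" for n
  proof (induction n)
    case (Suc n)
    have "\<mu> + real n \<le> N * real (Suc n)"
      using \<mu> N mult_right_mono [of 1 N "real n"] by (simp add: algebra_simps)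
    then have "pochhammer \<mu> n * (\<mu> + real n) \<le> (N ^ n * fact n) * (N * real (Suc n))"
      using Suc \<mu> N by - (rule mult_mono, auto)
    then show ?case by (simp add: pochhammer_Suc mult_ac)
  qed simp
  have p0: "pochhammer \<mu> n \<ge> 0" for n
    using \<mu> by (induction n) (auto simp: pochhammer_Suc)
  have t: "\<bar>(-1) ^ j * pochhammer \<mu> (k - j) / (fact j * fact (k - 2 * j)) * (2 * w) ^ (k - 2 * j)\<bar> \<le> (4 * N) ^ k"
    if j: "j \<le> k div 2" for j
  proof -
    have c: "(fact (k - j) :: real) / (fact j * fact (k - 2 * j)) = real ((k - j) choose j)"
    proof -
      have "j \<le> k - j" "k - j - j = k - 2 * j" using j by auto
      then show ?thesis using binomial_fact [of j "k - j", where 'a = real] by simp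
    qed
    have "\<bar>(2 * w) ^ (k - 2 * j)\<bar> \<le> 2 ^ (k - 2 * j)"
      unfolding power_abs using w by (intro power_mono) (auto simp: abs_mult)
    also have "\<dots> \<le> (2::real) ^ k" by (intro power_increasing) auto
    finally have w': "\<bar>(2 * w) ^ (k - 2 * j)\<bar> \<le> 2 ^ k" .
    have "pochhammer \<mu> (k - j) / (fact j * fact (k - 2 * j)) \<le> N ^ (k - j) * fact (k - j) / (fact j * fact (k - 2 * j))"
      by (intro divide_right_mono p) simp
    also have "\<dots> = N ^ (k - j) * real ((k - j) choose j)"
      unfolding c [symmetric] by simp
    also have "\<dots> \<le> N ^ k * 2 ^ k"
    proof (intro mult_mono)
      show "N ^ (k - j) \<le> N ^ k" using N by (intro power_increasing) auto
      have "(k - j) choose j \<le> 2 ^ (k - j)" by (rule binomial_le_pow2)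
      also have "\<dots> \<le> 2 ^ k" by (intro power_increasing) auto
      finally have "real ((k - j) choose j) \<le> real (2 ^ k)" by (simp only: of_nat_le_iff)
      then show "real ((k - j) choose j) \<le> 2 ^ k" by simp
    qed (use N in auto)
    finally have "pochhammer \<mu> (k - j) / (fact j * fact (k - 2 * j)) * \<bar>(2 * w) ^ (k - 2 * j)\<bar> \<le> N ^ k * 2 ^ k * 2 ^ k"
      using w' N by - (rule mult_mono, simp_all)
    also have "N ^ k * 2 ^ k * 2 ^ k = (N * 2 * 2) ^ k"
      by (simp only: power_mult_distrib)
    also have "N * 2 * 2 = 4 * N" by simp
    finally show ?thesis
      using p0 by (simp add: abs_mult)
  qed
  have "\<bar>gegenbauer k \<mu> w\<bar> \<le> (\<Sum>j\<le>k div 2. (4 * N) ^ k)"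
    unfolding gegenbauer_def by (rule order_trans [OF sum_abs sum_mono]) (use t in auto)
  also have "\<dots> = real (Suc (k div 2)) * (4 * N) ^ k" by simp
  also have "\<dots> \<le> 2 ^ k * (4 * N) ^ k"
  proof (intro mult_right_mono)
    have "Suc (k div 2) \<le> Suc k" by simp
    also have "Suc k \<le> 2 ^ k" using less_exp [of k] by (simp only: Suc_le_eq)
    finally have "real (Suc (k div 2)) \<le> real (2 ^ k)" by (simp only: of_nat_le_iff)
    then show "real (Suc (k div 2)) \<le> 2 ^ k" by simp
  qed (use N in auto)
  also have "\<dots> = (2 * (4 * N)) ^ k" by (simp only: power_mult_distrib)
  also have "2 * (4 * N) = 8 * N" by simp
  finally show ?thesis .
qed

lemma abs_gegenbauer_pred_le:
  assumes "0 \<le> \<mu>" "\<mu> \<le> N" "1 \<le> N" "\<bar>w\<bar> \<le> 1"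
  shows "\<bar>gegenbauer_pred k \<mu> w\<bar> \<le> (8 * N) ^ k" "\<bar>gegenbauer_pred (k - 1) \<mu> w\<bar> \<le> (8 * N) ^ k"
proof -
  have 1: "\<bar>gegenbauer_pred k \<mu> w\<bar> \<le> (8 * N) ^ k" for k
  proof (cases k)
    case (Suc k')
    have "\<bar>gegenbauer k' \<mu> w\<bar> \<le> (8 * N) ^ k'" using assms by (rule abs_gegenbauer_le)
    also have "\<dots> \<le> (8 * N) ^ k" unfolding Suc using assms by (intro power_increasing) auto
    finally show ?thesis by (simp add: gegenbauer_pred_def Suc)
  qed (simp add: gegenbauer_pred_def)
  then show "\<bar>gegenbauer_pred k \<mu> w\<bar> \<le> (8 * N) ^ k" .
  have "(8 * N) ^ (k - 1) \<le> (8 * N) ^ k" using assms by (intro power_increasing) auto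
  with 1 [of "k - 1"] show "\<bar>gegenbauer_pred (k - 1) \<mu> w\<bar> \<le> (8 * N) ^ k" by linarith
qed

text \<open>Every order in the kernel has the form \<nu> + t with t \<ge> 0, so the prefactor
  z^(-\<nu>) leaves only the nonnegative power z^t and the bound stays uniform as z tends to
  0.\<close>

lemma abs_powr_bessel_J_le:
  assumes \<nu>: "\<nu> \<ge> - 1 / 2" and t: "t \<ge> 0" and z: "0 < z" "z \<le> Z" and Z: "1 \<le> Z"
  shows "\<bar>z powr (- \<nu>) * bessel_J (\<nu> + t) z\<bar> \<le> 2 powr (- \<nu>) * exp (Z\<^sup>2 / 2) * (Z powr t * rGamma (\<nu> + 1 + t))"
proof -
  have G: "rGamma (\<nu> + 1 + t) \<ge> 0" using \<nu> t by (simp add: rGamma_inverse_Gamma)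
  have "\<bar>z powr (- \<nu>) * bessel_J (\<nu> + t) z\<bar> \<le> z powr (- \<nu>) * ((z / 2) powr (\<nu> + t) * rGamma (\<nu> + t + 1) * exp (z\<^sup>2 / 2))"
    using abs_bessel_J_le [of "\<nu> + t" z] \<nu> t z by (simp add: abs_mult mult_left_mono)
  also have "z powr (- \<nu>) * ((z / 2) powr (\<nu> + t) * rGamma (\<nu> + t + 1) * exp (z\<^sup>2 / 2)) =
      (2 powr (- \<nu>) * exp (z\<^sup>2 / 2)) * ((z / 2) powr t * rGamma (\<nu> + 1 + t))"
    using z by (simp add: powr_add powr_divide powr_minus field_simps add_ac)
  also have "\<dots> \<le> (2 powr (- \<nu>) * exp (Z\<^sup>2 / 2)) * (Z powr t * rGamma (\<nu> + 1 + t))"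
  proof (rule mult_mono)
    show "2 powr (- \<nu>) * exp (z\<^sup>2 / 2) \<le> 2 powr (- \<nu>) * exp (Z\<^sup>2 / 2)"
      using z by (intro mult_left_mono) (auto intro!: power_mono)
    show "(z / 2) powr t * rGamma (\<nu> + 1 + t) \<le> Z powr t * rGamma (\<nu> + 1 + t)"
      using z t G by (intro mult_right_mono powr_mono2) auto
  qed (use G in auto)
  finally show ?thesis .
qed


section \<open>The kernel as a series of zonal monogenics\<close>

text \<open>The radial coefficients carry the prefactor of the first series of the kernel. The
  prefactor of the second differs by 1/z, which the wedge product of x and y makes up for.\<close>

definition bessel_P :: "nat \<Rightarrow> real \<Rightarrow> nat \<Rightarrow> real \<Rightarrow> complex" where
  "bessel_P m c k z = of_real (z powr (- (def_delta m c - 2) / 2)) *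
     (def_alpha c (int k) * of_real (bessel_J (def_gamma m c (int k) / 2 - 1) z))"

definition bessel_Q :: "nat \<Rightarrow> real \<Rightarrow> nat \<Rightarrow> real \<Rightarrow> complex" where
  "bessel_Q m c k z = of_real (z powr (- (def_delta m c - 2) / 2)) *
     (- \<i> * def_alpha c (int k - 1) * of_real (bessel_J (def_gamma m c (int k - 1) / 2) z))"

lemma bessel_Q_0 [simp]: "bessel_Q m c 0 z = 0"
  by (simp add: bessel_Q_def def_alpha_def)

lemma norm_def_alpha_le: "norm (def_alpha c k) \<le> 1"
proof -
  define t where "t = - (pi * of_int k / (2 * (1 + c)))"
  have e: "- (\<i> * of_real pi * of_int k / (2 * (1 + of_real c))) = \<i> * complex_of_real t"
    by (simp add: t_def)
  show ?thesis
    unfolding def_alpha_def e by simp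
qed

text \<open>Measured from \<nu> = (\<delta> - 2)/2, the exponent in the prefactor, both families of
  orders are arithmetic progressions with step 1/(1+c).\<close>

lemma bessel_orders:
  assumes c: "c > -1"
  shows "(def_delta m c - 2) / 2 = (real m - 1) / (2 * (1 + c)) - 1 / 2"
    and "def_gamma m c (int k) / 2 - 1 = (def_delta m c - 2) / 2 + real k * (1 / (1 + c))"
    and "def_gamma m c (int k) / 2 = (def_delta m c - 2) / 2 + (1 + real k * (1 / (1 + c)))"
proof -
  define \<kappa> where "\<kappa> = 1 / (1 + c)"
  have "(c + 2) / (1 + c) = 1 + \<kappa>" using c by (simp add: \<kappa>_def field_simps)
  then have \<gamma>: "def_gamma m c (int k) = 2 * \<kappa> * (real k + (real m - 2) / 2) + (1 + \<kappa>)"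
    by (simp add: def_gamma_def \<kappa>_def)
  have \<delta>: "def_delta m c = 1 + (real m - 1) * \<kappa>"
    by (simp add: def_delta_def \<kappa>_def)
  have "(real m - 1) / (2 * (1 + c)) = (real m - 1) * \<kappa> / 2"
    by (simp add: \<kappa>_def)
  then show "(def_delta m c - 2) / 2 = (real m - 1) / (2 * (1 + c)) - 1 / 2"
    by (simp only: \<delta>) (simp add: diff_divide_distrib add_divide_distrib)
  show "def_gamma m c (int k) / 2 - 1 = (def_delta m c - 2) / 2 + real k * (1 / (1 + c))"
    "def_gamma m c (int k) / 2 = (def_delta m c - 2) / 2 + (1 + real k * (1 / (1 + c)))"
    unfolding \<gamma> \<delta> \<kappa>_def [symmetric] by (simp_all add: algebra_simps diff_divide_distrib add_divide_distrib)
qed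

text \<open>The weight X^k is there to absorb the geometric growth of the Gegenbauer polynomials;
  uniformity for z in (0, Z] lets the bound serve on a whole ball.\<close>

lemma bessel_PQ_bound:
  assumes c: "c > -1" and m: "m \<ge> 2" and X: "X > 0"
  obtains b where "summable (\<lambda>k. X ^ k * b k)" "\<And>k. b k \<ge> 0"
    "\<And>k z. 0 < z \<Longrightarrow> z \<le> Z \<Longrightarrow> norm (bessel_P m c k z) \<le> b k"
    "\<And>k z. 0 < z \<Longrightarrow> z \<le> Z \<Longrightarrow> norm (bessel_Q m c k z) \<le> b k"
proof -
  define \<nu> where "\<nu> = (def_delta m c - 2) / 2"
  define \<kappa> where "\<kappa> = 1 / (1 + c)"
  define Y where "Y = max 1 Z"
  define C where "C = 2 powr (- \<nu>) * exp (Y\<^sup>2 / 2)"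
  define r where "r k = Y powr (real k * \<kappa>) * rGamma (\<nu> + 1 + real k * \<kappa>)" for k :: nat
  define r' where "r' k = Y powr (1 + real k * \<kappa>) * rGamma (\<nu> + 1 + (1 + real k * \<kappa>))" for k :: nat
  \<comment> \<open>The second summand is delayed by one index because \<open>bessel_Q\<close> at k
    contains the Bessel function of index k - 1 and vanishes at k = 0.\<close>
  define b where "b k = C * (r k + (case k of 0 \<Rightarrow> 0 | Suc k' \<Rightarrow> r' k'))" for k
  have \<kappa>: "\<kappa> > 0" using c by (simp add: \<kappa>_def)
  have \<nu>: "\<nu> \<ge> - 1 / 2"
    unfolding \<nu>_def bessel_orders(1) [OF c] using c m by simp
  have Y: "Y \<ge> 1" by (simp add: Y_def)
  have C: "C \<ge> 0" by (simp add: C_def)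
  have r0: "r k \<ge> 0" "r' k \<ge> 0" for k
  proof -
    have "\<nu> + 1 > 0" "real k * \<kappa> \<ge> 0" using \<nu> \<kappa> by simp_all
    then have "Gamma (\<nu> + 1 + real k * \<kappa>) > 0" "Gamma (\<nu> + 1 + (1 + real k * \<kappa>)) > 0"
      by (intro Gamma_real_pos, linarith)+
    then show "r k \<ge> 0" "r' k \<ge> 0"
      by (simp_all add: r_def r'_def rGamma_inverse_Gamma)
  qed
  have exponent: "- (def_delta m c - 2) / 2 = - \<nu>"
    unfolding \<nu>_def by (rule minus_divide_left [symmetric])
  note orders = bessel_orders(2,3) [OF c, of m, folded \<nu>_def \<kappa>_def]
  have P: "norm (bessel_P m c k z) \<le> b k" if z: "0 < z" "z \<le> Z" for k z
  proof -
    have "norm (bessel_P m c k z) = norm (def_alpha c (int k)) * \<bar>z powr (- \<nu>) * bessel_J (\<nu> + real k * \<kappa>) z\<bar>"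
      unfolding bessel_P_def exponent orders by (simp add: norm_mult abs_mult)
    also have "\<dots> \<le> 1 * (C * r k)"
      unfolding C_def r_def
      by (rule mult_mono [OF norm_def_alpha_le abs_powr_bessel_J_le])
        (use \<nu> \<kappa> z Y in \<open>auto simp: Y_def\<close>)
    also have "\<dots> \<le> b k"
      unfolding b_def using C r0 by (simp add: distrib_left split: nat.split)
    finally show ?thesis .
  qed
  have Q: "norm (bessel_Q m c k z) \<le> b k" if z: "0 < z" "z \<le> Z" for k z
  proof (cases k)
    case 0
    then show ?thesis using C r0 by (simp add: b_def)
  next
    case (Suc k')
    have "norm (bessel_Q m c k z) = norm (def_alpha c (int k')) * \<bar>z powr (- \<nu>) * bessel_J (\<nu> + (1 + real k' * \<kappa>)) z\<bar>"
    proof -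
      have k: "int k - 1 = int k'" by (simp add: Suc)
      show ?thesis
        unfolding bessel_Q_def exponent k orders by (simp add: norm_mult abs_mult)
    qed
    also have "\<dots> \<le> 1 * (C * r' k')"
      unfolding C_def r'_def
      by (rule mult_mono [OF norm_def_alpha_le abs_powr_bessel_J_le])
        (use \<nu> \<kappa> z Y in \<open>auto simp: Y_def\<close>)
    also have "\<dots> \<le> b k"
      unfolding b_def using C r0 by (simp add: distrib_left Suc)
    finally show ?thesis .
  qed
  have pw: "Y powr (real k * \<kappa>) = (Y powr \<kappa>) ^ k" for k
    using Y by (simp add: mult.commute [of _ \<kappa>] powr_powr [symmetric] powr_realpow)
  have s1: "summable (\<lambda>k. X ^ k * r k)"
  proof -
    have "summable (\<lambda>k. (X * Y powr \<kappa>) ^ k * rGamma (\<nu> + 1 + real k * \<kappa>))"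
      using X Y by (intro summable_power_mult_rGamma [OF \<kappa>]) simp
    then show ?thesis by (simp add: r_def pw power_mult_distrib mult.assoc)
  qed
  have s2: "summable (\<lambda>k. X ^ k * r' k)"
  proof -
    have "summable (\<lambda>k. Y * ((X * Y powr \<kappa>) ^ k * rGamma ((\<nu> + 2) + real k * \<kappa>)))"
      using X Y by (intro summable_mult summable_power_mult_rGamma [OF \<kappa>]) simp
    moreover have "Y * ((X * Y powr \<kappa>) ^ k * rGamma ((\<nu> + 2) + real k * \<kappa>)) = X ^ k * r' k" for k
    proof -
      have "Y powr (1 + real k * \<kappa>) = Y * (Y powr \<kappa>) ^ k" using Y by (simp add: powr_add pw)
      moreover have "\<nu> + 1 + (1 + real k * \<kappa>) = \<nu> + 2 + real k * \<kappa>" by simp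
      ultimately show ?thesis
        unfolding r'_def by (simp only: power_mult_distrib mult_ac)
    qed
    ultimately show ?thesis by simp
  qed
  have s3: "summable (\<lambda>k. X ^ k * (case k of 0 \<Rightarrow> 0 | Suc k' \<Rightarrow> r' k'))"
  proof (subst summable_Suc_iff [symmetric])
    show "summable (\<lambda>k. X ^ Suc k * (case Suc k of 0 \<Rightarrow> 0 | Suc k' \<Rightarrow> r' k'))"
      using summable_mult [OF s2, of X] by (simp add: mult_ac)
  qed
  have "summable (\<lambda>k. X ^ k * b k)"
    using summable_mult [OF summable_add [OF s1 s3], of C] by (simp add: b_def algebra_simps)
  moreover have "b k \<ge> 0" for k
    unfolding b_def using C r0 by (intro mult_nonneg_nonneg add_nonneg_nonneg) (auto split: nat.split)
  ultimately show thesis using P Q that by blast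
qed

text \<open>
  With \<open>U\<^sub>k = C\<^sub>k\<^sup>\<lambda>\<^sup>+\<^sup>1\<close>, the kernels \<open>U\<^sub>k + \<eta> \<omega> U\<^bsub>k-1\<^esub>\<close> and \<open>- \<eta> \<omega> U\<^bsub>k-1\<^esub> - U\<^bsub>k-2\<^esub>\<close> reproduce the
  monogenics of degree \<open>k\<close> and their products \<open>\<omega> M\<close> with \<open>M\<close> of degree \<open>k - 1\<close>, respectively.
\<close>

definition zonal_plus :: "nat \<Rightarrow> real ^ 'n::{finite,linorder} \<Rightarrow> real ^ 'n::{finite,linorder} \<Rightarrow> 'n cl \<Rightarrow> 'n cl" where
  "zonal_plus k \<eta> \<omega> v = gegenbauer k (real CARD('n) / 2) (\<omega> \<bullet> \<eta>) *\<^sub>R v +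
     gegenbauer_pred k (real CARD('n) / 2) (\<omega> \<bullet> \<eta>) *\<^sub>R (cl_vec \<eta> \<odot> (cl_vec \<omega> \<odot> v))"

definition zonal_minus :: "nat \<Rightarrow> real ^ 'n::{finite,linorder} \<Rightarrow> real ^ 'n::{finite,linorder} \<Rightarrow> 'n cl \<Rightarrow> 'n cl" where
  "zonal_minus k \<eta> \<omega> v = - (gegenbauer_pred k (real CARD('n) / 2) (\<omega> \<bullet> \<eta>) *\<^sub>R (cl_vec \<eta> \<odot> (cl_vec \<omega> \<odot> v))) -
     gegenbauer_pred (k - 1) (real CARD('n) / 2) (\<omega> \<bullet> \<eta>) *\<^sub>R v"

section \<open>Norm estimates for the zonal functions and the terms of the kernel\<close>

lemma cl_vec_scaleR: "cl_vec (a *\<^sub>R x) = a *\<^sub>R cl_vec x"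
  by (simp add: cl_vec_def scaleR_sum_right)

lemma cl_vec_squared_mult: "norm \<eta> = 1 \<Longrightarrow> cl_vec \<eta> \<odot> (cl_vec \<eta> \<odot> v) = - v"
  by (simp add: cl_mult_assoc [symmetric] cl_vec_square dot_square_norm cl.minus_left cl_mult_one_left)

lemma norm_scale_cl: "norm (a *s (v :: complex ^ 'k::finite)) = norm a * norm v"
  by (simp add: norm_vec_def L2_set_def norm_mult power_mult_distrib real_sqrt_mult flip: sum_distrib_left)

text \<open>The constant comes from the boundedness of the bilinear product and the compactness of
  the unit sphere, so it is uniform in the direction.\<close>

lemma cl_vec_mult_bound:
  obtains C where "C \<ge> 0" "\<And>\<omega> v :: 'n::{finite,linorder} cl. norm \<omega> = 1 \<Longrightarrow> norm (cl_vec \<omega> \<odot> v) \<le> C * norm v"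
proof -
  obtain K where K: "\<And>a b :: 'n cl. norm (a \<odot> b) \<le> norm a * norm b * K" "K \<ge> 0"
    using cl.nonneg_bounded by blast
  have "compact (cl_vec ` sphere (0 :: (real, 'n) vec) 1)"
    unfolding cl_vec_def by (intro compact_continuous_image continuous_intros compact_sphere)
  then obtain L where L: "\<forall>y\<in>cl_vec ` sphere (0 :: (real, 'n) vec) 1. norm y \<le> L"
    using compact_imp_bounded bounded_iff by metis
  have "norm (cl_vec \<omega> \<odot> v) \<le> (max 0 L * K) * norm v" if "norm \<omega> = 1" for \<omega> and v :: "'n cl"
  proof -
    have "\<omega> \<in> sphere 0 1" using that by simp
    then have "norm (cl_vec \<omega>) \<le> L" using L by blast
    then have "norm (cl_vec \<omega>) \<le> max 0 L" by simp
    then have "norm (cl_vec \<omega>) * norm v * K \<le> max 0 L * norm v * K"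
      using K(2) by (intro mult_right_mono) auto
    with K(1) [of "cl_vec \<omega>" v] show ?thesis by (simp add: mult_ac)
  qed
  moreover have "max 0 L * K \<ge> 0" using K(2) by simp
  ultimately show thesis using that by blast
qed

lemma norm_zonal_le:
  obtains C where "C \<ge> 0"
    "\<And>k \<eta> \<omega> v :: 'n::{finite,linorder} cl. norm \<eta> = 1 \<Longrightarrow> norm \<omega> = 1 \<Longrightarrow>
      norm (zonal_plus k \<eta> \<omega> v) \<le> (8 * (1 + real CARD('n))) ^ k * (C * norm v)"
    "\<And>k \<eta> \<omega> v :: 'n::{finite,linorder} cl. norm \<eta> = 1 \<Longrightarrow> norm \<omega> = 1 \<Longrightarrow>
      norm (zonal_minus k \<eta> \<omega> v) \<le> (8 * (1 + real CARD('n))) ^ k * (C * norm v)"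
proof -
  let ?B = "8 * (1 + real CARD('n))"
  let ?\<mu> = "real CARD('n) / 2"
  obtain C where C: "C \<ge> 0" "\<And>\<omega> v :: 'n cl. norm \<omega> = 1 \<Longrightarrow> norm (cl_vec \<omega> \<odot> v) \<le> C * norm v"
    using cl_vec_mult_bound by blast
  have C2: "norm (cl_vec \<eta> \<odot> (cl_vec \<omega> \<odot> v)) \<le> C * C * norm v" if "norm \<eta> = 1" "norm \<omega> = 1" for \<eta> \<omega> and v :: "'n cl"
    using order_trans [OF C(2) [OF that(1)] mult_left_mono [OF C(2) [OF that(2)] C(1)]] by (simp add: mult_ac)
  have w: "\<bar>\<omega> \<bullet> \<eta>\<bar> \<le> 1" if "norm \<eta> = 1" "norm \<omega> = 1" for \<eta> \<omega> :: "(real, 'n) vec"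
    using Cauchy_Schwarz_ineq2 [of \<omega> \<eta>] that by simp
  have g: "\<bar>gegenbauer k ?\<mu> (\<omega> \<bullet> \<eta>)\<bar> \<le> ?B ^ k" "\<bar>gegenbauer_pred k ?\<mu> (\<omega> \<bullet> \<eta>)\<bar> \<le> ?B ^ k"
    "\<bar>gegenbauer_pred (k - 1) ?\<mu> (\<omega> \<bullet> \<eta>)\<bar> \<le> ?B ^ k"
    if "norm \<eta> = 1" "norm \<omega> = 1" for k and \<eta> \<omega> :: "(real, 'n) vec"
    by (intro abs_gegenbauer_le abs_gegenbauer_pred_le w that; simp)+
  have "norm (zonal_plus k \<eta> \<omega> v) \<le> ?B ^ k * ((1 + C * C) * norm v)"
    if "norm \<eta> = 1" "norm \<omega> = 1" for k \<eta> \<omega> and v :: "'n cl"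
  proof -
    have "norm (zonal_plus k \<eta> \<omega> v) \<le> \<bar>gegenbauer k ?\<mu> (\<omega> \<bullet> \<eta>)\<bar> * norm v +
        \<bar>gegenbauer_pred k ?\<mu> (\<omega> \<bullet> \<eta>)\<bar> * norm (cl_vec \<eta> \<odot> (cl_vec \<omega> \<odot> v))"
      unfolding zonal_plus_def by (rule order_trans [OF norm_triangle_ineq]) simp
    also have "\<dots> \<le> ?B ^ k * norm v + ?B ^ k * (C * C * norm v)"
      by (intro add_mono mult_mono g C2 that) auto
    finally show ?thesis by (simp add: algebra_simps)
  qed
  moreover have "norm (zonal_minus k \<eta> \<omega> v) \<le> ?B ^ k * ((1 + C * C) * norm v)"
    if "norm \<eta> = 1" "norm \<omega> = 1" for k \<eta> \<omega> and v :: "'n cl"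
  proof -
    have "norm (zonal_minus k \<eta> \<omega> v) \<le>
        \<bar>gegenbauer_pred k ?\<mu> (\<omega> \<bullet> \<eta>)\<bar> * norm (cl_vec \<eta> \<odot> (cl_vec \<omega> \<odot> v)) +
        \<bar>gegenbauer_pred (k - 1) ?\<mu> (\<omega> \<bullet> \<eta>)\<bar> * norm v"
      unfolding zonal_minus_def by (rule order_trans [OF norm_triangle_ineq4]) simp
    also have "\<dots> \<le> ?B ^ k * (C * C * norm v) + ?B ^ k * norm v"
      by (intro add_mono mult_mono g C2 that) auto
    finally show ?thesis by (simp add: algebra_simps)
  qed
  moreover have "1 + C * C \<ge> 0" using C(1) by simp
  ultimately show thesis using that by blast
qed

definition kernel_term :: "real \<Rightarrow> real \<Rightarrow> nat \<Rightarrow> real ^ 'n::{finite,linorder} \<Rightarrow> real ^ 'n::{finite,linorder} \<Rightarrow> 'n cl \<Rightarrow> 'n cl" where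
  "kernel_term c z k \<eta> \<omega> v =
     bessel_P CARD('n) c k z *s zonal_plus k \<eta> \<omega> v + bessel_Q CARD('n) c k z *s zonal_minus k \<eta> \<omega> v"

lemma kernel_term_bound:
  assumes c: "c > -1" and m: "CARD('n::{finite,linorder}) \<ge> 2"
  obtains b where "summable b" "\<And>k. b k \<ge> 0"
    "\<And>k z \<eta> \<omega> v :: 'n cl. 0 < z \<Longrightarrow> z \<le> Z \<Longrightarrow> norm \<eta> = 1 \<Longrightarrow> norm \<omega> = 1 \<Longrightarrow>
      norm (kernel_term c z k \<eta> \<omega> v) \<le> b k * norm v"
proof -
  let ?B = "8 * (1 + real CARD('n))"
  obtain C where C: "C \<ge> 0" "\<And>k \<eta> \<omega> v :: 'n cl. norm \<eta> = 1 \<Longrightarrow> norm \<omega> = 1 \<Longrightarrow>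
      norm (zonal_plus k \<eta> \<omega> v) \<le> ?B ^ k * (C * norm v)"
    "\<And>k \<eta> \<omega> v :: 'n cl. norm \<eta> = 1 \<Longrightarrow> norm \<omega> = 1 \<Longrightarrow>
      norm (zonal_minus k \<eta> \<omega> v) \<le> ?B ^ k * (C * norm v)"
    using norm_zonal_le by blast
  have B: "?B > 0" by simp
  obtain b where b: "summable (\<lambda>k. ?B ^ k * b k)" "\<And>k. b k \<ge> 0"
    "\<And>k z. 0 < z \<Longrightarrow> z \<le> Z \<Longrightarrow> norm (bessel_P CARD('n) c k z) \<le> b k"
    "\<And>k z. 0 < z \<Longrightarrow> z \<le> Z \<Longrightarrow> norm (bessel_Q CARD('n) c k z) \<le> b k"
    using bessel_PQ_bound [OF c m B, of Z] by blast
  show thesis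
  proof
    show "summable (\<lambda>k. 2 * C * (?B ^ k * b k))"
      by (intro summable_mult b)
    show "0 \<le> 2 * C * (?B ^ k * b k)" for k
      using C(1) b(2) by simp
    fix k z and \<eta> \<omega> :: "(real, 'n) vec" and v :: "'n cl"
    assume z: "0 < z" "z \<le> Z" and n: "norm \<eta> = 1" "norm \<omega> = 1"
    have "norm (kernel_term c z k \<eta> \<omega> v) \<le> norm (bessel_P CARD('n) c k z) * norm (zonal_plus k \<eta> \<omega> v) +
        norm (bessel_Q CARD('n) c k z) * norm (zonal_minus k \<eta> \<omega> v)"
      unfolding kernel_term_def by (rule order_trans [OF norm_triangle_ineq]) (simp add: norm_scale_cl)
    also have "\<dots> \<le> b k * (?B ^ k * (C * norm v)) + b k * (?B ^ k * (C * norm v))"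
      by (intro add_mono mult_mono b C z n) auto
    finally show "norm (kernel_term c z k \<eta> \<omega> v) \<le> 2 * C * (?B ^ k * b k) * norm v"
      by (simp add: algebra_simps)
  qed
qed

lemma sums_scale_cl: "f sums a \<Longrightarrow> (\<lambda>k. f k *s (v :: complex ^ 'k::finite)) sums (a *s v)"
proof -
  have "bounded_linear (\<lambda>a. a *s v)"
    by (rule bounded_linear_intro [where K = "norm v"])
      (simp_all add: norm_scale_cl scaleR_eq_scale vec_eq_iff distrib_right scaleR_conv_of_real)
  then show "f sums a \<Longrightarrow> (\<lambda>k. f k *s v) sums (a *s v)"
    by (rule bounded_linear.sums)
qed

text \<open>The series for A and for z B are regrouped by the index k. Since the wedge product is z
  (- \<eta> \<omega> - w) with w = <\<omega>, \<eta>>, the scalar part -w in the second series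
  cancels the terms with explicit w in the first, and what is left are the two zonal
  functions.\<close>

lemma kernel_expansion:
  fixes x y :: "real ^ 'n::{finite,linorder}"
  assumes c: "c > -1" and m: "CARD('n) \<ge> 2" and x: "x \<noteq> 0" and y: "y \<noteq> 0"
  shows "(\<lambda>k. kernel_term c (norm x * norm y) k (sgn y) (sgn x) v) sums (kernel_K c x y \<odot> v)"
proof -
  let ?m = "CARD('n)" and ?\<mu> = "real CARD('n) / 2"
  define z where "z = norm x * norm y"
  define \<omega> where "\<omega> = sgn x"
  define \<eta> where "\<eta> = sgn y"
  define w where "w = \<omega> \<bullet> \<eta>"
  define P where "P k = bessel_P ?m c k z" for k
  define Q where "Q k = bessel_Q ?m c k z" for k
  define U where "U k = gegenbauer k ?\<mu> w" for k
  define V where "V k = gegenbauer_pred k ?\<mu> w" for k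
  have z: "z > 0" using x y by (simp add: z_def)
  have n: "norm \<omega> = 1" "norm \<eta> = 1" using x y by (simp_all add: \<omega>_def \<eta>_def norm_sgn)
  have xy: "x = norm x *\<^sub>R \<omega>" "y = norm y *\<^sub>R \<eta>" using x y by (simp_all add: \<omega>_def \<eta>_def sgn_div_norm)
  have w': "(x \<bullet> y) / z = w"
    using x y by (simp add: w_def \<omega>_def \<eta>_def z_def sgn_div_norm field_simps)
  have w1: "\<bar>w\<bar> \<le> 1"
    unfolding w_def using Cauchy_Schwarz_ineq2 [of \<omega> \<eta>] n by simp
  let ?B = "8 * (1 + real ?m)"
  have B: "?B > 0" by simp
  obtain b where b: "summable (\<lambda>k. ?B ^ k * b k)" "\<And>k. b k \<ge> 0"
    "\<And>k t. 0 < t \<Longrightarrow> t \<le> z \<Longrightarrow> norm (bessel_P ?m c k t) \<le> b k"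
    "\<And>k t. 0 < t \<Longrightarrow> t \<le> z \<Longrightarrow> norm (bessel_Q ?m c k t) \<le> b k"
    using bessel_PQ_bound [OF c m B, of z] by blast
  have PQ: "norm (P k) \<le> b k" "norm (Q k) \<le> b k" for k
    using b(3,4) z by (auto simp: P_def Q_def)
  have UV: "\<bar>U k\<bar> \<le> ?B ^ k" "\<bar>V k\<bar> \<le> ?B ^ k" "\<bar>V (k - 1)\<bar> \<le> ?B ^ k" for k
    unfolding U_def V_def by (intro abs_gegenbauer_le abs_gegenbauer_pred_le w1; simp)+
  have summ: "summable (\<lambda>k. F k * of_real (g k))"
    if "\<And>k. norm (F k) \<le> b k" "\<And>k. \<bar>g k\<bar> \<le> ?B ^ k" for F :: "nat \<Rightarrow> complex" and g
  proof (rule summable_comparison_test' [OF b(1)])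
    fix k
    have "norm (F k * of_real (g k)) = norm (F k) * \<bar>g k\<bar>" by (simp add: norm_mult)
    also have "\<dots> \<le> b k * ?B ^ k" by (intro mult_mono that b(2)) auto
    finally show "norm (F k * of_real (g k)) \<le> ?B ^ k * b k" by (simp add: mult.commute)
  qed
  \<comment> \<open>Each of the four products is summable separately, so the series may be
    recombined termwise.\<close>
  note S = summ [OF PQ(1) UV(1)] summ [OF PQ(1) UV(2)] summ [OF PQ(2) UV(2)] summ [OF PQ(2) UV(3)]
  have \<lambda>: "def_lambda ?m + 1 = ?\<mu>" by (simp add: def_lambda_def field_simps)
  define a where "a k = P k * of_real (U k - w * V k) + Q k * of_real (w * V k - V (k - 1))" for k
  define d where "d k = (Q k - P k) * of_real (V k)" for k
  have Asum: "summable a"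
  proof -
    have "a = (\<lambda>k. P k * of_real (U k) - of_real w * (P k * of_real (V k)) +
        (of_real w * (Q k * of_real (V k)) - Q k * of_real (V (k - 1))))"
      by (rule ext) (simp add: a_def algebra_simps)
    then show ?thesis
      by (simp only:) (intro summable_add summable_diff summable_mult S)
  qed
  have dsum: "summable d"
  proof -
    have "d = (\<lambda>k. Q k * of_real (V k) - P k * of_real (V k))"
      by (rule ext) (simp add: d_def algebra_simps)
    then show ?thesis
      by (simp only:) (intro summable_diff S)
  qed
  have A: "a sums kernel_A ?m c z w"
  proof -
    have "kernel_A ?m c z w = suminf a"
      unfolding kernel_A_def a_def P_def Q_def U_def V_def bessel_P_def bessel_Q_def gegenbauer_plus_eq
        gegenbauer_minus_eq \<lambda>
      by (rule arg_cong [where f = suminf], rule ext) (simp add: algebra_simps)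
    with Asum show ?thesis by (simp add: summable_sums)
  qed
  have B: "d sums (of_real z * kernel_B ?m c z w)"
  proof -
    \<comment> \<open>The factor z coming from the wedge product raises the exponent of the
      prefactor from -\<delta>/2 to -(\<delta> - 2)/2.\<close>
    have zp: "z powr (- def_delta ?m c / 2) * z = z powr (- (def_delta ?m c - 2) / 2)"
    proof -
      have "z powr (- def_delta ?m c / 2) * z = z powr (- def_delta ?m c / 2) * z powr 1" using z by simp
      also have "\<dots> = z powr (- def_delta ?m c / 2 + 1)" by (rule powr_add [symmetric])
      also have "- def_delta ?m c / 2 + 1 = - (def_delta ?m c - 2) / 2" by (simp add: field_simps)
      finally show ?thesis .
    qed
    let ?e = "\<lambda>k. of_real (z powr (- def_delta ?m c / 2)) *
        (- def_alpha c (int k + 1) * of_real (bessel_J (def_gamma ?m c (int k + 1) / 2 - 1) z)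
         - \<i> * def_alpha c (int k) * of_real (bessel_J (def_gamma ?m c (int k) / 2) z)) *
        of_real (gegenbauer k (def_lambda ?m + 1) w)"
    have e: "of_real z * ?e k = d (Suc k)" for k
      unfolding d_def P_def Q_def V_def bessel_P_def bessel_Q_def zp [symmetric] \<lambda>
      by (simp add: gegenbauer_pred_def algebra_simps)
    have ds: "summable (\<lambda>k. d (Suc k))" using dsum by (simp add: summable_Suc_iff)
    have e': "?e = (\<lambda>k. inverse (of_real z) * d (Suc k))"
      unfolding e [symmetric] using z by (intro ext) simp
    have "kernel_B ?m c z w = inverse (of_real z) * (\<Sum>k. d (Suc k))"
      unfolding kernel_B_def e' by (rule suminf_mult [OF ds])
    then have "of_real z * kernel_B ?m c z w = (\<Sum>k. d (Suc k))" using z by simp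
    \<comment> \<open>The series for B begins at k = 1; as the Gegenbauer polynomial of index -1 is
      zero, it may begin at k = 0 as well.\<close>
    moreover have "d 0 = 0" by (simp add: d_def V_def gegenbauer_pred_def)
    ultimately show ?thesis
      using summable_sums [OF ds] sums_Suc_iff [of d] by simp
  qed
  define u where "u = cl_vec \<eta> \<odot> (cl_vec \<omega> \<odot> v)"
  have wedge: "cl_wedge x y \<odot> v = of_real z *s (- u - of_real w *s v)"
  proof -
    have "cl_wedge x y = - (cl_vec y \<odot> cl_vec x) - (x \<bullet> y) *\<^sub>R cl_one"
      using cl_vec_mult_cl_vec [of y x] by simp
    also have "cl_vec y \<odot> cl_vec x = z *\<^sub>R (cl_vec \<eta> \<odot> cl_vec \<omega>)"
      by (subst xy(1), subst xy(2)) (simp add: cl_vec_scaleR cl.scaleR_left cl.scaleR_right z_def)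
    also have "x \<bullet> y = z * w" using w' z by (simp add: field_simps)
    finally have "cl_wedge x y \<odot> v = - (z *\<^sub>R u) - (z * w) *\<^sub>R v"
      by (simp add: cl.diff_left cl.minus_left cl.scaleR_left u_def cl_mult_assoc cl_mult_one_left)
    then show ?thesis
      by (simp add: scaleR_eq_scale vec_eq_iff algebra_simps)
  qed
  have K: "kernel_K c x y \<odot> v = kernel_A ?m c z w *s v + (of_real z * kernel_B ?m c z w) *s (- u - of_real w *s v)"
    unfolding kernel_K_def Let_def z_def [symmetric] w'
    by (simp add: cl_mult_add_left cl_mult_scale_left cl_mult_one_left wedge vector_smult_assoc mult.commute)
  have "(\<lambda>k. a k *s v + d k *s (- u - of_real w *s v)) sums (kernel_K c x y \<odot> v)"
    unfolding K by (intro sums_add sums_scale_cl A B)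
  moreover have "kernel_term c z k \<eta> \<omega> v = a k *s v + d k *s (- u - of_real w *s v)" for k
    unfolding kernel_term_def zonal_plus_def zonal_minus_def w_def [symmetric] u_def [symmetric]
      U_def [symmetric] V_def [symmetric] P_def [symmetric] Q_def [symmetric] a_def d_def scaleR_eq_scale
    by (simp add: vec_eq_iff algebra_simps)
  ultimately show ?thesis
    unfolding z_def [symmetric] \<omega>_def [symmetric] \<eta>_def [symmetric] by (simp only:)
qed


section \<open>Averages of the zonal functions against monogenics\<close>

lemma parity_shift:
  fixes k l :: nat
  shows "l \<le> k \<and> even (k - l) \<longleftrightarrow> k = l \<or> (Suc l < k \<and> odd (k - Suc l))"
    and "l < k - 1 \<and> odd (k - 1 - l) \<longleftrightarrow> Suc l < k \<and> odd (k - Suc l)"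
    and "Suc l \<le> k \<and> even (k - Suc l) \<longleftrightarrow> l < k \<and> odd (k - l)"
    and "l < k \<and> odd (k - l) \<longleftrightarrow> k = Suc l \<or> (Suc l < k - 1 \<and> odd (k - 1 - Suc l))"
proof -
  \<comment> \<open>Only k = l and k = l + 1 are exceptional: for smaller k all conditions fail, and
    for k \<ge> l + 2 each reduces to the parity of k - l.\<close>
  consider "k < l" | "k = l" | "k = Suc l" | j where "k = Suc (Suc (l + j))"
  proof -
    have "k < l \<or> k = l \<or> k = Suc l \<or> Suc (Suc l) \<le> k" by linarith
    then show thesis using that le_Suc_ex by (metis add_Suc)
  qed
  then show "l \<le> k \<and> even (k - l) \<longleftrightarrow> k = l \<or> (Suc l < k \<and> odd (k - Suc l))"
    and "l < k - 1 \<and> odd (k - 1 - l) \<longleftrightarrow> Suc l < k \<and> odd (k - Suc l)"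
    and "Suc l \<le> k \<and> even (k - Suc l) \<longleftrightarrow> l < k \<and> odd (k - l)"
    and "l < k \<and> odd (k - l) \<longleftrightarrow> k = Suc l \<or> (Suc l < k - 1 \<and> odd (k - 1 - Suc l))"
    by (cases; auto simp: Suc_diff_le odd_pos)+
qed

lemma continuous_on_gegenbauer: "continuous_on A f \<Longrightarrow> continuous_on A (\<lambda>x. gegenbauer k \<mu> (f x))"
  unfolding gegenbauer_def by (intro continuous_intros) auto

lemma continuous_on_gegenbauer_pred: "continuous_on A f \<Longrightarrow> continuous_on A (\<lambda>x. gegenbauer_pred k \<mu> (f x))"
  unfolding gegenbauer_pred_def by (cases k) (auto intro: continuous_on_gegenbauer)

lemma continuous_on_cl_mult: "continuous_on A f \<Longrightarrow> continuous_on A g \<Longrightarrow> continuous_on A (\<lambda>x. f x \<odot> g x)"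
  by (rule cl.continuous_on)

lemma continuous_on_cl_vec: "continuous_on A f \<Longrightarrow> continuous_on A (\<lambda>x. cl_vec (f x))"
  unfolding cl_vec_def by (intro continuous_intros)

lemma integral_sphere_gegenbauer_pred_harmonic:
  fixes H :: "real ^ 'n::finite \<Rightarrow> 'b::euclidean_space"
  assumes m: "CARD('n) \<ge> 2" and H: "hpoly l H" "\<And>x. lap H x = 0" and \<eta>: "norm \<eta> = 1"
  shows "(\<integral>\<omega>. gegenbauer_pred k (real CARD('n) / 2) (\<omega> \<bullet> \<eta>) *\<^sub>R H \<omega> \<partial>sphere_measure) =
    (if l < k \<and> odd (k - l) then H \<eta> else 0)"
proof (cases k)
  case (Suc k')
  have "l \<le> k' \<and> even (k' - l) \<longleftrightarrow> l < k \<and> odd (k - l)"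
    by (auto simp: Suc Suc_diff_le)
  then show ?thesis
    using integral_sphere_gegenbauer_harmonic [OF m H \<eta>, of k'] by (simp add: Suc gegenbauer_pred_def)
qed (simp add: gegenbauer_pred_def)

context
  fixes M :: "real ^ 'n::{finite,linorder} \<Rightarrow> 'n cl" and l :: nat and \<eta> :: "real ^ 'n::{finite,linorder}"
  assumes m: "CARD('n) \<ge> 2" and M: "M \<in> spherical_monogenics l" and \<eta>: "norm \<eta> = 1"
begin

lemma hpolys: "hpoly l M" "hpoly (Suc l) (\<lambda>\<omega>. cl_vec \<omega> \<odot> M \<omega>)"
  using spherical_monogenics_hpoly [OF M] hpoly_cl_vec_mult by auto

lemma integrable_zonal_parts:
  assumes "continuous_on UNIV F"
  shows "integrable sphere_measure (\<lambda>\<omega>. gegenbauer k (real CARD('n) / 2) (\<omega> \<bullet> \<eta>) *\<^sub>R (F \<omega> :: 'n cl))"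
    "integrable sphere_measure (\<lambda>\<omega>. gegenbauer_pred k (real CARD('n) / 2) (\<omega> \<bullet> \<eta>) *\<^sub>R F \<omega>)"
  by (intro integrable_sphere_measure_continuous continuous_intros continuous_on_gegenbauer
      continuous_on_gegenbauer_pred assms)+

text \<open>G represents \<omega> F on the sphere alone. For F = \<omega> M this allows G = - M, a
  polynomial whose averages are known, although the square of \<omega> is -1 only on the
  sphere.\<close>

lemma integral_zonal:
  assumes F: "continuous_on UNIV F" and G: "continuous_on UNIV G"
    and eq: "\<And>\<omega>. norm \<omega> = 1 \<Longrightarrow> cl_vec \<omega> \<odot> F \<omega> = G \<omega>"
  shows "(\<integral>\<omega>. zonal_plus k \<eta> \<omega> (F \<omega>) \<partial>sphere_measure) =
      (\<integral>\<omega>. gegenbauer k (real CARD('n) / 2) (\<omega> \<bullet> \<eta>) *\<^sub>R F \<omega> \<partial>sphere_measure) +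
      cl_vec \<eta> \<odot> (\<integral>\<omega>. gegenbauer_pred k (real CARD('n) / 2) (\<omega> \<bullet> \<eta>) *\<^sub>R G \<omega> \<partial>sphere_measure)"
    and "(\<integral>\<omega>. zonal_minus k \<eta> \<omega> (F \<omega>) \<partial>sphere_measure) =
      - (cl_vec \<eta> \<odot> (\<integral>\<omega>. gegenbauer_pred k (real CARD('n) / 2) (\<omega> \<bullet> \<eta>) *\<^sub>R G \<omega> \<partial>sphere_measure)) -
      (\<integral>\<omega>. gegenbauer_pred (k - 1) (real CARD('n) / 2) (\<omega> \<bullet> \<eta>) *\<^sub>R F \<omega> \<partial>sphere_measure)"
    and "integrable sphere_measure (\<lambda>\<omega>. zonal_plus k \<eta> \<omega> (F \<omega>))"
    and "integrable sphere_measure (\<lambda>\<omega>. zonal_minus k \<eta> \<omega> (F \<omega>))"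
proof -
  note bl = cl.bounded_linear_right [of "cl_vec \<eta>"]
  have i: "integrable sphere_measure (\<lambda>\<omega>. cl_vec \<eta> \<odot> (gegenbauer_pred k (real CARD('n) / 2) (\<omega> \<bullet> \<eta>) *\<^sub>R G \<omega>))"
    by (rule integrable_bounded_linear [OF bl integrable_zonal_parts(2) [OF G]])
  have I: "(\<integral>\<omega>. cl_vec \<eta> \<odot> (gegenbauer_pred k (real CARD('n) / 2) (\<omega> \<bullet> \<eta>) *\<^sub>R G \<omega>) \<partial>sphere_measure) =
      cl_vec \<eta> \<odot> (\<integral>\<omega>. gegenbauer_pred k (real CARD('n) / 2) (\<omega> \<bullet> \<eta>) *\<^sub>R G \<omega> \<partial>sphere_measure)"
    by (rule integral_bounded_linear [OF bl integrable_zonal_parts(2) [OF G]])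
  have c: "continuous_on UNIV (\<lambda>\<omega>. zonal_plus k \<eta> \<omega> (F \<omega>))" "continuous_on UNIV (\<lambda>\<omega>. zonal_minus k \<eta> \<omega> (F \<omega>))"
    unfolding zonal_plus_def zonal_minus_def
    by (intro continuous_intros continuous_on_gegenbauer continuous_on_gegenbauer_pred
        continuous_on_cl_mult continuous_on_cl_vec F)+
  show "integrable sphere_measure (\<lambda>\<omega>. zonal_plus k \<eta> \<omega> (F \<omega>))"
    "integrable sphere_measure (\<lambda>\<omega>. zonal_minus k \<eta> \<omega> (F \<omega>))"
    by (rule integrable_sphere_measure_continuous [OF c(1)] integrable_sphere_measure_continuous [OF c(2)])+
  have "(\<integral>\<omega>. zonal_plus k \<eta> \<omega> (F \<omega>) \<partial>sphere_measure) =
      (\<integral>\<omega>. gegenbauer k (real CARD('n) / 2) (\<omega> \<bullet> \<eta>) *\<^sub>R F \<omega> + cl_vec \<eta> \<odot> (gegenbauer_pred k (real CARD('n) / 2) (\<omega> \<bullet> \<eta>) *\<^sub>R G \<omega>) \<partial>sphere_measure)"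
  proof (rule integral_cong_AE)
    show "AE \<omega> in sphere_measure. zonal_plus k \<eta> \<omega> (F \<omega>) =
        gegenbauer k (real CARD('n) / 2) (\<omega> \<bullet> \<eta>) *\<^sub>R F \<omega> + cl_vec \<eta> \<odot> (gegenbauer_pred k (real CARD('n) / 2) (\<omega> \<bullet> \<eta>) *\<^sub>R G \<omega>)"
      using AE_sphere_measure by eventually_elim (simp add: zonal_plus_def eq cl.scaleR_right)
    show "(\<lambda>\<omega>. zonal_plus k \<eta> \<omega> (F \<omega>)) \<in> borel_measurable sphere_measure"
      using borel_measurable_continuous_onI [OF c(1)] by simp
    show "(\<lambda>\<omega>. gegenbauer k (real CARD('n) / 2) (\<omega> \<bullet> \<eta>) *\<^sub>R F \<omega> + cl_vec \<eta> \<odot> (gegenbauer_pred k (real CARD('n) / 2) (\<omega> \<bullet> \<eta>) *\<^sub>R G \<omega>)) \<in> borel_measurable sphere_measure"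
      by (rule borel_measurable_integrable, rule Bochner_Integration.integrable_add [OF integrable_zonal_parts(1) [OF F] i])
  qed
  then show "(\<integral>\<omega>. zonal_plus k \<eta> \<omega> (F \<omega>) \<partial>sphere_measure) =
      (\<integral>\<omega>. gegenbauer k (real CARD('n) / 2) (\<omega> \<bullet> \<eta>) *\<^sub>R F \<omega> \<partial>sphere_measure) +
      cl_vec \<eta> \<odot> (\<integral>\<omega>. gegenbauer_pred k (real CARD('n) / 2) (\<omega> \<bullet> \<eta>) *\<^sub>R G \<omega> \<partial>sphere_measure)"
    by (simp only: Bochner_Integration.integral_add [OF integrable_zonal_parts(1) [OF F] i] I)
  have i': "integrable sphere_measure (\<lambda>\<omega>. - (cl_vec \<eta> \<odot> (gegenbauer_pred k (real CARD('n) / 2) (\<omega> \<bullet> \<eta>) *\<^sub>R G \<omega>)))"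
    using i by simp
  have "(\<integral>\<omega>. zonal_minus k \<eta> \<omega> (F \<omega>) \<partial>sphere_measure) =
      (\<integral>\<omega>. - (cl_vec \<eta> \<odot> (gegenbauer_pred k (real CARD('n) / 2) (\<omega> \<bullet> \<eta>) *\<^sub>R G \<omega>)) - gegenbauer_pred (k - 1) (real CARD('n) / 2) (\<omega> \<bullet> \<eta>) *\<^sub>R F \<omega> \<partial>sphere_measure)"
  proof (rule integral_cong_AE)
    show "AE \<omega> in sphere_measure. zonal_minus k \<eta> \<omega> (F \<omega>) =
        - (cl_vec \<eta> \<odot> (gegenbauer_pred k (real CARD('n) / 2) (\<omega> \<bullet> \<eta>) *\<^sub>R G \<omega>)) - gegenbauer_pred (k - 1) (real CARD('n) / 2) (\<omega> \<bullet> \<eta>) *\<^sub>R F \<omega>"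
      using AE_sphere_measure by eventually_elim (simp add: zonal_minus_def eq cl.scaleR_right)
    show "(\<lambda>\<omega>. zonal_minus k \<eta> \<omega> (F \<omega>)) \<in> borel_measurable sphere_measure"
      using borel_measurable_continuous_onI [OF c(2)] by simp
    show "(\<lambda>\<omega>. - (cl_vec \<eta> \<odot> (gegenbauer_pred k (real CARD('n) / 2) (\<omega> \<bullet> \<eta>) *\<^sub>R G \<omega>)) - gegenbauer_pred (k - 1) (real CARD('n) / 2) (\<omega> \<bullet> \<eta>) *\<^sub>R F \<omega>) \<in> borel_measurable sphere_measure"
      by (rule borel_measurable_integrable, rule Bochner_Integration.integrable_diff [OF i' integrable_zonal_parts(2) [OF F]])
  qed
  then show "(\<integral>\<omega>. zonal_minus k \<eta> \<omega> (F \<omega>) \<partial>sphere_measure) =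
      - (cl_vec \<eta> \<odot> (\<integral>\<omega>. gegenbauer_pred k (real CARD('n) / 2) (\<omega> \<bullet> \<eta>) *\<^sub>R G \<omega> \<partial>sphere_measure)) -
      (\<integral>\<omega>. gegenbauer_pred (k - 1) (real CARD('n) / 2) (\<omega> \<bullet> \<eta>) *\<^sub>R F \<omega> \<partial>sphere_measure)"
    by (simp only: Bochner_Integration.integral_diff [OF i' integrable_zonal_parts(2) [OF F]]
        Bochner_Integration.integral_minus I)
qed

lemma monogenic_parts:
  "(\<integral>\<omega>. gegenbauer k (real CARD('n) / 2) (\<omega> \<bullet> \<eta>) *\<^sub>R M \<omega> \<partial>sphere_measure) = (if l \<le> k \<and> even (k - l) then M \<eta> else 0)"
  "(\<integral>\<omega>. gegenbauer_pred k (real CARD('n) / 2) (\<omega> \<bullet> \<eta>) *\<^sub>R M \<omega> \<partial>sphere_measure) = (if l < k \<and> odd (k - l) then M \<eta> else 0)"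
  "(\<integral>\<omega>. gegenbauer k (real CARD('n) / 2) (\<omega> \<bullet> \<eta>) *\<^sub>R (cl_vec \<omega> \<odot> M \<omega>) \<partial>sphere_measure) =
    (if Suc l \<le> k \<and> even (k - Suc l) then cl_vec \<eta> \<odot> M \<eta> else 0)"
  "(\<integral>\<omega>. gegenbauer_pred k (real CARD('n) / 2) (\<omega> \<bullet> \<eta>) *\<^sub>R (cl_vec \<omega> \<odot> M \<omega>) \<partial>sphere_measure) =
    (if Suc l < k \<and> odd (k - Suc l) then cl_vec \<eta> \<odot> M \<eta> else 0)"
  by (rule integral_sphere_gegenbauer_harmonic integral_sphere_gegenbauer_pred_harmonic,
      rule m, rule hpolys, rule lap_monogenic [OF M] lap_cl_vec_mult_monogenic [OF M], rule \<eta>)+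

text \<open>M and \<omega> M are harmonic of degrees l and l + 1, so each part of a zonal function
  averages to a value at \<eta> under a condition of range and parity, and the squares of \<omega>
  and \<eta> being -1 gives the two parts opposite signs. They cancel except where one range starts
  before the other: at k = l in the first case and at k = l + 1 in the last.\<close>

lemma integral_zonal_monogenic:
  "(\<integral>\<omega>. zonal_plus k \<eta> \<omega> (M \<omega>) \<partial>sphere_measure) = (if k = l then M \<eta> else 0)"
  "(\<integral>\<omega>. zonal_minus k \<eta> \<omega> (M \<omega>) \<partial>sphere_measure) = 0"
  "(\<integral>\<omega>. zonal_plus k \<eta> \<omega> (cl_vec \<omega> \<odot> M \<omega>) \<partial>sphere_measure) = 0"
  "(\<integral>\<omega>. zonal_minus k \<eta> \<omega> (cl_vec \<omega> \<odot> M \<omega>) \<partial>sphere_measure) = (if k = Suc l then cl_vec \<eta> \<odot> M \<eta> else 0)"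
proof -
  note cont = hpolys [THEN hpoly_continuous_on, of UNIV]
  have sq: "cl_vec \<omega> \<odot> (cl_vec \<omega> \<odot> M \<omega>) = - M \<omega>" if "norm \<omega> = 1" for \<omega>
    using that by (rule cl_vec_squared_mult)
  have neg: "(\<integral>\<omega>. gegenbauer_pred k (real CARD('n) / 2) (\<omega> \<bullet> \<eta>) *\<^sub>R (- M \<omega>) \<partial>sphere_measure) = - (if l < k \<and> odd (k - l) then M \<eta> else 0)"
    by (simp only: scaleR_minus_right Bochner_Integration.integral_minus monogenic_parts)
  note A = integral_zonal [OF cont(1) cont(2) refl]
  have B: "(\<integral>\<omega>. zonal_plus k \<eta> \<omega> (cl_vec \<omega> \<odot> M \<omega>) \<partial>sphere_measure) =
      (\<integral>\<omega>. gegenbauer k (real CARD('n) / 2) (\<omega> \<bullet> \<eta>) *\<^sub>R (cl_vec \<omega> \<odot> M \<omega>) \<partial>sphere_measure) +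
      cl_vec \<eta> \<odot> (\<integral>\<omega>. gegenbauer_pred k (real CARD('n) / 2) (\<omega> \<bullet> \<eta>) *\<^sub>R (- M \<omega>) \<partial>sphere_measure)"
    "(\<integral>\<omega>. zonal_minus k \<eta> \<omega> (cl_vec \<omega> \<odot> M \<omega>) \<partial>sphere_measure) =
      - (cl_vec \<eta> \<odot> (\<integral>\<omega>. gegenbauer_pred k (real CARD('n) / 2) (\<omega> \<bullet> \<eta>) *\<^sub>R (- M \<omega>) \<partial>sphere_measure)) -
      (\<integral>\<omega>. gegenbauer_pred (k - 1) (real CARD('n) / 2) (\<omega> \<bullet> \<eta>) *\<^sub>R (cl_vec \<omega> \<odot> M \<omega>) \<partial>sphere_measure)"
    by (rule integral_zonal, rule cont, rule continuous_on_minus [OF cont(1)], rule sq, assumption)+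
  show "(\<integral>\<omega>. zonal_plus k \<eta> \<omega> (M \<omega>) \<partial>sphere_measure) = (if k = l then M \<eta> else 0)"
  proof -
    have "l \<le> k \<and> even (k - l) \<longleftrightarrow> k = l \<or> (Suc l < k \<and> odd (k - Suc l))"
      by (rule parity_shift)
    then show ?thesis
      unfolding A(1) monogenic_parts by (auto simp: cl_vec_squared_mult [OF \<eta>] cl.zero_right)
  qed
  show "(\<integral>\<omega>. zonal_minus k \<eta> \<omega> (M \<omega>) \<partial>sphere_measure) = 0"
  proof -
    have "l < k - 1 \<and> odd (k - 1 - l) \<longleftrightarrow> Suc l < k \<and> odd (k - Suc l)" by (rule parity_shift)
    then show ?thesis
      unfolding A(2) monogenic_parts by (auto simp: cl_vec_squared_mult [OF \<eta>] cl.zero_right)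
  qed
  show "(\<integral>\<omega>. zonal_plus k \<eta> \<omega> (cl_vec \<omega> \<odot> M \<omega>) \<partial>sphere_measure) = 0"
  proof -
    have "Suc l \<le> k \<and> even (k - Suc l) \<longleftrightarrow> l < k \<and> odd (k - l)" by (rule parity_shift)
    then show ?thesis
      unfolding B(1) neg monogenic_parts by (auto simp: cl.minus_right cl.zero_right)
  qed
  show "(\<integral>\<omega>. zonal_minus k \<eta> \<omega> (cl_vec \<omega> \<odot> M \<omega>) \<partial>sphere_measure) = (if k = Suc l then cl_vec \<eta> \<odot> M \<eta> else 0)"
  proof -
    have "l < k \<and> odd (k - l) \<longleftrightarrow> k = Suc l \<or> (Suc l < k - 1 \<and> odd (k - 1 - Suc l))"
      by (rule parity_shift)
    then show ?thesis
      unfolding B(2) neg monogenic_parts by (auto simp: cl.minus_right cl.zero_right)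
  qed
qed

lemma integrable_zonal_monogenic:
  "integrable sphere_measure (\<lambda>\<omega>. zonal_plus k \<eta> \<omega> (M \<omega>))"
  "integrable sphere_measure (\<lambda>\<omega>. zonal_minus k \<eta> \<omega> (M \<omega>))"
  "integrable sphere_measure (\<lambda>\<omega>. zonal_plus k \<eta> \<omega> (cl_vec \<omega> \<odot> M \<omega>))"
  "integrable sphere_measure (\<lambda>\<omega>. zonal_minus k \<eta> \<omega> (cl_vec \<omega> \<odot> M \<omega>))"
proof -
  note cont = hpolys [THEN hpoly_continuous_on, of UNIV]
  note A = integral_zonal(3,4) [OF cont(1) cont(2) refl]
  note B = integral_zonal(3,4) [OF cont(2) continuous_on_cl_mult [OF continuous_on_cl_vec [OF continuous_on_id] cont(2)] refl]
  show "integrable sphere_measure (\<lambda>\<omega>. zonal_plus k \<eta> \<omega> (M \<omega>))"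
    "integrable sphere_measure (\<lambda>\<omega>. zonal_minus k \<eta> \<omega> (M \<omega>))"
    "integrable sphere_measure (\<lambda>\<omega>. zonal_plus k \<eta> \<omega> (cl_vec \<omega> \<odot> M \<omega>))"
    "integrable sphere_measure (\<lambda>\<omega>. zonal_minus k \<eta> \<omega> (cl_vec \<omega> \<odot> M \<omega>))"
    by (rule A B)+
qed

end


section \<open>Integration against the kernel\<close>

lemma measurable_bessel_J [measurable]:
  assumes [measurable]: "f \<in> borel_measurable N"
  shows "(\<lambda>x. bessel_J \<nu> (f x)) \<in> borel_measurable N"
  unfolding bessel_J_def by measurable

lemma measurable_gegenbauer [measurable]:
  assumes [measurable]: "f \<in> borel_measurable N"
  shows "(\<lambda>x. gegenbauer k \<mu> (f x)) \<in> borel_measurable N"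
  unfolding gegenbauer_def by measurable

lemma measurable_gegenbauer_pred [measurable]:
  assumes [measurable]: "f \<in> borel_measurable N"
  shows "(\<lambda>x. gegenbauer_pred k \<mu> (f x)) \<in> borel_measurable N"
  unfolding gegenbauer_pred_def by (cases k) auto

lemma measurable_cl_mult [measurable (raw)]:
  assumes "f \<in> borel_measurable N" "g \<in> borel_measurable N"
  shows "(\<lambda>x. f x \<odot> g x) \<in> borel_measurable N"
  by (rule borel_measurable_continuous_Pair [OF assms]) (intro continuous_on_cl_mult continuous_intros)

lemma measurable_scale_cl [measurable (raw)]:
  fixes f :: "'a \<Rightarrow> complex" and g :: "'a \<Rightarrow> complex ^ 'k::finite"
  assumes "f \<in> borel_measurable N" "g \<in> borel_measurable N"
  shows "(\<lambda>x. f x *s g x) \<in> borel_measurable N"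
  by (rule borel_measurable_continuous_Pair [OF assms])
    (unfold vector_scalar_mult_def, intro continuous_intros)

text \<open>The identities with raised parameter remove the limits that occur for m = 2 and leave
  countable sums of measurable functions; the wedge product is continuous by its expression through
  a product of vectors.\<close>

lemma measurable_kernel_K:
  fixes f :: "'a \<Rightarrow> real ^ 'n::{finite,linorder}"
  assumes f [measurable]: "f \<in> borel_measurable N"
  shows "(\<lambda>x. kernel_K c (f x) y) \<in> borel_measurable N"
proof -
  have [measurable]: "(\<lambda>x. cl_wedge (f x) y) \<in> borel_measurable N"
  proof (rule measurable_compose [OF f])
    have "continuous_on UNIV (\<lambda>x. - (cl_vec y \<odot> cl_vec x) - (x \<bullet> y) *\<^sub>R cl_one)"
      by (intro continuous_intros continuous_on_cl_mult continuous_on_cl_vec)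
    moreover have "(\<lambda>x. - (cl_vec y \<odot> cl_vec x) - (x \<bullet> y) *\<^sub>R cl_one) = (\<lambda>x. cl_wedge x y)"
      by (simp add: cl_vec_mult_cl_vec)
    ultimately show "(\<lambda>x. cl_wedge x y) \<in> borel_measurable borel"
      by (metis borel_measurable_continuous_onI)
  qed
  show ?thesis
    unfolding kernel_K_def Let_def kernel_A_def kernel_B_def gegenbauer_plus_eq gegenbauer_minus_eq
    by measurable
qed

text \<open>The uniform bounds of the terms are summed. The origin is excluded because the expansion
  needs z > 0.\<close>

lemma norm_kernel_K_mult_le:
  fixes y :: "real ^ 'n::{finite,linorder}"
  assumes c: "c > -1" and m: "CARD('n) \<ge> 2" and y: "y \<noteq> 0"
  obtains C where "C \<ge> 0"
    "\<And>x v. x \<noteq> 0 \<Longrightarrow> norm x \<le> R \<Longrightarrow> norm (kernel_K c x y \<odot> v) \<le> C * norm v"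
proof -
  obtain b where b: "summable b" "\<And>k. b k \<ge> 0"
    "\<And>k z \<eta> \<omega> v :: 'n cl. 0 < z \<Longrightarrow> z \<le> R * norm y \<Longrightarrow> norm \<eta> = 1 \<Longrightarrow> norm \<omega> = 1 \<Longrightarrow>
      norm (kernel_term c z k \<eta> \<omega> v) \<le> b k * norm v"
    using kernel_term_bound [OF c m, of "R * norm y"] by blast
  have "norm (kernel_K c x y \<odot> v) \<le> suminf b * norm v" if x: "x \<noteq> 0" "norm x \<le> R" for x v
  proof -
    have le: "norm (kernel_term c (norm x * norm y) k (sgn y) (sgn x) v) \<le> b k * norm v" for k
      using x y by (intro b(3)) (auto simp: norm_sgn intro: mult_right_mono)
    have "norm (\<Sum>k. kernel_term c (norm x * norm y) k (sgn y) (sgn x) v) \<le> (\<Sum>k. b k * norm v)"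
      by (rule norm_suminf_le [OF le]) (intro summable_mult2 b(1))
    then show ?thesis
      using sums_unique [OF kernel_expansion [OF c m x(1) y, of v]] suminf_mult2 [OF b(1), of "norm v"] by simp
  qed
  moreover have "suminf b \<ge> 0" by (rule suminf_nonneg [OF b(1,2)])
  ultimately show thesis using that by blast
qed

text \<open>Sum and average may be interchanged because on the sphere the terms are dominated by the
  summable sequence \<open>b k * D\<close>, with \<open>D\<close> a bound for F there.\<close>

lemma sums_integral_sphere_kernel:
  fixes y :: "real ^ 'n::{finite,linorder}" and F :: "real ^ 'n::{finite,linorder} \<Rightarrow> 'n cl"
  assumes c: "c > -1" and m: "CARD('n) \<ge> 2" and y: "y \<noteq> 0" and r: "r > 0"
    and F: "continuous_on UNIV F"
    and int: "\<And>k. integrable sphere_measure (\<lambda>\<omega>. zonal_plus k (sgn y) \<omega> (F \<omega>))"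
      "\<And>k. integrable sphere_measure (\<lambda>\<omega>. zonal_minus k (sgn y) \<omega> (F \<omega>))"
  shows "(\<lambda>k. bessel_P CARD('n) c k (r * norm y) *s (\<integral>\<omega>. zonal_plus k (sgn y) \<omega> (F \<omega>) \<partial>sphere_measure) +
      bessel_Q CARD('n) c k (r * norm y) *s (\<integral>\<omega>. zonal_minus k (sgn y) \<omega> (F \<omega>) \<partial>sphere_measure))
    sums (\<integral>\<omega>. kernel_K c (r *\<^sub>R \<omega>) y \<odot> F \<omega> \<partial>sphere_measure)"
    and "integrable sphere_measure (\<lambda>\<omega>. kernel_K c (r *\<^sub>R \<omega>) y \<odot> F \<omega>)"
proof -
  interpret finite_measure "sphere_measure :: (real, 'n) vec measure" by (rule finite_measure_sphere_measure)
  let ?z = "r * norm y"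
  let ?t = "\<lambda>k \<omega>. kernel_term c ?z k (sgn y) \<omega> (F \<omega>)"
  have z: "?z > 0" using y r by simp
  have [measurable]: "F \<in> borel_measurable borel"
    using F by (rule borel_measurable_continuous_onI)
  have bl: "bounded_linear (\<lambda>v :: 'n cl. a *s v)" for a
    by (rule bounded_linear_intro [where K = "norm a"])
      (simp_all add: norm_scale_cl scaleR_eq_scale vec_eq_iff distrib_left mult_ac)
  have i: "integrable sphere_measure (\<lambda>\<omega>. bessel_P CARD('n) c k ?z *s zonal_plus k (sgn y) \<omega> (F \<omega>))"
    "integrable sphere_measure (\<lambda>\<omega>. bessel_Q CARD('n) c k ?z *s zonal_minus k (sgn y) \<omega> (F \<omega>))" for k
    by (intro integrable_bounded_linear [OF bl] int)+
  have ti: "integrable sphere_measure (?t k)" for k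
    unfolding kernel_term_def by (intro Bochner_Integration.integrable_add i)
  have tI: "integral\<^sup>L sphere_measure (?t k) =
      bessel_P CARD('n) c k ?z *s (\<integral>\<omega>. zonal_plus k (sgn y) \<omega> (F \<omega>) \<partial>sphere_measure) +
      bessel_Q CARD('n) c k ?z *s (\<integral>\<omega>. zonal_minus k (sgn y) \<omega> (F \<omega>) \<partial>sphere_measure)" for k
    unfolding kernel_term_def Bochner_Integration.integral_add [OF i]
    by (simp only: integral_bounded_linear [OF bl] int)
  obtain b where b: "summable b" "\<And>k. b k \<ge> 0"
    "\<And>k t \<eta> \<omega> v :: 'n cl. 0 < t \<Longrightarrow> t \<le> ?z \<Longrightarrow> norm \<eta> = 1 \<Longrightarrow> norm \<omega> = 1 \<Longrightarrow>
      norm (kernel_term c t k \<eta> \<omega> v) \<le> b k * norm v"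
    using kernel_term_bound [OF c m, of ?z] by blast
  have "compact (F ` sphere 0 1)"
    using F by (intro compact_continuous_image) (auto intro: continuous_on_subset)
  then obtain D where D: "\<forall>v\<in>F ` sphere 0 1. norm v \<le> D"
    using compact_imp_bounded bounded_iff by metis
  have tle: "norm (?t k \<omega>) \<le> b k * D" if "norm \<omega> = 1" for k \<omega>
  proof -
    have "norm (?t k \<omega>) \<le> b k * norm (F \<omega>)"
      using that y z by (intro b(3)) (auto simp: norm_sgn)
    also have "\<dots> \<le> b k * D"
      using D that b(2) by (intro mult_left_mono) auto
    finally show ?thesis .
  qed
  have summ: "summable (\<lambda>k. b k * D)" by (intro summable_mult2 b(1))
  have s1: "AE \<omega> in sphere_measure. summable (\<lambda>k. norm (?t k \<omega>))"
    using AE_sphere_measure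
  proof eventually_elim
    case (elim \<omega>)
    show ?case by (rule summable_comparison_test' [OF summ]) (use tle [OF elim] in simp)
  qed
  have s2: "summable (\<lambda>k. \<integral>\<omega>. norm (?t k \<omega>) \<partial>sphere_measure)"
  proof (rule summable_comparison_test' [OF summ])
    fix k
    have "(\<integral>\<omega>. norm (?t k \<omega>) \<partial>sphere_measure) \<le> (\<integral>\<omega>. b k * D \<partial>(sphere_measure :: (real, 'n) vec measure))"
      by (rule integral_mono_AE) (use ti tle AE_sphere_measure in \<open>auto elim!: eventually_mono\<close>)
    also have "\<dots> = b k * D" by (simp only: integral_sphere_const)
    finally show "norm (\<integral>\<omega>. norm (?t k \<omega>) \<partial>sphere_measure) \<le> b k * D"
      by (simp add: integral_nonneg_AE)
  qed
  have AE: "AE \<omega> in sphere_measure. (\<Sum>k. ?t k \<omega>) = kernel_K c (r *\<^sub>R \<omega>) y \<odot> F \<omega>"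
    using AE_sphere_measure
  proof eventually_elim
    case (elim \<omega>)
    then have "r *\<^sub>R \<omega> \<noteq> 0" "norm (r *\<^sub>R \<omega>) = r" "sgn (r *\<^sub>R \<omega>) = \<omega>"
      using r by (auto simp: sgn_div_norm)
    then show ?case
      using sums_unique [OF kernel_expansion [OF c m _ y, of "r *\<^sub>R \<omega>" "F \<omega>"]] by simp
  qed
  have [measurable]: "(\<lambda>\<omega>. kernel_K c (r *\<^sub>R \<omega>) y) \<in> borel_measurable (sphere_measure :: (real, 'n) vec measure)"
    by (rule measurable_kernel_K) simp
  have M1: "(\<lambda>\<omega>. \<Sum>k. ?t k \<omega>) \<in> borel_measurable sphere_measure"
    by (rule borel_measurable_integrable, rule integrable_suminf [OF ti s1 s2])
  have M2: "(\<lambda>\<omega>. kernel_K c (r *\<^sub>R \<omega>) y \<odot> F \<omega>) \<in> borel_measurable sphere_measure"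
    by measurable
  show "integrable sphere_measure (\<lambda>\<omega>. kernel_K c (r *\<^sub>R \<omega>) y \<odot> F \<omega>)"
    using integrable_suminf [OF ti s1 s2] by (rule integrable_cong_AE_imp [OF _ M2]) (use AE in \<open>auto elim: eventually_mono\<close>)
  have "(\<integral>\<omega>. (\<Sum>k. ?t k \<omega>) \<partial>sphere_measure) = (\<integral>\<omega>. kernel_K c (r *\<^sub>R \<omega>) y \<odot> F \<omega> \<partial>sphere_measure)"
    by (rule integral_cong_AE [OF M1 M2 AE])
  then show "(\<lambda>k. bessel_P CARD('n) c k (r * norm y) *s (\<integral>\<omega>. zonal_plus k (sgn y) \<omega> (F \<omega>) \<partial>sphere_measure) +
      bessel_Q CARD('n) c k (r * norm y) *s (\<integral>\<omega>. zonal_minus k (sgn y) \<omega> (F \<omega>) \<partial>sphere_measure))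
    sums (\<integral>\<omega>. kernel_K c (r *\<^sub>R \<omega>) y \<odot> F \<omega> \<partial>sphere_measure)"
    using sums_integral [OF ti s1 s2] by (simp only: tI)
qed

text \<open>Only one term of each series can be nonzero. For \<omega> M it sits at index l + 1 of
  \<open>bessel_Q\<close>, whose entries lag by one, and therefore carries \<alpha> and \<gamma> of
  index l.\<close>

lemma integral_sphere_kernel_monogenic:
  fixes y :: "real ^ 'n::{finite,linorder}"
  assumes c: "c > -1" and m: "CARD('n) \<ge> 2" and y: "y \<noteq> 0" and r: "r > 0"
    and M: "M \<in> spherical_monogenics l"
  shows "(\<integral>\<omega>. kernel_K c (r *\<^sub>R \<omega>) y \<odot> M \<omega> \<partial>sphere_measure) =
      bessel_P CARD('n) c l (r * norm y) *s M (sgn y)"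
    and "integrable sphere_measure (\<lambda>\<omega>. kernel_K c (r *\<^sub>R \<omega>) y \<odot> M \<omega>)"
    and "(\<integral>\<omega>. kernel_K c (r *\<^sub>R \<omega>) y \<odot> (cl_vec \<omega> \<odot> M \<omega>) \<partial>sphere_measure) =
      bessel_Q CARD('n) c (Suc l) (r * norm y) *s (cl_vec (sgn y) \<odot> M (sgn y))"
    and "integrable sphere_measure (\<lambda>\<omega>. kernel_K c (r *\<^sub>R \<omega>) y \<odot> (cl_vec \<omega> \<odot> M \<omega>))"
proof -
  have n: "norm (sgn y) = 1" using y by (simp add: norm_sgn)
  note hp = spherical_monogenics_hpoly [OF M]
  note S1 = sums_integral_sphere_kernel [OF c m y r hpoly_continuous_on [OF hp]
      integrable_zonal_monogenic(1,2) [OF m M n], unfolded integral_zonal_monogenic [OF m M n]]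
  note S2 = sums_integral_sphere_kernel [OF c m y r hpoly_continuous_on [OF hpoly_cl_vec_mult [OF hp]]
      integrable_zonal_monogenic(3,4) [OF m M n], unfolded integral_zonal_monogenic [OF m M n]]
  show "integrable sphere_measure (\<lambda>\<omega>. kernel_K c (r *\<^sub>R \<omega>) y \<odot> M \<omega>)" by (rule S1(2))
  show "integrable sphere_measure (\<lambda>\<omega>. kernel_K c (r *\<^sub>R \<omega>) y \<odot> (cl_vec \<omega> \<odot> M \<omega>))" by (rule S2(2))
  let ?P = "bessel_P CARD('n) c l (r * norm y) *s M (sgn y)"
  let ?Q = "bessel_Q CARD('n) c (Suc l) (r * norm y) *s (cl_vec (sgn y) \<odot> M (sgn y))"
  have "(\<lambda>k. if k = l then ?P else 0) sums ?P" "(\<lambda>k. if k = Suc l then ?Q else 0) sums ?Q"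
    by (rule sums_single)+
  moreover have "(\<lambda>k. if k = l then ?P else 0) sums (\<integral>\<omega>. kernel_K c (r *\<^sub>R \<omega>) y \<odot> M \<omega> \<partial>sphere_measure)"
    using S1(1) by (rule sums_cong [THEN iffD1, rotated]) (auto simp: vector_smult_rzero)
  moreover have "(\<lambda>k. if k = Suc l then ?Q else 0) sums (\<integral>\<omega>. kernel_K c (r *\<^sub>R \<omega>) y \<odot> (cl_vec \<omega> \<odot> M \<omega>) \<partial>sphere_measure)"
    using S2(1) by (rule sums_cong [THEN iffD1, rotated]) (auto simp: vector_smult_rzero)
  ultimately show "(\<integral>\<omega>. kernel_K c (r *\<^sub>R \<omega>) y \<odot> M \<omega> \<partial>sphere_measure) = ?P"
    "(\<integral>\<omega>. kernel_K c (r *\<^sub>R \<omega>) y \<odot> (cl_vec \<omega> \<odot> M \<omega>) \<partial>sphere_measure) = ?Q"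
    using sums_unique2 by blast+
qed

section \<open>The transform of radial multiples\<close>

lemma distr_norm_lborel: "distr lborel borel (norm :: 'a \<Rightarrow> real) = radial_measure TYPE('a::euclidean_space)"
proof (rule measure_eqI)
  fix A assume "A \<in> sets (distr lborel borel (norm :: 'a \<Rightarrow> real))"
  then have A: "A \<in> sets borel" by simp
  have "emeasure (distr lborel borel (norm :: 'a \<Rightarrow> real)) A = emeasure lborel {x::'a. norm x \<in> A \<and> sgn x \<in> UNIV}"
    using A by (subst emeasure_distr) (auto intro!: arg_cong [where f = "emeasure lborel"])
  also have "\<dots> = emeasure (radial_measure TYPE('a)) A"
    using emeasure_polar_rectangle [OF A, of "UNIV :: 'a set"] by (simp add: emeasure_sphere_measure_UNIV)
  finally show "emeasure (distr lborel borel (norm :: 'a \<Rightarrow> real)) A = emeasure (radial_measure TYPE('a)) A" .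
qed simp

lemma def_h_nonneg: "def_h m c r \<ge> 0"
  by (simp add: def_h_def)

lemma measurable_def_h [measurable]:
  "f \<in> borel_measurable N \<Longrightarrow> (\<lambda>x. def_h m c (f x)) \<in> borel_measurable N"
  unfolding def_h_def by measurable

text \<open>In polar coordinates the weight becomes a nonnegative power of r, so it is bounded near
  the origin for every c > -1.\<close>

lemma def_h_times_power:
  assumes c: "c > -1" and m: "m \<ge> 1" and r: "r > 0"
  shows "def_h m c r * r ^ (m - 1) = r powr ((real m - 1) / (1 + c))"
proof -
  have "def_h m c r * r ^ (m - 1) = r powr (1 - (1 + real m * c) / (1 + c) + (real m - 1))"
  proof -
    have "r ^ (m - 1) = r powr (real m - 1)"
      using r m by (simp add: powr_realpow [symmetric] of_nat_diff)
    then show ?thesis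
      unfolding def_h_def by (simp only: powr_add)
  qed
  also have "1 - (1 + real m * c) / (1 + c) + (real m - 1) = (real m - 1) / (1 + c)"
    using c by (simp add: field_simps)
  finally show ?thesis .
qed

text \<open>The question is moved to the half-line through the distribution of the norm; there the
  density times the weight is bounded on (0, R].\<close>

lemma integrable_def_h_cball:
  assumes c: "c > -1"
  shows "integrable lborel (\<lambda>x::real ^ 'n::finite. indicator (cball 0 R) x * def_h CARD('n) c (norm x))"
proof -
  let ?m = "CARD('n)" and ?a = "(real CARD('n) - 1) / (1 + c)"
  let ?\<sigma> = "real CARD('n) * measure lborel (cball (0::real ^ 'n) 1)"
  have m: "?m \<ge> 1" using zero_less_card_finite [where 'a='n] by linarith
  let ?\<phi> = "\<lambda>r. indicator {..R} r * def_h ?m c r"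
  have [measurable]: "?\<phi> \<in> borel_measurable borel" by measurable
  have "integrable lborel (\<lambda>r. (indicator {0<..} r * (?\<sigma> * r ^ (?m - 1))) *\<^sub>R ?\<phi> r)"
  proof (rule Bochner_Integration.integrable_bound)
    show "integrable lborel (\<lambda>r::real. indicator {0..R} r *\<^sub>R (?\<sigma> * R powr ?a))"
      by (cases "0 \<le> R") (auto intro!: borel_integrable_compact)
    show "AE r in lborel. norm ((indicator {0<..} r * (?\<sigma> * r ^ (?m - 1))) *\<^sub>R ?\<phi> r) \<le>
        norm (indicator {0..R} r *\<^sub>R (?\<sigma> * R powr ?a))"
    proof (rule AE_I2)
      fix r :: real
      show "norm ((indicator {0<..} r * (?\<sigma> * r ^ (?m - 1))) *\<^sub>R ?\<phi> r) \<le>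
        norm (indicator {0..R} r *\<^sub>R (?\<sigma> * R powr ?a))"
      proof (cases "0 < r \<and> r \<le> R")
        case True
        have "def_h ?m c r * r ^ (?m - 1) \<le> R powr ?a"
          unfolding def_h_times_power [OF c m conjunct1 [OF True]]
          using True c m by (intro powr_mono2) auto
        then have "?\<sigma> * (def_h ?m c r * r ^ (?m - 1)) \<le> ?\<sigma> * R powr ?a"
          by (intro mult_left_mono) auto
        with True show ?thesis by (simp add: abs_mult def_h_nonneg mult_ac)
      qed (auto simp: indicator_def)
    qed
  qed measurable
  then have "integrable (radial_measure TYPE(real ^ 'n)) ?\<phi>"
    unfolding radial_measure_def by (subst integrable_density) (auto simp: indicator_def)
  then have "integrable (distr lborel borel (norm :: real ^ 'n \<Rightarrow> real)) ?\<phi>"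
    by (simp only: distr_norm_lborel)
  then have "integrable lborel (\<lambda>x::real ^ 'n. ?\<phi> (norm x))"
    by (subst (asm) integrable_distr_eq) auto
  then show ?thesis by (simp add: indicator_def)
qed

text \<open>\<Gamma>(m/2 + 1) = (m/2) \<Gamma>(m/2) matches the two constants. The one on the right
  comes from \<open>radial_measure\<close>, so the prefactor of the transform cancels.\<close>

lemma def_sigma_eq: "def_sigma CARD('n) = real CARD('n) * measure lborel (cball (0::real ^ 'n::finite) 1)"
proof -
  let ?m = "real CARD('n)"
  have m: "?m / 2 > 0" using zero_less_card_finite [where 'a='n] by simp
  have "measure lborel (cball (0::real ^ 'n) 1) = unit_ball_vol ?m"
    by (simp add: content_cball)
  also have "\<dots> = pi powr (?m / 2) / (?m / 2 * Gamma (?m / 2))"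
  proof -
    have "?m / 2 \<notin> \<int>\<^sub>\<le>\<^sub>0" using m nonpos_Ints_nonpos [of "?m / 2"] by auto
    from Gamma_plus1 [OF this] show ?thesis by (simp only: unit_ball_vol_def)
  qed
  finally show ?thesis using m by (simp add: def_sigma_def)
qed

text \<open>Common to both formulas, with F = M or F = x M and J the surviving Bessel factor. Square
  integrability is used for absolute convergence on balls; the assumption on the radial integral
  carries the limit over R.\<close>

lemma deformed_fourier_radial:
  fixes y :: "real ^ 'n::{finite,linorder}" and F :: "real ^ 'n::{finite,linorder} \<Rightarrow> 'n cl"
  assumes c: "c > -1" and m: "CARD('n) \<ge> 2" and y: "y \<noteq> 0"
    and F: "hpoly d F"
    and f: "(\<lambda>r. indicator {0<..} r *\<^sub>R f r) \<in> borel_measurable borel"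
    and L2: "(\<lambda>x. f (norm x) *s F x) \<in> L2_0c c"
    and I: "\<And>r. r > 0 \<Longrightarrow> (\<integral>\<omega>. kernel_K c (r *\<^sub>R \<omega>) y \<odot> F \<omega> \<partial>sphere_measure) = J r *s v"
      "\<And>r. r > 0 \<Longrightarrow> integrable sphere_measure (\<lambda>\<omega>. kernel_K c (r *\<^sub>R \<omega>) y \<odot> F \<omega>)"
    and int: "set_integrable lborel {0<..} (\<lambda>r. of_real (r ^ d * def_h CARD('n) c r * r ^ (CARD('n) - 1)) * f r * J r)"
  shows "deformed_fourier c (\<lambda>x. f (norm x) *s F x) y =
    (LINT r:{0<..}|lborel. of_real (r ^ d * def_h CARD('n) c r * r ^ (CARD('n) - 1)) * f r * J r) *s v"
proof -
  let ?m = "CARD('n)" and ?h = "def_h CARD('n) c"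
  let ?u = "\<lambda>x. f (norm x) *s F x"
  let ?G = "\<lambda>r. of_real (r ^ d * ?h r * r ^ (?m - 1)) * f r * J r"
  \<comment> \<open>Measurability of f is given only for r > 0; the cut-off version makes the
    integrand jointly measurable in (r, \<omega>).\<close>
  define g where "g r = indicator {0<..} r *\<^sub>R f r" for r :: real
  have g [measurable]: "g \<in> borel_measurable borel" using f by (simp add: g_def [abs_def])
  have F' [measurable]: "F \<in> borel_measurable borel"
    using hpoly_continuous_on [OF F] by (rule borel_measurable_continuous_onI)
  have u [measurable]: "?u \<in> borel_measurable borel"
    and uint: "integrable lborel (\<lambda>x. ?h (norm x) * (norm (?u x))\<^sup>2)"
    using L2 by (auto simp: L2_0c_def)
  have blv: "bounded_linear (\<lambda>a. a *s v)"
    by (rule bounded_linear_intro [where K = "norm v"])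
      (simp_all add: norm_scale_cl scaleR_eq_scale vec_eq_iff distrib_right scaleR_conv_of_real)
  have bl: "bounded_linear (\<lambda>v :: 'n cl. a *s v)" for a
    by (rule bounded_linear_intro [where K = "norm a"])
      (simp_all add: norm_scale_cl scaleR_eq_scale vec_eq_iff distrib_left mult_ac)
  have ball: "(LINT x:cball 0 R|lborel. ?h (norm x) *\<^sub>R (kernel_K c x y \<odot> ?u x)) =
      def_sigma ?m *\<^sub>R ((LINT r:{0<..}|lborel. indicator {..R} r *\<^sub>R ?G r) *s v)" if R: "R > 0" for R
  proof -
    define \<Phi> where "\<Phi> p = (case p of (r, \<omega>) \<Rightarrow> (indicator {..R} r * ?h r * r ^ d) *\<^sub>R (kernel_K c (r *\<^sub>R \<omega>) y \<odot> (g r *s F \<omega>)))"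
      for p :: "real \<times> ((real, 'n) vec)"
    have [measurable]: "(\<lambda>p :: real \<times> ((real, 'n) vec). kernel_K c (fst p *\<^sub>R snd p) y) \<in> borel_measurable (borel \<Otimes>\<^sub>M borel)"
      by (rule measurable_kernel_K) measurable
    have \<Phi>m [measurable]: "\<Phi> \<in> borel_measurable (borel \<Otimes>\<^sub>M borel)"
      unfolding \<Phi>_def split_beta by measurable
    have K [measurable]: "(\<lambda>x. kernel_K c x y) \<in> borel_measurable borel"
      by (rule measurable_kernel_K) simp
    have eq: "indicator (cball 0 R) x *\<^sub>R (?h (norm x) *\<^sub>R (kernel_K c x y \<odot> ?u x)) = \<Phi> (norm x, sgn x)"
      if "x \<noteq> 0" for x :: "(real, 'n) vec"
    proof -
      have x: "norm x *\<^sub>R sgn x = x" using that by (simp add: sgn_div_norm)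
      have "F x = norm x ^ d *\<^sub>R F (sgn x)"
        using hpoly_scaleR_arg [OF F, of "norm x" "sgn x"] by (simp add: x)
      then have "kernel_K c x y \<odot> ?u x = norm x ^ d *\<^sub>R (kernel_K c x y \<odot> (g (norm x) *s F (sgn x)))"
        using that by (simp add: g_def cl_mult_scale_right cl.scaleR_right scaleR_eq_scale vector_smult_assoc mult.commute)
      then show ?thesis
        by (simp add: \<Phi>_def x indicator_def)
    qed
    obtain C where C: "C \<ge> 0" "\<And>x v. x \<noteq> 0 \<Longrightarrow> norm x \<le> R \<Longrightarrow> norm (kernel_K c x y \<odot> v) \<le> C * norm v"
      using norm_kernel_K_mult_le [OF c m y] by blast
    have int\<Phi>: "integrable lborel (\<lambda>x. \<Phi> (norm x, sgn x))"
    \<comment> \<open>The kernel is bounded on the ball, and t \<le> 1 + t^2 splits the bound into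
      the weight, integrable on the ball, and the weighted square of the function, integrable by
      assumption.\<close>
    proof (rule Bochner_Integration.integrable_bound)
      show "integrable lborel (\<lambda>x. C * (indicator (cball 0 R) x * ?h (norm x) + ?h (norm x) * (norm (?u x))\<^sup>2))"
        by (intro integrable_mult_right Bochner_Integration.integrable_add integrable_def_h_cball [OF c] uint)
      show "(\<lambda>x. \<Phi> (norm x, sgn x)) \<in> borel_measurable lborel" by measurable
      show "AE x in lborel. norm (\<Phi> (norm x, sgn x)) \<le>
          norm (C * (indicator (cball 0 R) x * ?h (norm x) + ?h (norm x) * (norm (?u x))\<^sup>2))"
        using AE_lborel_singleton [of "0 :: (real, 'n) vec"]
      proof eventually_elim
        case (elim x)
        show ?case
        proof (cases "norm x \<le> R")
          case True
          have "norm (\<Phi> (norm x, sgn x)) = ?h (norm x) * norm (kernel_K c x y \<odot> ?u x)"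
            using elim True by (simp add: eq [symmetric] def_h_nonneg)
          also have "\<dots> \<le> ?h (norm x) * (C * norm (?u x))"
            using C(2) [OF elim True] def_h_nonneg by (rule mult_left_mono)
          also have "\<dots> \<le> ?h (norm x) * (C * (1 + (norm (?u x))\<^sup>2))"
          proof (intro mult_left_mono C(1) def_h_nonneg)
            show "norm (?u x) \<le> 1 + (norm (?u x))\<^sup>2"
              using sum_squares_bound [of 1 "norm (?u x)"] norm_ge_zero [of "?u x"] by (simp only: power_one)
          qed
          also have "\<dots> = C * (indicator (cball 0 R) x * ?h (norm x) + ?h (norm x) * (norm (?u x))\<^sup>2)"
            using True by (simp add: algebra_simps)
          also have "\<dots> \<le> norm \<dots>" by simp
          finally show ?thesis .
        next
          case False
          with elim have "\<Phi> (norm x, sgn x) = 0" by (simp add: \<Phi>_def)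
          then show ?thesis by simp
        qed
      qed
    qed
    have inner: "(\<integral>\<omega>. \<Phi> (r, \<omega>) \<partial>sphere_measure) = ((indicator {..R} r * ?h r * r ^ d) *\<^sub>R (g r * J r)) *s v" if "r > 0" for r
    proof -
      have "(\<integral>\<omega>. \<Phi> (r, \<omega>) \<partial>sphere_measure) =
          (\<integral>\<omega>. (indicator {..R} r * ?h r * r ^ d) *\<^sub>R (g r *s (kernel_K c (r *\<^sub>R \<omega>) y \<odot> F \<omega>)) \<partial>sphere_measure)"
        by (simp add: \<Phi>_def cl_mult_scale_right)
      also have "\<dots> = (indicator {..R} r * ?h r * r ^ d) *\<^sub>R (g r *s (J r *s v))"
        by (simp only: integral_scaleR_right integral_bounded_linear [OF bl I(2) [OF that]] I(1) [OF that])
      finally show ?thesis by (simp add: scaleR_eq_scale vector_smult_assoc scaleR_conv_of_real mult.assoc)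
    qed
    have "(LINT x:cball 0 R|lborel. ?h (norm x) *\<^sub>R (kernel_K c x y \<odot> ?u x)) = (\<integral>x. \<Phi> (norm x, sgn x) \<partial>lborel)"
      unfolding set_lebesgue_integral_def
    proof (rule integral_cong_AE)
      show "AE x in lborel. indicat_real (cball 0 R) x *\<^sub>R ?h (norm x) *\<^sub>R (kernel_K c x y \<odot> ?u x) = \<Phi> (norm x, sgn x)"
        using AE_lborel_singleton [of "0 :: (real, 'n) vec"] by eventually_elim (rule eq)
      have "(\<lambda>x. ?h (norm x) *\<^sub>R (kernel_K c x y \<odot> ?u x)) \<in> borel_measurable borel"
        by (intro borel_measurable_scaleR measurable_cl_mult K u measurable_def_h borel_measurable_norm measurable_ident)
      then show "(\<lambda>x. indicat_real (cball 0 R) x *\<^sub>R ?h (norm x) *\<^sub>R (kernel_K c x y \<odot> ?u x)) \<in> borel_measurable lborel"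
        by (intro borel_measurable_scaleR borel_measurable_indicator) simp_all
      show "(\<lambda>x. \<Phi> (norm x, sgn x)) \<in> borel_measurable lborel" by measurable
    qed
    also have "\<dots> = (\<integral>r. (\<integral>\<omega>. \<Phi> (r, \<omega>) \<partial>sphere_measure) \<partial>radial_measure TYPE((real, 'n) vec))"
      by (rule integral_polar [OF \<Phi>m int\<Phi>])
    also have "\<dots> = def_sigma ?m *\<^sub>R (LINT r:{0<..}|lborel. r ^ (?m - 1) *\<^sub>R (\<integral>\<omega>. \<Phi> (r, \<omega>) \<partial>sphere_measure))"
    proof -
      have "(\<lambda>r. \<integral>\<omega>. \<Phi> (r, \<omega>) \<partial>sphere_measure) \<in> borel_measurable borel"
        using borel_measurable_integrable [OF integrable_polar [OF \<Phi>m int\<Phi>]] by simp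
      from integral_radial_measure [OF this, where 'a = "(real, 'n) vec"] show ?thesis
        by (simp add: def_sigma_eq)
    qed
    also have "(LINT r:{0<..}|lborel. r ^ (?m - 1) *\<^sub>R (\<integral>\<omega>. \<Phi> (r, \<omega>) \<partial>sphere_measure)) =
        (LINT r:{0<..}|lborel. (indicator {..R} r *\<^sub>R ?G r) *s v)"
      unfolding set_lebesgue_integral_def
      by (rule Bochner_Integration.integral_cong [OF refl])
        (auto simp: inner g_def scaleR_eq_scale vector_smult_assoc scaleR_conv_of_real mult_ac indicator_def)
    also have "\<dots> = (\<integral>r. (indicator {0<..} r *\<^sub>R indicator {..R} r *\<^sub>R ?G r) *s v \<partial>lborel)"
      unfolding set_lebesgue_integral_def
      by (rule Bochner_Integration.integral_cong [OF refl]) (auto simp: indicator_def)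
    also have "\<dots> = (LINT r:{0<..}|lborel. indicator {..R} r *\<^sub>R ?G r) *s v"
    proof -
      have "integrable lborel (\<lambda>r. indicator {..R} r *\<^sub>R (indicator {0<..} r *\<^sub>R ?G r))"
        by (rule integrable_mult_indicator) (use int in \<open>simp_all only: set_integrable_def sets_lborel atMost_borel\<close>)
      then have "integrable lborel (\<lambda>r. indicator {0<..} r *\<^sub>R indicator {..R} r *\<^sub>R ?G r)"
        by (subst scaleR_left_commute)
      from integral_bounded_linear [OF blv this] show ?thesis
        unfolding set_lebesgue_integral_def .
    qed
    finally show ?thesis .
  qed
  \<comment> \<open>Absolute convergence over the half-line dominates the integrals over (0, R], so
    they tend to the full radial integral.\<close>
  have "((\<lambda>R. LINT r:{0<..}|lborel. indicator {..R} r *\<^sub>R ?G r) \<longlongrightarrow> (LINT r:{0<..}|lborel. ?G r)) at_top"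
    unfolding set_lebesgue_integral_def
  proof (rule integral_dominated_convergence_at_top)
    let ?H = "\<lambda>r. indicat_real {0<..} r *\<^sub>R ?G r"
    have H: "integrable lborel ?H" using int by (simp add: set_integrable_def)
    then show Hm [measurable]: "?H \<in> borel_measurable lborel" by (rule borel_measurable_integrable)
    show "integrable lborel (\<lambda>r. norm (?H r))" using H by (rule integrable_norm)
    show "(\<lambda>r. indicat_real {0<..} r *\<^sub>R indicat_real {..R} r *\<^sub>R ?G r) \<in> borel_measurable lborel" for R
    proof -
      have "(\<lambda>r. indicat_real {..R} r *\<^sub>R ?H r) \<in> borel_measurable lborel" by measurable
      then show ?thesis by (subst scaleR_left_commute)
    qed
    show "AE r in lborel. ((\<lambda>R. indicat_real {0<..} r *\<^sub>R indicat_real {..R} r *\<^sub>R ?G r) \<longlongrightarrow> ?H r) at_top"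
    proof (rule AE_I2, rule tendsto_eventually)
      fix r :: real
      show "\<forall>\<^sub>F R in at_top. indicat_real {0<..} r *\<^sub>R indicat_real {..R} r *\<^sub>R ?G r = ?H r"
        using eventually_ge_at_top [of r] by eventually_elim simp
    qed
    show "\<forall>\<^sub>F R in at_top. AE r in lborel. norm (indicat_real {0<..} r *\<^sub>R indicat_real {..R} r *\<^sub>R ?G r) \<le> norm (?H r)"
      by (intro always_eventually allI AE_I2) (simp add: indicator_def)
  qed
  then have lim: "((\<lambda>R. (LINT r:{0<..}|lborel. indicator {..R} r *\<^sub>R ?G r) *s v) \<longlongrightarrow> (LINT r:{0<..}|lborel. ?G r) *s v) at_top"
    by (rule bounded_linear.tendsto [OF blv])
  have \<sigma>: "def_sigma ?m \<noteq> 0"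
    using m by (simp add: def_sigma_def Gamma_eq_zero_iff nonpos_Ints_def)
  have "((\<lambda>R. inverse (def_sigma ?m) *\<^sub>R (LINT x:cball 0 R|lborel. ?h (norm x) *\<^sub>R (kernel_K c x y \<odot> ?u x))) \<longlongrightarrow>
      (LINT r:{0<..}|lborel. ?G r) *s v) at_top"
    using lim
  proof (rule Lim_transform_eventually)
    show "\<forall>\<^sub>F R in at_top. (LINT r:{0<..}|lborel. indicator {..R} r *\<^sub>R ?G r) *s v =
        inverse (def_sigma ?m) *\<^sub>R (LINT x:cball 0 R|lborel. ?h (norm x) *\<^sub>R (kernel_K c x y \<odot> ?u x))"
      using eventually_gt_at_top [of 0] by eventually_elim (simp only: ball scaleR_scaleR, simp add: \<sigma>)
  qed
  then show ?thesis
    unfolding deformed_fourier_def by (intro tendsto_Lim) simp_all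
qed

theorem proposition7p2:
  fixes c s :: real and l :: nat
    and M :: "real ^ 'n::{finite,linorder} \<Rightarrow> 'n cl"
    and f :: "real \<Rightarrow> complex"
    and y y' :: "real ^ 'n::{finite,linorder}"
  assumes m: "CARD('n) \<ge> 2"
    and c: "c > -1"
    and M: "M \<in> spherical_monogenics l"
    and L2: "(\<lambda>x. f (norm x) *s M x) \<in> L2_0c c"
      "(\<lambda>x. f (norm x) *s (cl_vec x \<odot> M x)) \<in> L2_0c c"
    and y: "s = norm y" "s > 0" "y = s *\<^sub>R y'" "y' \<in> sphere 0 1"
    and abs_conv:
      "set_integrable lborel {0<..} (\<lambda>r. of_real r ^ l * f r *
         of_real ((r * s) powr (- (def_delta CARD('n) c - 2) / 2) *
           bessel_J (def_gamma CARD('n) c (int l) / 2 - 1) (r * s) *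
           def_h CARD('n) c r * r ^ (CARD('n) - 1)))"
      "set_integrable lborel {0<..} (\<lambda>r. of_real r ^ (l + 1) * f r *
         of_real ((r * s) powr (- (def_delta CARD('n) c - 2) / 2) *
           bessel_J (def_gamma CARD('n) c (int l) / 2) (r * s) *
           def_h CARD('n) c r * r ^ (CARD('n) - 1)))"
  shows "(deformed_fourier c (\<lambda>x. f (norm x) *s M x) y =
      (exp (- (\<i> * of_real pi * of_nat l / (2 * (1 + of_real c)))) *
        (LINT r:{0<..}|lborel. of_real r ^ l * f r *
           of_real ((r * s) powr (- (def_delta CARD('n) c - 2) / 2) *
             bessel_J (def_gamma CARD('n) c (int l) / 2 - 1) (r * s) *
             def_h CARD('n) c r * r ^ (CARD('n) - 1)))) *s M y')
    \<and> (deformed_fourier c (\<lambda>x. f (norm x) *s (cl_vec x \<odot> M x)) y =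
      (- \<i> * exp (- (\<i> * of_real pi * of_nat l / (2 * (1 + of_real c)))) *
        (LINT r:{0<..}|lborel. of_real r ^ (l + 1) * f r *
           of_real ((r * s) powr (- (def_delta CARD('n) c - 2) / 2) *
             bessel_J (def_gamma CARD('n) c (int l) / 2) (r * s) *
             def_h CARD('n) c r * r ^ (CARD('n) - 1)))) *s (cl_vec y' \<odot> M y'))"
proof -
  let ?m = "CARD('n)" and ?h = "def_h CARD('n) c"
  let ?e = "exp (- (\<i> * of_real pi * of_nat l / (2 * (1 + of_real c)))) :: complex"
  let ?G1 = "\<lambda>r. of_real r ^ l * f r *
         of_real ((r * s) powr (- (def_delta CARD('n) c - 2) / 2) *
           bessel_J (def_gamma CARD('n) c (int l) / 2 - 1) (r * s) *
           def_h CARD('n) c r * r ^ (CARD('n) - 1))"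
  let ?G2 = "\<lambda>r. of_real r ^ (l + 1) * f r *
         of_real ((r * s) powr (- (def_delta CARD('n) c - 2) / 2) *
           bessel_J (def_gamma CARD('n) c (int l) / 2) (r * s) *
           def_h CARD('n) c r * r ^ (CARD('n) - 1))"
  have y0: "y \<noteq> 0" and ny: "norm y = s" and y': "norm y' = 1" and sy: "sgn y = y'"
    using y by (auto simp: sgn_div_norm)
  note hp = spherical_monogenics_hpoly [OF M]
  show ?thesis
  \<comment> \<open>If M vanishes on the sphere, it vanishes everywhere and both formulas read 0 =
    0. Otherwise a point of the sphere where M is nonzero serves to recover the measurability of
    f.\<close>
  proof (cases "\<exists>\<omega>. norm \<omega> = 1 \<and> M \<omega> \<noteq> 0")
    case False
    have M0: "M x = 0" for x
    proof -
      obtain \<omega> where \<omega>: "norm \<omega> = 1" "x = norm x *\<^sub>R \<omega>"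
      proof (cases "x = 0")
        case True
        then show thesis using that [of y'] y' by simp
      next
        case False
        then show thesis using that [of "sgn x"] by (simp add: norm_sgn sgn_div_norm)
      qed
      have "M (norm x *\<^sub>R \<omega>) = norm x ^ l *\<^sub>R M \<omega>"
        by (rule hpoly_scaleR_arg [OF hp])
      with \<omega> False show ?thesis by simp
    qed
    have "deformed_fourier c (\<lambda>x. 0) y = (0 :: 'n cl)"
      unfolding deformed_fourier_def by (simp add: cl.zero_right set_lebesgue_integral_def tendsto_Lim)
    then show ?thesis by (simp add: M0 cl.zero_right)
  next
    case True
    then obtain \<omega> where \<omega>: "norm \<omega> = 1" "M \<omega> \<noteq> 0" by blast
    then obtain A where A: "M \<omega> $ A \<noteq> 0" by (auto simp: vec_eq_iff)
    let ?u = "\<lambda>x. f (norm x) *s M x"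
    have f: "(\<lambda>r. indicator {0<..} r *\<^sub>R f r) \<in> borel_measurable borel"
    proof -
      have [measurable]: "?u \<in> borel_measurable borel" using L2(1) by (simp add: L2_0c_def)
      have "(\<lambda>r. ?u (r *\<^sub>R \<omega>)) \<in> borel_measurable borel"
        by (rule measurable_compose [where g = ?u and N = borel]) measurable
      then have [measurable]: "(\<lambda>r. ?u (r *\<^sub>R \<omega>) $ A) \<in> borel_measurable borel"
        by (rule measurable_compose) (intro borel_measurable_continuous_onI continuous_intros)
      \<comment> \<open>Along the ray through \<omega> the equation M(r \<omega>) = r^l M(\<omega>)
        can be solved for f, dividing by a nonzero coefficient of M(\<omega>).\<close>
      have "(\<lambda>r. indicator {0<..} r *\<^sub>R f r) =
          (\<lambda>r. indicator {0<..} r *\<^sub>R (?u (r *\<^sub>R \<omega>) $ A / (of_real r ^ l * (M \<omega> $ A))))"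
      proof
        fix r :: real
        show "indicator {0<..} r *\<^sub>R f r = indicator {0<..} r *\<^sub>R (?u (r *\<^sub>R \<omega>) $ A / (of_real r ^ l * (M \<omega> $ A)))"
        proof (cases "r > 0")
          case True
          have "M (r *\<^sub>R \<omega>) $ A = of_real r ^ l * (M \<omega> $ A)"
            by (simp add: hpoly_scaleR_arg [OF hp] scaleR_conv_of_real [where 'a = complex])
          then show ?thesis using True A \<omega> by simp
        qed simp
      qed
      also have "\<dots> \<in> borel_measurable borel" by measurable
      finally show ?thesis .
    qed
    have G1: "of_real (r ^ l * ?h r * r ^ (?m - 1)) * f r * bessel_P ?m c l (r * s) = ?e * ?G1 r" for r
      by (simp add: bessel_P_def def_alpha_def mult_ac)
    \<comment> \<open>At index l + 1, \<open>bessel_Q\<close> contains \<alpha> and \<gamma> at l;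
      this is the origin of the factor -\<i> and of the Bessel order in the second formula.\<close>
    have G2: "of_real (r ^ Suc l * ?h r * r ^ (?m - 1)) * f r * bessel_Q ?m c (Suc l) (r * s) = (- \<i> * ?e) * ?G2 r" for r
      by (simp add: bessel_Q_def def_alpha_def mult_ac)
    have T1: "deformed_fourier c (\<lambda>x. f (norm x) *s M x) y =
        (LINT r:{0<..}|lborel. of_real (r ^ l * ?h r * r ^ (?m - 1)) * f r * bessel_P ?m c l (r * s)) *s M y'"
    proof (rule deformed_fourier_radial [OF c m y0 hp f L2(1)])
      show "set_integrable lborel {0<..} (\<lambda>r. of_real (r ^ l * ?h r * r ^ (?m - 1)) * f r * bessel_P ?m c l (r * s))"
        unfolding G1 using abs_conv(1) by (intro set_integrable_mult_right) simp
    qed (use integral_sphere_kernel_monogenic(1,2) [OF c m y0 _ M] in \<open>simp_all add: ny sy\<close>)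
    have T2: "deformed_fourier c (\<lambda>x. f (norm x) *s (cl_vec x \<odot> M x)) y =
        (LINT r:{0<..}|lborel. of_real (r ^ Suc l * ?h r * r ^ (?m - 1)) * f r * bessel_Q ?m c (Suc l) (r * s)) *s (cl_vec y' \<odot> M y')"
    proof (rule deformed_fourier_radial [OF c m y0 hpoly_cl_vec_mult [OF hp] f L2(2)])
      show "set_integrable lborel {0<..} (\<lambda>r. of_real (r ^ Suc l * ?h r * r ^ (?m - 1)) * f r * bessel_Q ?m c (Suc l) (r * s))"
        unfolding G2 using abs_conv(2) by (intro set_integrable_mult_right) simp
    qed (use integral_sphere_kernel_monogenic(3,4) [OF c m y0 _ M] in \<open>simp_all add: ny sy\<close>)
    show ?thesis
      unfolding T1 T2 G1 G2 set_integral_mult_right by blast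
  qed
qed

end
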